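(* Let $a\in\mathbb C^n$, $c_0\in\mathbb R$ and $b_k\in\mathbb R$ for $k=1,2,\dots,n$. Assume that $b_k\neq0$ for each $k=1,2,\dots,n$ and consider the polynomial $$P(z)=ic_0+\bar az-a\bar z+i\sum_{k=1}^nb_k|z_k|^2,\qquad z\in\mathbb C^n.$$ Then $$\begin{aligned}\exp_{\ast_0}(P)(z)=\;&e^{ic_0}\left(\prod_{k=1}^n\cos(\tfrac1\lambda b_k)\right)^{-1}\exp\left(i\lambda\sum_{k=1}^n|a_k|^2\left(-\tfrac1{\lambda b_k}+\tfrac1{b_k^2}\tan\left(\tfrac1\lambda b_k\right)\right)\right)\\ &\times\exp\left(i\lambda\sum_{k=1}^n|z_k|^2\tan\left(\tfrac1\lambda b_k\right)\right)\exp\left(\lambda\sum_{k=1}^n\tfrac1{b_k}\tan\left(\tfrac1\lambda b_k\right)(z_k\overline{a_k}-a_k\overline{z_k})\right).\end{aligned}$$ In particular, if $a=0$ and $c_0=0$, then $$\exp_{\ast_0}\left(i\sum_{k=1}^nb_k|z_k|^2\right)=\left(\prod_{k=1}^n\cos(\tfrac1\lambda b_k)\right)^{-1}\exp\left(i\lambda\sum_{k=1}^n|z_k|^2\tan\left(\tfrac1\lambda b_k\right)\right).$$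
   Context: Fix $\lambda>0$. For $z,w\in\mathbb C^n$, $zw:=\sum_{k=1}^n z_kw_k$ (bilinear). $\mathcal F_\lambda$ is the Hilbert space of holomorphic functions $f$ on $\mathbb C^n$ with $\int_{\mathbb C^n}|f(z)|^2e^{-\lambda|z|^2/2}\,d\mu_\lambda(z)<\infty$, where $d\mu_\lambda(z)=(2\pi)^{-n}\lambda^n\,dx\,dy$, $z=x+iy$. With $e_z(w)=\exp(\lambda\bar zw/2)$ and $k_A(z,w)=\langle Ae_w,e_z\rangle_{\mathcal F_\lambda}$, the complex Weyl symbol of an operator $A$ on $\mathcal F_\lambda$ is the function on $\mathbb C^n$ $$W_0(A)(z)=2^n\int_{\mathbb C^n}k_A(z+w,z-w)\exp\left(\tfrac\lambda2(-z\bar z-w\bar w+z\bar w-\bar zw)\right)d\mu_\lambda(w);$$ this formula applies in particular to trace class operators and to differential operators with polynomial coefficients. The associative product $\ast_0$ on functions on $\mathbb C^n$ is defined by $W_0^{-1}(f\ast_0g)=W_0^{-1}(f)W_0^{-1}(g)$. The star exponential of a function $f$ on $\mathbb C^n$ is $$\exp_{\ast_0}(f):=\sum_{k\ge0}\frac1{k!}f^{\ast_0,k},\qquad f^{\ast_0,k}=f\ast_0\cdots\ast_0f\ (k\text{ times}).$$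
   Formalization: It is assumed that cos(b_k/λ) ≠ 0 for all k, since otherwise the right side is undefined; the star exponential series is summed as operators on coherent states and then mapped by W_0, and also pointwise when all |b_k| < λπ/2 (the pointwise series can diverge for larger b_k). *)

theory Defs
  imports "HOL-Analysis.Analysis"
begin

definition bil :: "complex^'n \<Rightarrow> complex^'n \<Rightarrow> complex" where
  "bil z w = (\<Sum>k\<in>UNIV. z $ k * w $ k)"

definition cnjv :: "complex^'n \<Rightarrow> complex^'n" where
  "cnjv z = (\<chi> k. cnj (z $ k))"

text \<open>Holomorphic on all of \<open>\<complex>\<^sup>n\<close>: the real Frechet derivative exists and is complex linear.\<close>

definition entire_fun :: "(complex^'n \<Rightarrow> complex) \<Rightarrow> bool" where
  "entire_fun f \<longleftrightarrow>
     (\<forall>z. \<exists>f'. (f has_derivative f') (at z) \<and> (\<forall>c v. f' (c *s v) = c * f' v))"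

definition mu :: "real \<Rightarrow> (complex^'n) measure" where
  "mu lam = density lborel (\<lambda>_. ennreal ((2 * pi) powi (- int CARD('n)) * lam ^ CARD('n)))"

definition fock :: "real \<Rightarrow> (complex^'n \<Rightarrow> complex) set" where
  "fock lam = {f. entire_fun f \<and>
     integrable (mu lam) (\<lambda>z. (cmod (f z))\<^sup>2 * exp (- lam * (norm z)\<^sup>2 / 2))}"

definition fock_inner ::
  "real \<Rightarrow> (complex^'n \<Rightarrow> complex) \<Rightarrow> (complex^'n \<Rightarrow> complex) \<Rightarrow> complex" where
  "fock_inner lam f g =
     (LINT z|mu lam. f z * cnj (g z) * of_real (exp (- lam * (norm z)\<^sup>2 / 2)))"

definition fock_norm :: "real \<Rightarrow> (complex^'n \<Rightarrow> complex) \<Rightarrow> real" where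
  "fock_norm lam f = sqrt (Re (fock_inner lam f f))"

definition fock_sums ::
  "real \<Rightarrow> (nat \<Rightarrow> complex^'n \<Rightarrow> complex) \<Rightarrow> (complex^'n \<Rightarrow> complex) \<Rightarrow> bool" where
  "fock_sums lam u s \<longleftrightarrow> (\<forall>k. u k \<in> fock lam) \<and> s \<in> fock lam \<and>
     (\<lambda>N. fock_norm lam (\<lambda>z. (\<Sum>k<N. u k z) - s z)) \<longlonglongrightarrow> 0"

definition coh :: "real \<Rightarrow> complex^'n \<Rightarrow> complex^'n \<Rightarrow> complex" where
  "coh lam z = (\<lambda>w. exp (of_real lam * bil (cnjv z) w / 2))"

text \<open>An operator may be unbounded or only partially meaningful as a map on all functions: the kernel,
  and hence the symbol, involves only its values on the coherent states.\<close>

type_synonym 'n operator = "(complex^'n \<Rightarrow> complex) \<Rightarrow> (complex^'n \<Rightarrow> complex)"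

definition kernel :: "real \<Rightarrow> 'n::finite operator \<Rightarrow> complex^'n \<Rightarrow> complex^'n \<Rightarrow> complex" where
  "kernel lam A z w = fock_inner lam (A (coh lam w)) (coh lam z)"

definition W0_integrand ::
  "real \<Rightarrow> 'n::finite operator \<Rightarrow> complex^'n \<Rightarrow> complex^'n \<Rightarrow> complex" where
  "W0_integrand lam A z w = kernel lam A (z + w) (z - w) *
     exp (of_real lam / 2 *
       (- bil z (cnjv z) - bil w (cnjv w) + bil z (cnjv w) - bil (cnjv z) w))"

definition W0 :: "real \<Rightarrow> 'n::finite operator \<Rightarrow> complex^'n \<Rightarrow> complex" where
  "W0 lam A z = 2 ^ CARD('n) * (LINT w|mu lam. W0_integrand lam A z w)"

definition cpartial :: "'n::finite \<Rightarrow> 'n operator" where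
  "cpartial k f z = deriv (\<lambda>t. f (z + t *s axis k 1)) 0"

text \<open>Finite sums of terms \<open>c z\<^sup>\<alpha> \<partial>\<^sub>\<beta>\<close>; the order of differentiation is a list \<open>\<beta>\<close> of
  coordinates, so that \<open>foldr cpartial \<beta>\<close> is the iterated partial derivative. As these operators
  are compared by equality, they are taken on the entire functions and made \<open>undefined\<close>
  elsewhere.\<close>

definition poly_diff_ops :: "('n::finite operator) set" where
  "poly_diff_ops =
     {restrict (\<lambda>f z. \<Sum>(\<alpha>, \<beta>)\<in>S. c \<alpha> \<beta> * (\<Prod>k\<in>UNIV. (z $ k) ^ \<alpha> k) * foldr cpartial \<beta> f z)
        (Collect entire_fun)
      | (S :: (('n \<Rightarrow> nat) \<times> 'n list) set) c. finite S}"

text \<open>The inverse symbol map is taken on the symbols of differential operators with polynomial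
  coefficients (that is, on the polynomials in \<open>z\<close> and its conjugate), where it is
  unique; this class is closed under composition.\<close>

definition W0_inv :: "real \<Rightarrow> (complex^'n \<Rightarrow> complex) \<Rightarrow> 'n::finite operator" where
  "W0_inv lam f = (THE A. A \<in> poly_diff_ops \<and> W0 lam A = f)"

definition star ::
  "real \<Rightarrow> (complex^'n \<Rightarrow> complex) \<Rightarrow> (complex^'n \<Rightarrow> complex) \<Rightarrow> (complex^'n::finite \<Rightarrow> complex)" where
  "star lam f g = W0 lam (compose (Collect entire_fun) (W0_inv lam f) (W0_inv lam g))"

primrec star_pow :: "real \<Rightarrow> (complex^'n \<Rightarrow> complex) \<Rightarrow> nat \<Rightarrow> (complex^'n::finite \<Rightarrow> complex)" where
  "star_pow lam f 0 = (\<lambda>_. 1)"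
| "star_pow lam f (Suc k) = star lam f (star_pow lam f k)"

text \<open>The series \<open>\<Sum>k. f\<^sup>k / k!\<close> of star powers has sum \<open>g\<close>, in the sense of operators: the
  operators with symbols the partial sums converge, in Fock norm on every coherent state, to an
  operator \<open>B\<close> whose symbol is given by an absolutely convergent integral and equals \<open>g\<close>.
  For quadratic \<open>f\<close> the operator series may converge, as here, although the numerical series
  \<open>\<Sum>k. f\<^sup>k(z) / k!\<close> does not: the latter is a power series in the scaling of \<open>f\<close>
  and is stopped by the zeros of the cosine.\<close>

definition has_star_exp ::
  "real \<Rightarrow> (complex^'n \<Rightarrow> complex) \<Rightarrow> (complex^'n::finite \<Rightarrow> complex) \<Rightarrow> bool" where
  "has_star_exp lam f g \<longleftrightarrow>
     (\<exists>B. (\<forall>w. fock_sums lam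
              (\<lambda>k z. 1 / fact k * W0_inv lam (star_pow lam f k) (coh lam w) z)
              (B (coh lam w))) \<and>
          (\<forall>z. integrable (mu lam) (W0_integrand lam B z)) \<and>
          W0 lam B = g)"

definition has_pointwise_star_exp ::
  "real \<Rightarrow> (complex^'n \<Rightarrow> complex) \<Rightarrow> (complex^'n::finite \<Rightarrow> complex) \<Rightarrow> bool" where
  "has_pointwise_star_exp lam f g \<longleftrightarrow>
     (\<forall>z. (\<lambda>k. 1 / fact k * star_pow lam f k z) sums g z)"

end

theory Submission
  imports Defs "HOL-Complex_Analysis.Cauchy_Integral_Formula"
begin

text \<open>The polynomial \<open>P\<close> is the Weyl symbol of a first order differential operator \<open>gen\<close> with affine
  coefficients. Solving the characteristic equations shows that its flow maps the coherent state of
  parameter \<open>w\<close> to an exponential of an affine function of \<open>z\<close> that is entire in the (complex) time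
  \<open>t\<close>. Its Taylor coefficients at \<open>t = 0\<close> are the vectors \<open>gen\<^sup>k coh\<close>, and a Cauchy estimate on
  \<open>|t| = 2\<close>, which costs only a factor \<open>exp (C + M |z|)\<close>, gives convergence of the operator exponential
  in the Fock norm. At \<open>t = 1\<close> the symbol is a Gaussian integral, evaluated by a shift and the mean
  value property, and the condition \<open>cos (b\<^sub>k / \<lambda>) \<noteq> 0\<close> is what makes it convergent. For complex times
  near 0 the integral also converges, and comparing Taylor coefficients identifies the star powers
  with the derivatives at 0 of the closed form, which is holomorphic up to the first zero of a cosine:
  this gives the pointwise series.

  The symbol map is injective on differential operators with polynomial coefficients: under the
  scaling \<open>z \<mapsto> t z\<close>, \<open>t \<rightarrow> \<infinity>\<close>, only the terms of top degree of the symbol survive, and the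
  monomials \<open>z\<^sup>\<alpha> cnj z\<^sup>\<beta>\<close> are distinct characters of a monoid, hence linearly independent.\<close>

section \<open>Entire functions of several variables\<close>

text \<open>The star powers are never expanded. The symbol of the \<open>m\<close>-th power of
  \<open>gen\<close> is read off as the \<open>m\<close>-th time derivative at 0 of the closed form,
  and already \<open>m = 1\<close> identifies \<open>P\<close>. Two circles in the time plane play
  different roles. Convergence on coherent states at time 1 needs a circle of radius greater than 1,
  on which the symbol integral may diverge; the comparison of symbols needs a circle so small that
  one Gaussian dominates the integrand on all of it. As \<open>flow\<close> is entire in time, both
  circles speak of the same Taylor coefficients.

  The inverse symbol map is a definite description over operators compared by equality. A
  differential operator has many presentations, since lists in different order name the same
  derivative, so injectivity rests on commuting partial derivatives. Entire functions are only
  assumed complex differentiable; the smoothness is won from Cauchy's formula on complex lines.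
  Throughout, a derivative becomes an average over a circle, which Fubini or differentiation under
  the integral can exchange with other operations.\<close>

abbreviation circ :: "real \<Rightarrow> complex" where
  "circ x \<equiv> cis (2 * pi * x)"

lemma continuous_on_circ [continuous_intros]: "continuous_on S circ"
  by (intro continuous_intros)

text \<open>Cauchy's formula, written as an integral over the unit interval so that it can be
  exchanged with other integrals and with derivatives in a parameter. The radius stays free: radius
  1 serves for directional derivatives, a small one for the comparison of symbols.\<close>

lemma Cauchy_coeff_circle:
  assumes r: "r > 0" and hol: "f holomorphic_on cball 0 r"
  shows "((\<lambda>x. f (of_real r * circ x) / circ x ^ k) has_integral
           of_real r ^ k * (deriv ^^ k) f 0 / fact k) {0..1}"
proof -
  have "((\<lambda>u. f u / (u - 0) ^ Suc k) has_contour_integral 2 * pi * \<i> / fact k * (deriv ^^ k) f 0)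
      (circlepath 0 r)"
    by (rule Cauchy_has_contour_integral_higher_derivative_circlepath)
       (use r hol in \<open>auto intro: holomorphic_on_imp_continuous_on holomorphic_on_subset\<close>)
  then have "((\<lambda>x. f (circlepath 0 r x) / (circlepath 0 r x) ^ Suc k *
       vector_derivative (circlepath 0 r) (at x within {0..1})) has_integral
       2 * pi * \<i> / fact k * (deriv ^^ k) f 0) {0..1}"
    by (simp add: has_contour_integral_def)
  then have "((\<lambda>x. f (of_real r * circ x) / (of_real r * circ x) ^ Suc k *
       (2 * pi * \<i> * r * circ x)) has_integral 2 * pi * \<i> / fact k * (deriv ^^ k) f 0) {0..1}"
    by (rule has_integral_eq[rotated])
       (simp only: vector_derivative_circlepath01 atLeastAtMost_iff,
        simp add: circlepath cis_conv_exp mult_ac)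
  from has_integral_mult_right[OF this, of "of_real r ^ k / (2 * pi * \<i>)"]
  have "((\<lambda>x. of_real r ^ k / (2 * pi * \<i>) * (f (of_real r * circ x) / (of_real r * circ x) ^ Suc k *
       (2 * pi * \<i> * r * circ x))) has_integral
       of_real r ^ k / (2 * pi * \<i>) * (2 * pi * \<i> / fact k * (deriv ^^ k) f 0)) {0..1}" .
  moreover have "of_real r ^ k / (2 * pi * \<i>) * (f (of_real r * circ x) / (of_real r * circ x) ^ Suc k *
       (2 * pi * \<i> * r * circ x)) = f (of_real r * circ x) / circ x ^ k" for x
    using r by (simp add: power_mult_distrib field_simps)
  moreover have "of_real r ^ k / (2 * pi * \<i>) * (2 * pi * \<i> / fact k * (deriv ^^ k) f 0) =
      of_real r ^ k * (deriv ^^ k) f 0 / fact k"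
    by (simp add: field_simps)
  ultimately show ?thesis
    by (simp only:)
qed

lemma bounded_linear_smult_right: "bounded_linear (\<lambda>t. t *s (v :: complex^'n))"
  by (auto simp: linear_conv_bounded_linear[symmetric] linear_iff vec_eq_iff algebra_simps)

lemma continuous_on_smult [continuous_intros]:
  fixes f :: "'a::topological_space \<Rightarrow> complex" and g :: "'a \<Rightarrow> complex^'n"
  assumes "continuous_on S f" "continuous_on S g"
  shows "continuous_on S (\<lambda>x. f x *s g x)"
  unfolding vector_scalar_mult_def by (intro continuous_intros assms)

lemma norm_smult: "norm (c *s (v :: complex^'n)) = cmod c * norm v"
  by (simp add: norm_vec_def L2_set_def norm_mult power_mult_distrib real_sqrt_mult
      flip: sum_distrib_left)

section \<open>Smoothness and symmetry of mixed derivatives of entire functions\<close>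

lemma entire_funE:
  assumes "entire_fun f"
  obtains D where "\<And>z. (f has_derivative D z) (at z)" "\<And>z c v. D z (c *s v) = c * D z v"
proof -
  from assms have "\<forall>z. \<exists>f'. (f has_derivative f') (at z) \<and> (\<forall>c v. f' (c *s v) = c * f' v)"
    by (simp add: entire_fun_def)
  then show thesis
    using that by (auto dest!: choice)
qed

lemma entire_fun_continuous: "entire_fun f \<Longrightarrow> continuous_on S f"
  by (meson continuous_at_imp_continuous_on entire_fun_def has_derivative_continuous)

lemma has_field_derivative_line:
  assumes "(f has_derivative D) (at (z + t *s v))" "\<And>c. D (c *s v) = c * D v"
  shows "((\<lambda>t. f (z + t *s (v :: complex^'n))) has_field_derivative D v) (at t)"
proof -
  have "((\<lambda>t. z + t *s v) has_derivative (\<lambda>t. t *s v)) (at t)"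
    by (auto intro!: derivative_eq_intros
        bounded_linear.has_derivative[OF bounded_linear_smult_right])
  from diff_chain_at[OF this assms(1)]
  have "((\<lambda>t. f (z + t *s v)) has_derivative (\<lambda>t. t * D v)) (at t)"
    by (simp add: o_def assms(2))
  then show ?thesis
    by (rule has_derivative_imp_has_field_derivative) simp
qed

lemma entire_fun_line_holomorphic:
  assumes "entire_fun f"
  shows "(\<lambda>t. f (z + t *s v)) holomorphic_on S"
proof -
  obtain D where D: "\<And>z. (f has_derivative D z) (at z)" "\<And>z c v. D z (c *s v) = c * D z v"
    by (rule entire_funE[OF assms]) blast
  have "((\<lambda>t. f (z + t *s v)) has_field_derivative D (z + t *s v) v) (at t)" for t
    by (rule has_field_derivative_line[OF D])
  then show ?thesis
    unfolding holomorphic_on_def field_differentiable_def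
    by (blast intro: has_field_derivative_at_within)
qed

text \<open>Cauchy's formula on the complex line through \<open>z\<close> in direction
  \<open>v\<close>. The right-hand side involves only values of \<open>f\<close>, so regularity of
  the derivative in \<open>z\<close> can be deduced from that of \<open>f\<close>.\<close>

lemma entire_fun_derivative_circle:
  assumes f: "\<And>z. (f has_derivative D z) (at z)" "\<And>z c v. D z (c *s v) = c * D z v"
  shows "D z v = integral {0..1} (\<lambda>x. f (z + circ x *s v) / circ x)"
proof -
  have "entire_fun f"
    using f unfolding entire_fun_def by blast
  from Cauchy_coeff_circle[OF zero_less_one entire_fun_line_holomorphic[OF this, of z v], of 1]
  have "((\<lambda>x. f (z + circ x *s v) / circ x) has_integral deriv (\<lambda>t. f (z + t *s v)) 0) {0..1}"
    by simp
  moreover have "deriv (\<lambda>t. f (z + t *s v)) 0 = D z v"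
    by (rule DERIV_imp_deriv, rule has_field_derivative_line) (simp_all add: f)
  ultimately show ?thesis
    by (simp add: integral_unique)
qed

lemma cpartial_eq_derivative:
  assumes f: "\<And>z. (f has_derivative D z) (at z)" "\<And>z c v. D z (c *s v) = c * D z v"
  shows "cpartial k f z = D z (axis k 1)"
  unfolding cpartial_def
  by (rule DERIV_imp_deriv, rule has_field_derivative_line) (simp_all add: f)

text \<open>Differentiate the Cauchy integral of \<open>cpartial k f\<close> under the integral
  sign. The Leibniz rule asks for derivatives that are continuous in operator norm; this continuity
  again comes from Cauchy's formula.\<close>

lemma has_derivative_cpartial:
  fixes f :: "complex^'n \<Rightarrow> complex"
  assumes f: "\<And>z. (f has_derivative D z) (at z)" "\<And>z c v. D z (c *s v) = c * D z v"
  shows "(cpartial k f has_derivative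
           (\<lambda>v. integral {0..1} (\<lambda>x. D (z + circ x *s axis k 1) v / circ x))) (at z)"
proof -
  have cf: "continuous_on S f" for S
    using f by (metis has_derivative_at_withinI has_derivative_continuous_on)
  define B where "B z = Blinfun (D z)" for z
  have B: "blinfun_apply (B z) = D z" for z
    unfolding B_def using has_derivative_bounded_linear[OF f(1)] by (rule bounded_linear_Blinfun_apply)
  \<comment> \<open>In finite dimension it is enough to test the derivative on fixed vectors; each
    value is a Cauchy integral of \<open>f\<close> and depends continuously on
    \<open>z\<close>.\<close>
  have contB: "continuous_on UNIV B"
  proof (rule continuous_on_blinfun_componentwise)
    fix i :: "complex^'n"
    have "continuous_on UNIV (\<lambda>z. integral (cbox 0 1) (\<lambda>x. f (z + circ x *s i) / circ x))"
      by (rule integral_continuous_on_param)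
         (auto simp: split_beta intro!: continuous_intros continuous_on_compose2[OF cf[of UNIV]])
    then show "continuous_on UNIV (\<lambda>z. blinfun_apply (B z) i)"
      by (simp add: B entire_fun_derivative_circle[OF f])
  qed
  define G where "G z x = blinfun_mult_right (1 / circ x) o\<^sub>L B (z + circ x *s axis k 1)" for z x
  have G: "blinfun_apply (G z x) v = D (z + circ x *s axis k 1) v / circ x" for z x v
    by (simp add: G_def B)
  have contG: "continuous_on (UNIV \<times> cbox 0 1) (\<lambda>(z, x). G z x)"
    unfolding G_def split_beta
    by (intro continuous_intros bounded_bilinear.continuous_on[OF bounded_bilinear_blinfun_compose]
        bounded_linear.continuous_on[OF bounded_linear_blinfun_mult_right]
        continuous_on_compose2[OF contB]) auto
  have der: "((\<lambda>z. f (z + circ x *s axis k 1) / circ x) has_derivative blinfun_apply (G z x)) (at z)"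
    for z x
  proof -
    have "((\<lambda>z. z + circ x *s axis k 1) has_derivative (\<lambda>v. v)) (at z)"
      by (auto intro!: derivative_eq_intros)
    from diff_chain_at[OF this f(1)]
    have "((\<lambda>z. f (z + circ x *s axis k 1)) has_derivative D (z + circ x *s axis k 1)) (at z)"
      by (simp add: o_def)
    from has_derivative_mult_right[OF this, of "1 / circ x"] show ?thesis
      by (simp add: G[abs_def])
  qed
  have "((\<lambda>z. integral (cbox 0 1) (\<lambda>x. f (z + circ x *s axis k 1) / circ x)) has_derivative
      blinfun_apply (integral (cbox 0 1) (G z))) (at z within UNIV)"
    by (rule leibniz_rule[OF _ _ contG])
       (auto intro!: der integrable_continuous_interval continuous_intros continuous_on_compose2[OF cf[of UNIV]])
  moreover have "(\<lambda>z. integral (cbox 0 1) (\<lambda>x. f (z + circ x *s axis k 1) / circ x)) = cpartial k f"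
    by (simp add: fun_eq_iff cpartial_eq_derivative[OF f] entire_fun_derivative_circle[OF f])
  moreover have "blinfun_apply (integral (cbox 0 1) (G z)) =
      (\<lambda>v. integral {0..1} (\<lambda>x. D (z + circ x *s axis k 1) v / circ x))"
  proof
    have "continuous_on (cbox 0 1) (\<lambda>x. case (z, x) of (z, x) \<Rightarrow> G z x)"
      by (rule continuous_on_compose2[OF contG]) (auto intro: continuous_on_Pair)
    then have "continuous_on (cbox 0 1) (G z)"
      by simp
    then have "G z integrable_on cbox 0 1"
      by (rule integrable_continuous)
    then show "blinfun_apply (integral (cbox 0 1) (G z)) v =
        integral {0..1} (\<lambda>x. D (z + circ x *s axis k 1) v / circ x)" for v
      by (simp add: blinfun_apply_integral G)
  qed
  ultimately show ?thesis
    by (simp only:)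
qed

lemma entire_fun_cpartial:
  assumes "entire_fun f"
  shows "entire_fun (cpartial k f)"
proof -
  obtain D where D: "\<And>z. (f has_derivative D z) (at z)" "\<And>z c v. D z (c *s v) = c * D z v"
    by (rule entire_funE[OF assms]) blast
  show ?thesis
    unfolding entire_fun_def
  proof (intro allI exI conjI)
    show "(cpartial k f has_derivative
        (\<lambda>v. integral {0..1} (\<lambda>x. D (z + circ x *s axis k 1) v / circ x))) (at z)" for z
      by (rule has_derivative_cpartial[OF D])
  qed (simp add: D(2) flip: integral_mult_right times_divide_eq_right)
qed

text \<open>Differentiating the Cauchy integral of \<open>cpartial k f\<close> in direction
  \<open>j\<close> puts \<open>cpartial j f\<close> under the integral, and the result is Cauchy's
  formula for the \<open>k\<close>-derivative of \<open>cpartial j f\<close>.\<close>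

lemma cpartial_commute:
  assumes "entire_fun f"
  shows "cpartial j (cpartial k f) = cpartial k (cpartial j f)"
proof
  fix z
  obtain D where D: "\<And>z. (f has_derivative D z) (at z)" "\<And>z c v. D z (c *s v) = c * D z v"
    by (rule entire_funE[OF assms]) blast
  let ?D = "\<lambda>k z v. integral {0..1} (\<lambda>x. D (z + circ x *s axis k 1) v / circ x)"
  have lin: "?D k z (c *s v) = c * ?D k z v" for k z c v
    by (simp add: D(2) flip: integral_mult_right times_divide_eq_right)
  have "cpartial j (cpartial k f) z = ?D k z (axis j 1)"
    by (rule cpartial_eq_derivative[OF has_derivative_cpartial[OF D] lin])
  also have "\<dots> = integral {0..1} (\<lambda>x. cpartial j f (z + circ x *s axis k 1) / circ x)"
    by (simp add: cpartial_eq_derivative[OF D])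
  also have "\<dots> = ?D j z (axis k 1)"
    by (rule entire_fun_derivative_circle[OF has_derivative_cpartial[OF D] lin, symmetric])
  also have "\<dots> = cpartial k (cpartial j f) z"
    by (rule cpartial_eq_derivative[OF has_derivative_cpartial[OF D] lin, symmetric])
  finally show "cpartial j (cpartial k f) z = cpartial k (cpartial j f) z" .
qed

lemma entire_fun_foldr_cpartial: "entire_fun f \<Longrightarrow> entire_fun (foldr cpartial bs f)"
  by (induction bs) (auto intro: entire_fun_cpartial)

lemma foldr_cpartial_remove1:
  assumes "entire_fun f" "k \<in> set bs"
  shows "foldr cpartial bs f = cpartial k (foldr cpartial (remove1 k bs) f)"
  using assms(2)
  by (induction bs) (auto simp: cpartial_commute[OF entire_fun_foldr_cpartial[OF assms(1)]])

text \<open>Symbols see only how often each coordinate is differentiated. This matches the lists in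
  \<open>poly_diff_ops\<close> with the multisets for which linear independence is proved.\<close>

lemma foldr_cpartial_mset:
  assumes "entire_fun f" "mset as = mset bs"
  shows "foldr cpartial as f = foldr cpartial bs f"
  using assms(2)
proof (induction as arbitrary: bs)
  case (Cons k as)
  then have "k \<in> set bs" "mset as = mset (remove1 k bs)"
    by (metis list.set_intros(1) set_mset_mset) (simp add: Cons.prems[symmetric])
  then show ?case
    by (simp only: foldr_cpartial_remove1[OF assms(1)] Cons.IH foldr.simps o_apply)
qed auto

section \<open>Closure properties of entire functions\<close>

lemma entire_fun_const: "entire_fun (\<lambda>z. c)"
  unfolding entire_fun_def
proof
  show "\<exists>h. ((\<lambda>z. c) has_derivative h) (at z) \<and> (\<forall>c v. h (c *s v) = c * h v)" for z :: "complex^'n"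
    by (rule exI[of _ "\<lambda>_. 0"]) simp
qed

lemma entire_fun_nth: "entire_fun (\<lambda>z. z $ k)"
  unfolding entire_fun_def
proof
  show "\<exists>h. ((\<lambda>z. z $ k) has_derivative h) (at z) \<and> (\<forall>c v. h (c *s v) = c * h v)"
    for z
    by (rule exI[of _ "\<lambda>v. v $ k"])
       (simp add: bounded_linear_imp_has_derivative bounded_linear_vec_nth)
qed

lemma entire_fun_add:
  assumes "entire_fun f" "entire_fun g"
  shows "entire_fun (\<lambda>z. f z + g z)"
  unfolding entire_fun_def
proof
  fix z
  obtain D D' where "(f has_derivative D) (at z)" "\<And>c v. D (c *s v) = c * D v"
    "(g has_derivative D') (at z)" "\<And>c v. D' (c *s v) = c * D' v"
    using assms unfolding entire_fun_def by metis
  then show "\<exists>h. ((\<lambda>z. f z + g z) has_derivative h) (at z) \<and> (\<forall>c v. h (c *s v) = c * h v)"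
    by (intro exI[of _ "\<lambda>v. D v + D' v"] conjI has_derivative_add) (auto simp: algebra_simps)
qed

lemma entire_fun_mult:
  assumes "entire_fun f" "entire_fun g"
  shows "entire_fun (\<lambda>z. f z * g z)"
  unfolding entire_fun_def
proof
  fix z
  obtain D D' where "(f has_derivative D) (at z)" "\<And>c v. D (c *s v) = c * D v"
    "(g has_derivative D') (at z)" "\<And>c v. D' (c *s v) = c * D' v"
    using assms unfolding entire_fun_def by metis
  then show "\<exists>h. ((\<lambda>z. f z * g z) has_derivative h) (at z) \<and> (\<forall>c v. h (c *s v) = c * h v)"
    by (intro exI[of _ "\<lambda>v. f z * D' v + D v * g z"] conjI has_derivative_mult)
       (auto simp: algebra_simps)
qed

lemma entire_fun_sum: "(\<And>i. i \<in> I \<Longrightarrow> entire_fun (f i)) \<Longrightarrow> entire_fun (\<lambda>z. \<Sum>i\<in>I. f i z)"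
  by (induction I rule: infinite_finite_induct) (auto intro: entire_fun_const entire_fun_add)

lemma entire_fun_prod: "(\<And>i. i \<in> I \<Longrightarrow> entire_fun (f i)) \<Longrightarrow> entire_fun (\<lambda>z. \<Prod>i\<in>I. f i z)"
  by (induction I rule: infinite_finite_induct) (auto intro: entire_fun_const entire_fun_mult)

lemma entire_fun_power: "entire_fun f \<Longrightarrow> entire_fun (\<lambda>z. f z ^ m)"
  by (induction m) (auto intro: entire_fun_const entire_fun_mult)

lemma entire_fun_exp:
  assumes "entire_fun f"
  shows "entire_fun (\<lambda>z. exp (f z))"
  unfolding entire_fun_def
proof
  fix z
  obtain D where D: "(f has_derivative D) (at z)" "\<And>c v. D (c *s v) = c * D v"
    using assms unfolding entire_fun_def by metis
  have "((\<lambda>z. exp (f z)) has_derivative (\<lambda>v. exp (f z) * D v)) (at z)"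
    using has_derivative_compose[OF D(1), of exp "\<lambda>v. exp (f z) * v"]
    by (simp add: DERIV_exp flip: has_field_derivative_def)
  with D(2) show "\<exists>h. ((\<lambda>z. exp (f z)) has_derivative h) (at z) \<and> (\<forall>c v. h (c *s v) = c * h v)"
    by (intro exI conjI) (auto simp: algebra_simps)
qed

lemma entire_fun_translate:
  assumes "entire_fun f"
  shows "entire_fun (\<lambda>z. f (a + z))"
  unfolding entire_fun_def
proof
  fix z
  obtain D where D: "(f has_derivative D) (at (a + z))" "\<And>c v. D (c *s v) = c * D v"
    using assms unfolding entire_fun_def by metis
  have "((\<lambda>z. a + z) has_derivative (\<lambda>v. v)) (at z)"
    by (auto intro!: derivative_eq_intros)
  from has_derivative_compose[OF this D(1)] D(2)
  show "\<exists>h. ((\<lambda>z. f (a + z)) has_derivative h) (at z) \<and> (\<forall>c v. h (c *s v) = c * h v)"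
    by blast
qed

lemma entire_fun_bil: "entire_fun (bil a)"
  unfolding bil_def[abs_def]
  by (intro entire_fun_sum entire_fun_mult entire_fun_const entire_fun_nth)

lemma entire_fun_coh: "entire_fun (coh lam w)"
  unfolding coh_def divide_inverse
  by (intro entire_fun_exp entire_fun_mult entire_fun_const entire_fun_bil)

section \<open>Gaussian integrals and the mean value property\<close>

lemma nn_integral_lborel_translate:
  fixes f :: "'a::euclidean_space \<Rightarrow> ennreal"
  assumes [measurable]: "f \<in> borel_measurable borel"
  shows "(\<integral>\<^sup>+x. f (c + x) \<partial>lborel) = (\<integral>\<^sup>+x. f x \<partial>lborel)"
  by (subst (2) lborel_distr_plus[of c, symmetric]) (simp add: nn_integral_distr)

lemma nn_integral_lborel_reflect:
  fixes f :: "'a::euclidean_space \<Rightarrow> ennreal"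
  assumes [measurable]: "f \<in> borel_measurable borel"
  shows "(\<integral>\<^sup>+x. f (c - x) \<partial>lborel) = (\<integral>\<^sup>+x. f x \<partial>lborel)"
  by (subst (2) lborel_affine[of "-1" c]) (simp_all add: nn_integral_density nn_integral_distr)

text \<open>Multiply with the volume of the unit ball, written as an integral over a second variable: Fubini
  and translations shift \<open>R\<close> from \<open>A\<close> to the ball, which it preserves.\<close>

lemma lborel_distr_isometry:
  fixes R :: "'a::euclidean_space \<Rightarrow> 'a"
  assumes R: "linear R" "\<And>x. norm (R x) = norm x" and S: "\<And>x. R (S x) = x"
  shows "distr lborel borel R = lborel"
proof (rule measure_eqI)
  have [measurable]: "R \<in> borel_measurable borel"
    using R(1) by (intro borel_measurable_continuous_onI linear_continuous_on) (simp add: linear_conv_bounded_linear)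
  fix A assume "A \<in> sets (distr lborel borel R)"
  then have [measurable]: "A \<in> sets borel" by simp
  define V where "V = emeasure lborel (ball (0::'a) 1)"
  have V: "V \<noteq> 0" "V \<noteq> \<infinity>"
    using emeasure_ball[of 1 "0::'a"] unit_ball_vol_pos[of "real DIM('a)"]
    by (auto simp: V_def simp del: unit_ball_vol_pos)
  define h B :: "'a \<Rightarrow> ennreal" where "h = indicator A" and "B = indicator (ball 0 1)"
  have [measurable]: "h \<in> borel_measurable borel" "B \<in> borel_measurable borel"
    unfolding h_def B_def by (intro borel_measurable_indicator; simp)+
  have V_eq: "(\<integral>\<^sup>+x. B x \<partial>lborel) = V"
    by (simp add: V_def B_def)
  have BR: "B (R x) = B x" for x
    by (simp add: B_def indicator_def R(2))
  have "emeasure (distr lborel borel R) A * V = (\<integral>\<^sup>+x. h (R x) \<partial>lborel) * (\<integral>\<^sup>+y. B y \<partial>lborel)"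
    unfolding V_eq
    by (subst nn_integral_indicator[symmetric], simp, subst nn_integral_distr) (simp_all add: h_def)
  also have "\<dots> = (\<integral>\<^sup>+y. \<integral>\<^sup>+x. h (R x) * B y \<partial>lborel \<partial>lborel)"
  proof -
    have "(\<integral>\<^sup>+x. h (R x) * B y \<partial>lborel) = (\<integral>\<^sup>+x. h (R x) \<partial>lborel) * B y" for y
      by (rule nn_integral_multc) measurable
    then show ?thesis
      by (simp only:) (rule nn_integral_cmult[symmetric], simp)
  qed
  also have "\<dots> = (\<integral>\<^sup>+y. \<integral>\<^sup>+x. h (y + R x) * B y \<partial>lborel \<partial>lborel)"
  proof (rule nn_integral_cong)
    fix y
    have "(\<integral>\<^sup>+x. h (R x) * B y \<partial>lborel) = (\<integral>\<^sup>+x. h (R (S y + x)) * B y \<partial>lborel)"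
      by (rule nn_integral_lborel_translate[symmetric]) simp
    then show "(\<integral>\<^sup>+x. h (R x) * B y \<partial>lborel) = (\<integral>\<^sup>+x. h (y + R x) * B y \<partial>lborel)"
      by (simp add: linear_add[OF R(1)] S)
  qed
  also have "\<dots> = (\<integral>\<^sup>+x. \<integral>\<^sup>+y. h (y + R x) * B y \<partial>lborel \<partial>lborel)"
    by (rule lborel_pair.Fubini') simp
  also have "\<dots> = (\<integral>\<^sup>+x. \<integral>\<^sup>+y. h y * B (y - R x) \<partial>lborel \<partial>lborel)"
  proof (rule nn_integral_cong)
    fix x
    have "(\<integral>\<^sup>+y. h y * B (y - R x) \<partial>lborel) =
        (\<integral>\<^sup>+y. h (R x + y) * B ((R x + y) - R x) \<partial>lborel)"
      by (rule nn_integral_lborel_translate[symmetric]) simp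
    then show "(\<integral>\<^sup>+y. h (y + R x) * B y \<partial>lborel) = (\<integral>\<^sup>+y. h y * B (y - R x) \<partial>lborel)"
      by (simp add: add.commute)
  qed
  also have "\<dots> = (\<integral>\<^sup>+y. \<integral>\<^sup>+x. h y * B (y - R x) \<partial>lborel \<partial>lborel)"
    by (rule lborel_pair.Fubini') simp
  also have "\<dots> = (\<integral>\<^sup>+y. h y * V \<partial>lborel)"
  proof (rule nn_integral_cong)
    fix y
    have "y - R x = R (S y - x)" for x
      by (simp add: linear_diff[OF R(1)] S)
    then have "(\<integral>\<^sup>+x. h y * B (y - R x) \<partial>lborel) = (\<integral>\<^sup>+x. h y * B (S y - x) \<partial>lborel)"
      by (simp add: BR)
    also have "\<dots> = (\<integral>\<^sup>+x. h y * B x \<partial>lborel)"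
      by (rule nn_integral_lborel_reflect) simp
    also have "\<dots> = h y * V"
      by (simp add: nn_integral_cmult V_eq)
    finally show "(\<integral>\<^sup>+x. h y * B (y - R x) \<partial>lborel) = h y * V" .
  qed
  also have "\<dots> = emeasure lborel A * V"
    by (simp add: nn_integral_multc) (simp add: h_def)
  finally show "emeasure (distr lborel borel R) A = emeasure lborel A"
    using V by (simp add: mult.commute[of _ V] ennreal_mult_cancel_left)
qed simp

section \<open>Averaging over the action of the unit circle\<close>

lemma circ_smult_isometry:
  "distr lborel borel (\<lambda>w :: complex^'n. circ x *s w) = lborel"
proof (rule lborel_distr_isometry[where S = "\<lambda>w. inverse (circ x) *s w"])
  show "linear (\<lambda>w :: complex^'n. circ x *s w)"
    by (simp add: linear_iff vec_eq_iff algebra_simps)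
qed (simp_all add: norm_smult vec_eq_iff cis_mult)

lemma integral_circ_smult:
  fixes f :: "complex^'n \<Rightarrow> complex"
  assumes [measurable]: "f \<in> borel_measurable borel"
  shows "(LINT w|lborel. f (circ x *s w)) = (LINT w|lborel. f w)"
proof -
  have [measurable]: "(\<lambda>w :: complex^'n. circ x *s w) \<in> borel_measurable borel"
    by (intro borel_measurable_continuous_onI continuous_intros)
  show ?thesis
    by (subst (2) circ_smult_isometry[symmetric, of x]) (simp add: integral_distr)
qed

text \<open>A bound independent of \<open>x\<close> is integrable over the product because the unit
  interval has length 1, so Fubini applies. This serves the mean value property and later the
  exchange of the time circle with the symbol integral.\<close>

lemma circle_integral_swap:
  fixes F :: "real \<Rightarrow> 'a::euclidean_space \<Rightarrow> complex"
  assumes cont: "continuous_on UNIV (\<lambda>(x, w). F x w)"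
    and bound: "\<And>x w. cmod (F x w) \<le> G w" and G: "integrable lborel G"
  shows "(LINT w|lborel. integral {0..1} (\<lambda>x. F x w)) = (LINT x:{0..1}|lborel. LINT w|lborel. F x w)"
proof -
  have [measurable]: "(\<lambda>p. F (fst p) (snd p)) \<in> borel_measurable borel"
    using cont by (intro borel_measurable_continuous_onI) (simp add: split_beta)
  have [measurable]: "F x \<in> borel_measurable borel" for x
  proof (intro borel_measurable_continuous_onI)
    have "continuous_on UNIV (\<lambda>w. case (x, w) of (x, w) \<Rightarrow> F x w)"
      by (rule continuous_on_compose2[OF cont]) (auto intro: continuous_on_Pair)
    then show "continuous_on UNIV (F x)" by simp
  qed
  have contx: "continuous_on {0..1} (\<lambda>x. F x w)" for w
  proof -
    have "continuous_on {0..1} (\<lambda>x. case (x, w) of (x, w) \<Rightarrow> F x w)"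
      by (rule continuous_on_compose2[OF cont]) (auto intro: continuous_on_Pair)
    then show ?thesis by simp
  qed
  have Fint: "integrable lborel (F x)" for x
    by (rule Bochner_Integration.integrable_bound[OF G])
       (auto intro: order_trans[OF bound] abs_ge_self)
  have [measurable]: "G \<in> borel_measurable borel"
    using G by auto
  have meas: "(\<lambda>p. F (fst p) (snd p)) \<in> borel_measurable (lborel \<Otimes>\<^sub>M lborel)"
    by (simp add: lborel_prod)
  have "integrable (lborel \<Otimes>\<^sub>M lborel) (\<lambda>(x, w). indicator {0..1} x *\<^sub>R F x w)"
  proof (rule Bochner_Integration.integrable_bound)
    show "integrable (lborel \<Otimes>\<^sub>M lborel) (\<lambda>(x, w). indicator {0..1::real} x *\<^sub>R G w)"
    proof (rule lborel_pair.Fubini_integrable)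
      show "integrable lborel (\<lambda>x. LINT w|lborel. norm (case (x, w) of (x, w) \<Rightarrow> indicator {0..1::real} x *\<^sub>R G w))"
        by (simp add: abs_mult)
    qed (auto simp: G split_beta)
  qed (use meas in \<open>auto simp: split_beta abs_mult indicator_def intro: order_trans[OF bound] abs_ge_self\<close>)
  from lborel_pair.Fubini_integral[OF this]
  have "(LINT w|lborel. LINT x|lborel. indicator {0..1} x *\<^sub>R F x w) =
     (LINT x|lborel. LINT w|lborel. indicator {0..1} x *\<^sub>R F x w)" .
  moreover have "(LINT x|lborel. indicator {0..1} x *\<^sub>R F x w) = integral {0..1} (\<lambda>x. F x w)" for w
    using set_borel_integral_eq_integral(2)[OF borel_integrable_atLeastAtMost'[OF contx]]
    by (simp add: set_lebesgue_integral_def)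
  ultimately show ?thesis
    by (simp add: set_lebesgue_integral_def)
qed

text \<open>Rotating \<open>w\<close> by \<open>circ x\<close> changes neither the integral nor
  \<open>g\<close>. After averaging over \<open>x\<close> the factor \<open>f\<close> is replaced by
  its mean over a circle in the complex line through \<open>w\<close>, which is \<open>f 0\<close>.
  The rotation invariant bound \<open>G\<close> justifies exchanging the two integrals.\<close>

lemma mean_value_integral:
  fixes f g :: "complex^'n \<Rightarrow> complex"
  assumes f: "entire_fun f" and g: "continuous_on UNIV g" "\<And>x w. g (circ x *s w) = g w"
    and bound: "\<And>w. cmod (f w * g w) \<le> G w" "\<And>x w. G (circ x *s w) = G w" and G: "integrable lborel G"
  shows "(LINT w|lborel. f w * g w) = f 0 * (LINT w|lborel. g w)"
proof -
  have [measurable]: "(\<lambda>w. f w * g w) \<in> borel_measurable borel"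
    by (intro borel_measurable_continuous_onI continuous_intros entire_fun_continuous f g)
  have rot: "(LINT w|lborel. f (circ x *s w) * g w) = (LINT w|lborel. f w * g w)" for x
    using integral_circ_smult[of "\<lambda>w. f w * g w" x] by (simp add: g)
  have mean: "integral {0..1} (\<lambda>x. f (circ x *s w) * g w) = f 0 * g w" for w
  proof -
    have "((\<lambda>x. f (circ x *s w)) has_integral f 0) {0..1}"
      using Cauchy_coeff_circle[OF zero_less_one entire_fun_line_holomorphic[OF f, of 0 w], of 0]
      by simp
    then show ?thesis
      by (intro integral_unique has_integral_mult_left)
  qed
  have "(LINT w|lborel. integral {0..1} (\<lambda>x. f (circ x *s w) * g w)) =
        (LINT x:{0..1}|lborel. LINT w|lborel. f (circ x *s w) * g w)"
  proof (rule circle_integral_swap[OF _ _ G])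
    show "continuous_on UNIV (\<lambda>(x, w). f (circ x *s w) * g w)"
      unfolding split_beta
      by (intro continuous_intros continuous_on_compose2[OF entire_fun_continuous[OF f, of UNIV]]
          continuous_on_compose2[OF g(1)]) auto
    show "cmod (f (circ x *s w) * g w) \<le> G w" for x w
      using bound(1)[of "circ x *s w"] by (simp add: g bound(2))
  qed
  then show ?thesis
    by (simp only: mean rot) (simp add: set_lebesgue_integral_def)
qed


section \<open>Gaussian integrals in one and several variables\<close>

lemma integral_lborel_prod:
  fixes f :: "'a::euclidean_space \<Rightarrow> real \<Rightarrow> complex"
  assumes f: "\<And>b. b \<in> Basis \<Longrightarrow> integrable lborel (f b)"
  shows "integrable lborel (\<lambda>x::'a. \<Prod>b\<in>Basis. f b (x \<bullet> b))"
    and "(LINT x|lborel. (\<Prod>b\<in>(Basis::'a set). f b (x \<bullet> b))) = (\<Prod>b\<in>Basis. (LINT x|lborel. f b x))"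
proof -
  interpret product_sigma_finite "\<lambda>_::'a. lborel :: real measure" ..
  have [measurable]: "f b \<in> borel_measurable borel" if "b \<in> Basis" for b
    using f[OF that] by auto
  have [measurable]: "(\<lambda>x::'a. \<Prod>b\<in>Basis. f b (x \<bullet> b)) \<in> borel_measurable borel"
    by measurable
  have [measurable]: "(\<lambda>g. \<Sum>b\<in>(Basis::'a set). g b *\<^sub>R b) \<in> measurable (\<Pi>\<^sub>M b\<in>Basis. lborel) borel"
    by measurable
  have eq: "(\<Prod>b\<in>Basis. f b ((\<Sum>b\<in>Basis. x b *\<^sub>R b) \<bullet> b)) = (\<Prod>b\<in>(Basis::'a set). f b (x b))" for x
    by (intro prod.cong) simp_all
  show "integrable lborel (\<lambda>x::'a. \<Prod>b\<in>Basis. f b (x \<bullet> b))"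
    by (subst lborel_eq) (simp add: integrable_distr_eq eq product_integrable_prod f)
  show "(LINT x|lborel. (\<Prod>b\<in>(Basis::'a set). f b (x \<bullet> b))) = (\<Prod>b\<in>Basis. (LINT x|lborel. f b x))"
    by (subst lborel_eq) (simp add: integral_distr eq product_integral_prod f)
qed

text \<open>The sign makes the half-lines \<open>{x<..}\<close> sets of finite measure, so that they determine the measure.\<close>

lemma distr_minus_cmod_square:
  "distr lborel borel (\<lambda>w. - (cmod w)\<^sup>2) = density lborel (\<lambda>x. ennreal (pi * indicator {..<0} x))"
proof (rule measure_eqI_lessThan)
  fix x :: real
  have "emeasure (distr lborel borel (\<lambda>w. - (cmod w)\<^sup>2)) {x<..} = emeasure lborel {w. x < - (cmod w)\<^sup>2}"
    by (subst emeasure_distr) (auto simp: vimage_def)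
  also have "\<dots> = ennreal (pi * max 0 (- x))"
  proof (cases "x < 0")
    case True
    have "x < - (cmod w)\<^sup>2 \<longleftrightarrow> cmod w < sqrt (- x)" for w
    proof -
      have "x < - (cmod w)\<^sup>2 \<longleftrightarrow> (cmod w)\<^sup>2 < - x" by linarith
      also have "\<dots> \<longleftrightarrow> cmod w < sqrt (- x)"
        using real_sqrt_less_iff[of "(cmod w)\<^sup>2" "- x"] by simp
      finally show ?thesis .
    qed
    then have "{w. x < - (cmod w)\<^sup>2} = ball 0 (sqrt (- x))"
      by (simp only: ball_def dist_0_norm)
    then show ?thesis
      using True by (simp add: emeasure_ball unit_ball_vol_2)
  next
    case False
    then have "\<not> x < - (cmod w)\<^sup>2" for w
      using zero_le_power2[of "cmod w"] by linarith
    then have "{w. x < - (cmod w)\<^sup>2} = {}"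
      by simp
    with False show ?thesis by simp
  qed
  finally have 1: "emeasure (distr lborel borel (\<lambda>w. - (cmod w)\<^sup>2)) {x<..} = ennreal (pi * max 0 (- x))" .
  have "emeasure (density lborel (\<lambda>x. ennreal (pi * indicator {..<0} x))) {x<..} =
      (\<integral>\<^sup>+y. ennreal pi * indicator {x<..<0} y \<partial>lborel)"
    by (subst emeasure_density) (auto intro!: nn_integral_cong simp: indicator_def)
  also have "\<dots> = ennreal (pi * max 0 (- x))"
    by (simp add: nn_integral_cmult ennreal_mult max_def)
  finally show "emeasure (distr lborel borel (\<lambda>w. - (cmod w)\<^sup>2)) {x<..} =
      emeasure (density lborel (\<lambda>x. ennreal (pi * indicator {..<0} x))) {x<..}"
    by (simp add: 1)
  show "emeasure (distr lborel borel (\<lambda>w. - (cmod w)\<^sup>2)) {x<..} < \<infinity>"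
    by (simp add: 1)
qed simp_all

lemma integral_exp_negative_axis:
  fixes p :: complex
  assumes p: "Re p > 0"
  shows "set_integrable lborel {..<0} (\<lambda>x. exp (p * of_real x))"
    and "(LINT x:{..<0::real}|lborel. exp (p * of_real x)) = 1 / p"
proof -
  have p0: "p \<noteq> 0" using p by auto
  have lim: "((\<lambda>x. exp (Re p * x)) \<longlongrightarrow> 0) at_bot"
    using p by (intro filterlim_compose[OF exp_at_bot] filterlim_tendsto_pos_mult_at_bot[OF tendsto_const]) (auto intro: filterlim_ident)
  have "set_integrable lborel (einterval (-\<infinity>) 0) (\<lambda>x. exp (Re p * x))"
  proof (rule interval_integral_FTC_nonneg[where F = "\<lambda>x. exp (Re p * x) / Re p"])
    show "(((\<lambda>x. exp (Re p * x) / Re p) \<circ> real_of_ereal) \<longlongrightarrow> 0) (at_right (-\<infinity>))"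
      using tendsto_divide[OF lim tendsto_const[of "Re p"]] p by (simp add: ereal_tendsto_simps)
    show "(((\<lambda>x. exp (Re p * x) / Re p) \<circ> real_of_ereal) \<longlongrightarrow> 1 / Re p) (at_left 0)"
      unfolding zero_ereal_def ereal_tendsto_simps
      using p by (auto intro!: tendsto_eq_intros)
  qed (use p in \<open>auto intro!: derivative_eq_intros\<close>)
  moreover have ei: "einterval (-\<infinity>) 0 = {..<0}"
    by (auto simp: einterval_def zero_ereal_def)
  ultimately have "set_integrable lborel {..<0} (\<lambda>x. exp (Re p * x))"
    by simp
  then show *: "set_integrable lborel {..<0} (\<lambda>x. exp (p * of_real x))"
    unfolding set_integrable_def
    by (rule Bochner_Integration.integrable_bound) (auto simp: indicator_def)
  have "(LBINT x=-\<infinity>..0. exp (p * of_real x)) = 1 / p - 0"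
  proof (rule interval_integral_FTC_integrable[where F = "\<lambda>x. exp (p * of_real x) / p"])
    have "((\<lambda>x. exp (p * of_real x)) \<longlongrightarrow> 0) at_bot"
      by (rule tendsto_norm_zero_cancel) (simp add: lim)
    from tendsto_divide[OF this tendsto_const[of p]]
    show "(((\<lambda>x. exp (p * of_real x) / p) \<circ> real_of_ereal) \<longlongrightarrow> 0) (at_right (-\<infinity>))"
      using p0 by (simp add: ereal_tendsto_simps)
    show "(((\<lambda>x. exp (p * of_real x) / p) \<circ> real_of_ereal) \<longlongrightarrow> 1 / p) (at_left 0)"
      unfolding zero_ereal_def ereal_tendsto_simps
      using p by (auto intro!: tendsto_eq_intros)
    show "((\<lambda>x. exp (p * of_real x) / p) has_vector_derivative exp (p * of_real x)) (at x)" for x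
    proof (rule has_vector_derivative_real_field)
      show "((\<lambda>x. exp (p * x) / p) has_field_derivative exp (p * of_real x)) (at (of_real x))"
        using p0 by (auto intro!: derivative_eq_intros)
    qed
  qed (use * in \<open>auto simp: ei intro!: continuous_intros\<close>)
  then show "(LINT x:{..<0::real}|lborel. exp (p * of_real x)) = 1 / p"
    by (simp add: interval_lebesgue_integral_def ei)
qed

text \<open>The integrand factors through the squared modulus, whose negative has density
  \<open>pi\<close> on the negative half-line. The plane integral thus becomes the integral of an
  exponential, also for complex \<open>p\<close>.\<close>

lemma complex_gaussian:
  fixes p :: complex
  assumes p: "Re p > 0"
  shows "integrable lborel (\<lambda>w. exp (- p * of_real ((cmod w)\<^sup>2)))"
    and "(LINT w|lborel. exp (- p * of_real ((cmod w)\<^sup>2))) = pi / p"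
proof -
  have [measurable]: "(\<lambda>x::real. exp (p * of_real x)) \<in> borel_measurable borel"
    by (intro borel_measurable_continuous_onI continuous_intros)
  have eq: "(pi * indicator {..<0} x) *\<^sub>R exp (p * of_real x) =
      pi *\<^sub>R (indicator {..<0::real} x *\<^sub>R exp (p * of_real x))" for x
    by simp
  have "integrable (density lborel (\<lambda>x. ennreal (pi * indicator {..<0} x))) (\<lambda>x. exp (p * of_real x))"
    using integral_exp_negative_axis(1)[OF p]
    by (subst integrable_density) (auto simp: eq set_integrable_def simp del: scaleR_scaleR)
  then show "integrable lborel (\<lambda>w. exp (- p * of_real ((cmod w)\<^sup>2)))"
    by (simp add: distr_minus_cmod_square[symmetric] integrable_distr_eq)
  have "(LINT w|lborel. exp (- p * of_real ((cmod w)\<^sup>2))) =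
      (LINT x|distr lborel borel (\<lambda>w. - (cmod w)\<^sup>2). exp (p * of_real x))"
    by (simp add: integral_distr)
  also have "\<dots> = (LINT x|lborel. pi *\<^sub>R (indicator {..<0::real} x *\<^sub>R exp (p * of_real x)))"
    unfolding distr_minus_cmod_square
    by (subst integral_density) (auto simp: eq simp del: scaleR_scaleR)
  also have "\<dots> = pi / p"
    using integral_exp_negative_axis(2)[OF p]
    by (simp add: set_lebesgue_integral_def del: scaleR_scaleR) (simp add: scaleR_conv_of_real)
  finally show "(LINT w|lborel. exp (- p * of_real ((cmod w)\<^sup>2))) = pi / p" .
qed

lemma norm_square_Basis: "(norm x)\<^sup>2 = (\<Sum>b\<in>Basis. (x \<bullet> b)\<^sup>2)" for x :: "'a::euclidean_space"
  unfolding power2_norm_eq_inner by (subst euclidean_inner) (simp add: power2_eq_square)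

text \<open>In real coordinates the plane Gaussian is a product of two equal factors, so its finite
  integral is the square of the integral in question.\<close>

lemma real_gaussian_integrable:
  assumes "k > (0::real)"
  shows "integrable lborel (\<lambda>x. exp (- k * x\<^sup>2))"
proof -
  have "(\<integral>\<^sup>+w. ennreal (norm (exp (- complex_of_real k * of_real ((cmod w)\<^sup>2)))) \<partial>lborel) < \<infinity>"
    using complex_gaussian(1)[of "of_real k"] assms unfolding integrable_iff_bounded by simp
  also have "(\<lambda>w. ennreal (norm (exp (- complex_of_real k * of_real ((cmod w)\<^sup>2))))) =
      (\<lambda>w. \<Prod>b\<in>Basis. ennreal (exp (- k * (w \<bullet> b)\<^sup>2)))"
    by (simp add: prod_ennreal norm_square_Basis exp_sum[symmetric] sum_distrib_left sum_negf)
  finally have "(\<Prod>b\<in>(Basis::complex set). (\<integral>\<^sup>+x. ennreal (exp (- k * x\<^sup>2)) \<partial>lborel)) < \<infinity>"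
    by (subst (asm) nn_integral_lborel_prod) auto
  then have "(\<integral>\<^sup>+x. ennreal (exp (- k * x\<^sup>2)) \<partial>lborel) < \<infinity>"
    by (simp add: Basis_complex_def ennreal_mult_less_top less_top[symmetric] power2_eq_square)
       (auto simp: ennreal_mult_eq_top_iff)
  then show ?thesis
    by (auto simp: integrable_iff_bounded)
qed

text \<open>Stating only the square avoids choosing a complex square root of \<open>pi / p\<close>.
  Each complex coordinate consists of two real ones with the same coefficient, so later only squares
  occur.\<close>

lemma one_dim_gaussian:
  fixes p :: complex
  assumes p: "Re p > 0"
  shows "integrable lborel (\<lambda>x::real. exp (- p * of_real (x\<^sup>2)))"
    and "(LINT x|lborel. exp (- p * of_real (x\<^sup>2)))\<^sup>2 = pi / p"
proof -
  show int: "integrable lborel (\<lambda>x::real. exp (- p * of_real (x\<^sup>2)))"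
    by (rule Bochner_Integration.integrable_bound[OF real_gaussian_integrable[OF p]])
       (auto intro!: borel_measurable_continuous_onI continuous_intros)
  have "(LINT w|lborel. exp (- p * of_real ((cmod w)\<^sup>2))) =
      (LINT w|lborel. (\<Prod>b\<in>(Basis::complex set). exp (- p * of_real ((w \<bullet> b)\<^sup>2))))"
    by (simp add: norm_square_Basis exp_sum[symmetric] sum_distrib_left sum_negf)
  also have "\<dots> = (\<Prod>b\<in>(Basis::complex set). (LINT x|lborel. exp (- p * of_real (x\<^sup>2))))"
    by (rule integral_lborel_prod(2)[where f = "\<lambda>_ x. exp (- p * of_real (x\<^sup>2))"]) (rule int)
  also have "\<dots> = (LINT x|lborel. exp (- p * of_real (x\<^sup>2)))\<^sup>2"
    by (simp add: Basis_complex_def power2_eq_square)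
  finally show "(LINT x|lborel. exp (- p * of_real (x\<^sup>2)))\<^sup>2 = pi / p"
    using complex_gaussian(2)[OF p] by simp
qed

text \<open>Completing the square gives
  \<open>M * norm x <= k / 2 * (norm x)^2 + M^2 / (2 * k)\<close>, so half of the decay pays for the
  linear term. Functions of this form are the dominating functions of the later sections.\<close>

lemma gaussian_exp_integrable:
  fixes C M k :: real
  assumes k: "k > 0"
  shows "integrable lborel (\<lambda>x::'a::euclidean_space. C * exp (M * norm x - k * (norm x)\<^sup>2))"
proof -
  have "integrable lborel (\<lambda>x::'a. \<Prod>b\<in>Basis. exp (- complex_of_real (k / 2) * of_real ((x \<bullet> b)\<^sup>2)))"
    by (rule integral_lborel_prod(1)[where f = "\<lambda>_ x. exp (- complex_of_real (k / 2) * of_real (x\<^sup>2))"],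
        rule one_dim_gaussian(1)) (use k in simp)
  from integrable_norm[OF this]
  have "integrable lborel (\<lambda>x::'a. exp (- (k / 2) * (norm x)\<^sup>2))"
    by (simp add: norm_square_Basis exp_sum[symmetric] sum_distrib_left sum_negf prod_norm[symmetric])
  then have "integrable lborel (\<lambda>x::'a. \<bar>C\<bar> * exp (M\<^sup>2 / (2 * k)) * exp (- (k / 2) * (norm x)\<^sup>2))"
    by simp
  then show ?thesis
  proof (rule Bochner_Integration.integrable_bound)
    show "AE x in lborel. norm (C * exp (M * norm (x::'a) - k * (norm x)\<^sup>2)) \<le>
        norm (\<bar>C\<bar> * exp (M\<^sup>2 / (2 * k)) * exp (- (k / 2) * (norm x)\<^sup>2))"
    proof (rule AE_I2)
      fix x :: 'a
      have "0 \<le> k / 2 * (norm x - M / k)\<^sup>2"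
        using k by simp
      also have "\<dots> = k / 2 * (norm x)\<^sup>2 - M * norm x + M\<^sup>2 / (2 * k)"
        using k by (simp add: power2_eq_square field_simps)
      finally show "norm (C * exp (M * norm x - k * (norm x)\<^sup>2)) \<le>
        norm (\<bar>C\<bar> * exp (M\<^sup>2 / (2 * k)) * exp (- (k / 2) * (norm x)\<^sup>2))"
        by (simp add: abs_mult mult_left_mono mult.assoc flip: exp_add)
    qed
  qed (auto intro!: borel_measurable_continuous_onI continuous_intros)
qed

lemma prod_Basis_vec:
  "(\<Prod>b\<in>(Basis :: ('a::euclidean_space^'n) set). F b) = (\<Prod>k\<in>UNIV. \<Prod>u\<in>Basis. F (axis k u))"
proof -
  have eq: "(Basis :: ('a^'n) set) = (\<lambda>(k, u). axis k u) ` (UNIV \<times> Basis)"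
    by (auto simp: Basis_vec_def)
  have inj: "inj_on (\<lambda>(k, u). axis k u :: 'a^'n) (UNIV \<times> Basis)"
    by (auto simp: inj_on_def axis_eq_axis nonzero_Basis)
  have "prod F (Basis :: ('a^'n) set) = prod (F \<circ> (\<lambda>(k, u). axis k u)) (UNIV \<times> Basis)"
    unfolding eq by (rule prod.reindex[OF inj])
  then show ?thesis
    by (simp add: prod.cartesian_product split_beta)
qed

lemma vec_gaussian:
  fixes p :: "'n::finite \<Rightarrow> complex"
  assumes p: "\<And>k. Re (p k) > 0"
  shows "(LINT w|lborel. exp (- (\<Sum>k\<in>UNIV. p k * of_real ((cmod (w $ k))\<^sup>2)))) = (\<Prod>k\<in>UNIV. pi / p k)"
proof -
  \<comment> \<open>A standard basis vector lives in one coordinate, which \<open>ix\<close>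
    recovers. Thus the coefficients \<open>p k\<close> can be indexed by \<open>Basis\<close>, as
    the product formula requires.\<close>
  define ix where "ix b = (SOME k. b $ k \<noteq> 0)" for b :: "complex^'n"
  have ix: "ix (axis k u) = k" if "u \<in> Basis" for k :: 'n and u :: complex
    unfolding ix_def using nonzero_Basis[OF that] by (auto simp: axis_def intro!: some_equality split: if_splits)
  have "exp (- (\<Sum>k\<in>UNIV. p k * of_real ((cmod (w $ k))\<^sup>2))) =
      (\<Prod>b\<in>Basis. exp (- p (ix b) * of_real ((w \<bullet> b)\<^sup>2)))" for w :: "complex^'n"
    by (simp add: prod_Basis_vec ix inner_axis norm_square_Basis exp_sum[symmetric] sum_distrib_left sum_negf cong: prod.cong)
  then have "(LINT w|lborel. exp (- (\<Sum>k\<in>UNIV. p k * of_real ((cmod (w $ k))\<^sup>2)))) =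
      (LINT w|lborel. (\<Prod>b\<in>(Basis::(complex^'n) set). exp (- p (ix b) * of_real ((w \<bullet> b)\<^sup>2))))"
    by simp
  also have "\<dots> = (\<Prod>b\<in>(Basis::(complex^'n) set). (LINT x|lborel. exp (- p (ix b) * of_real (x\<^sup>2))))"
    by (rule integral_lborel_prod(2)[where f = "\<lambda>b x. exp (- p (ix b) * of_real (x\<^sup>2))"],
        rule one_dim_gaussian(1), rule p)
  also have "\<dots> = (\<Prod>k\<in>UNIV. \<Prod>u\<in>(Basis::complex set). (LINT x|lborel. exp (- p k * of_real (x\<^sup>2))))"
    by (simp add: prod_Basis_vec ix cong: prod.cong)
  also have "\<dots> = (\<Prod>k\<in>UNIV. (LINT x|lborel. exp (- p k * of_real (x\<^sup>2)))\<^sup>2)"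
    by (simp add: Basis_complex_def power2_eq_square)
  also have "\<dots> = (\<Prod>k\<in>UNIV. pi / p k)"
    by (simp add: one_dim_gaussian(2)[OF p, simplified])
  finally show ?thesis .
qed

lemma integral_lborel_translate:
  fixes f :: "'a::euclidean_space \<Rightarrow> complex"
  assumes [measurable]: "f \<in> borel_measurable borel"
  shows "(LINT w|lborel. f (c + w)) = (LINT w|lborel. f w)"
  by (subst (2) lborel_distr_plus[of c, symmetric]) (simp add: integral_distr)

lemma sum_norm_square_vec: "(\<Sum>k\<in>UNIV. (norm (w $ k))\<^sup>2) = (norm w)\<^sup>2"
  by (simp add: norm_vec_def L2_set_def sum_nonneg)

lemma gaussian_linear_bound:
  fixes p q r :: "'n::finite \<Rightarrow> complex" and w :: "complex^'n"
  assumes m: "\<And>k. m \<le> Re (p k)"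
  shows "cmod (exp (\<Sum>k\<in>UNIV. - p k * (w $ k * cnj (w $ k)) + q k * w $ k + r k * cnj (w $ k)))
       \<le> exp ((\<Sum>k\<in>UNIV. cmod (q k) + cmod (r k)) * norm w - m * (norm w)\<^sup>2)"
proof -
  have "Re (- p k * (w $ k * cnj (w $ k)) + q k * w $ k + r k * cnj (w $ k)) \<le>
      (cmod (q k) + cmod (r k)) * norm w - m * (cmod (w $ k))\<^sup>2" for k
  proof -
    have "Re (- p k * (w $ k * cnj (w $ k))) = - Re (p k) * (cmod (w $ k))\<^sup>2"
      by (simp add: complex_mult_cnj cmod_power2)
    also have "\<dots> \<le> - m * (cmod (w $ k))\<^sup>2"
      using m[of k] by (intro mult_right_mono) auto
    finally have 1: "Re (- p k * (w $ k * cnj (w $ k))) \<le> - m * (cmod (w $ k))\<^sup>2" .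
    have "Re (q k * w $ k) \<le> cmod (q k) * norm w" "Re (r k * cnj (w $ k)) \<le> cmod (r k) * norm w"
      using complex_Re_le_cmod[of "q k * w $ k"] complex_Re_le_cmod[of "r k * cnj (w $ k)"]
        mult_left_mono[OF Finite_Cartesian_Product.norm_nth_le[of w k], of "cmod (q k)"]
        mult_left_mono[OF Finite_Cartesian_Product.norm_nth_le[of w k], of "cmod (r k)"]
      by (simp_all add: norm_mult)
    with 1 show ?thesis
      by (simp add: distrib_right)
  qed
  then have "Re (\<Sum>k\<in>UNIV. - p k * (w $ k * cnj (w $ k)) + q k * w $ k + r k * cnj (w $ k)) \<le>
      (\<Sum>k\<in>UNIV. (cmod (q k) + cmod (r k)) * norm w - m * (cmod (w $ k))\<^sup>2)"
    unfolding Re_sum by (intro sum_mono)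
  also have "\<dots> = (\<Sum>k\<in>UNIV. cmod (q k) + cmod (r k)) * norm w - m * (norm w)\<^sup>2"
    by (simp only: sum_subtractf sum_distrib_right[symmetric] sum_distrib_left[symmetric] sum_norm_square_vec)
  finally show ?thesis
    by simp
qed

text \<open>Since \<open>q\<close> and \<open>r\<close> are unrelated, in general no translation
  removes both linear terms. The shift by \<open>r k / p k\<close> removes the antiholomorphic one;
  what remains is an entire exponential \<open>f\<close> times a centred, rotation invariant
  Gaussian \<open>g\<close>, so the mean value property replaces \<open>f\<close> by
  \<open>f 0 = 1\<close>. The constant \<open>q k * r k / p k\<close> is the value of the exponent
  at the shift.\<close>

lemma vec_gaussian_linear:
  fixes p q r :: "'n::finite \<Rightarrow> complex"
  assumes p: "\<And>k. Re (p k) > 0"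
  defines "h \<equiv> \<lambda>w :: complex^'n. exp (\<Sum>k\<in>UNIV. - p k * (w $ k * cnj (w $ k)) + q k * w $ k + r k * cnj (w $ k))"
  shows "integrable lborel h" "integral\<^sup>L lborel h = (\<Prod>k\<in>UNIV. pi / p k * exp (q k * r k / p k))"
proof -
  define m where "m = Min (range (\<lambda>k. Re (p k)))"
  have m: "m > 0" "m \<le> Re (p k)" for k
    using p by (auto simp: m_def)
  have bound: "cmod (exp (\<Sum>k\<in>UNIV. - p k * (w $ k * cnj (w $ k)) + q k * w $ k + r k * cnj (w $ k)))
       \<le> exp ((\<Sum>k\<in>UNIV. cmod (q k) + cmod (r k)) * norm w - m * (norm w)\<^sup>2)" for w :: "complex^'n" and q r
    by (rule gaussian_linear_bound) (rule m(2))
  have cont: "continuous_on UNIV h"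
    unfolding h_def by (intro continuous_intros)
  have [measurable]: "h \<in> borel_measurable borel"
    by (rule borel_measurable_continuous_onI[OF cont])
  define c :: "complex^'n" where "c = (\<chi> k. r k / p k)"
  define q' where "q' k = q k - p k * cnj (c $ k)" for k
  define f g where "f w = exp (\<Sum>k\<in>UNIV. q' k * w $ k)"
    and "g w = exp (- (\<Sum>k\<in>UNIV. p k * of_real ((cmod (w $ k))\<^sup>2)))" for w :: "complex^'n"
  have p0: "p k \<noteq> 0" for k
    using p[of k] by auto
  have h_c: "h (c + w) = exp (\<Sum>k\<in>UNIV. q k * r k / p k) * (f w * g w)" for w
    unfolding h_def f_def g_def mult_exp_exp sum_negf[symmetric] sum.distrib[symmetric]
    by (intro arg_cong[where f = exp] sum.cong)
       (simp_all add: q'_def c_def p0 field_simps complex_norm_square del: of_real_power)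
  have "(LINT w|lborel. f w * g w) = f 0 * (LINT w|lborel. g w)"
  proof (rule mean_value_integral)
    show "entire_fun f"
      unfolding f_def by (intro entire_fun_exp entire_fun_sum entire_fun_mult entire_fun_const entire_fun_nth)
    show "continuous_on UNIV g"
      unfolding g_def by (intro continuous_intros)
    show "g (circ x *s w) = g w" for x w
      by (simp add: g_def norm_mult)
    show "integrable lborel (\<lambda>w::complex^'n. 1 * exp ((\<Sum>k\<in>UNIV. cmod (q' k)) * norm w - m * (norm w)\<^sup>2))"
      by (rule gaussian_exp_integrable[OF m(1)])
    show "cmod (f w * g w) \<le> 1 * exp ((\<Sum>k\<in>UNIV. cmod (q' k)) * norm w - m * (norm w)\<^sup>2)" for w
      using bound[of w q' "\<lambda>_. 0"]
      unfolding f_def g_def mult_exp_exp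
      by (simp add: sum.distrib sum_subtractf sum_negf complex_norm_square add.commute del: of_real_power)
  qed (simp add: norm_smult)
  moreover have "f 0 = 1"
    by (simp add: f_def)
  moreover have "(LINT w|lborel. g w) = (\<Prod>k\<in>UNIV. pi / p k)"
    unfolding g_def by (rule vec_gaussian) (rule p)
  moreover have "integral\<^sup>L lborel h = (LINT w|lborel. exp (\<Sum>k\<in>UNIV. q k * r k / p k) * (f w * g w))"
    using integral_lborel_translate[of h c] by (simp add: h_c)
  ultimately have "integral\<^sup>L lborel h = exp (\<Sum>k\<in>UNIV. q k * r k / p k) * (\<Prod>k\<in>UNIV. pi / p k)"
    by simp
  then show "integral\<^sup>L lborel h = (\<Prod>k\<in>UNIV. pi / p k * exp (q k * r k / p k))"
    by (simp only: prod.distrib exp_sum[OF finite]) (simp only: mult.commute)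
  have hb: "cmod (h w) \<le> exp ((\<Sum>k\<in>UNIV. cmod (q k) + cmod (r k)) * norm w - m * (norm w)\<^sup>2)" for w
    unfolding h_def by (rule bound)
  show "integrable lborel h"
  proof (rule Bochner_Integration.integrable_bound[OF gaussian_exp_integrable[OF m(1), of 1]])
    show "AE w in lborel. norm (h w) \<le>
        norm (1 * exp ((\<Sum>k\<in>UNIV. cmod (q k) + cmod (r k)) * norm w - m * (norm w)\<^sup>2))"
      using hb by simp
  qed simp
qed

section \<open>Entire functions of exponential type in the Fock space\<close>

text \<open>A class that lies in every Fock space and is stable under sums, products and
  translations. It contains the coherent states, their images under differential operators with
  polynomial coefficients, and the flow.\<close>

definition exp_type :: "(complex^'n \<Rightarrow> complex) \<Rightarrow> bool" where
  "exp_type f \<longleftrightarrow> entire_fun f \<and> (\<exists>C M. 0 \<le> C \<and> 0 \<le> M \<and> (\<forall>z. cmod (f z) \<le> C * exp (M * norm z)))"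

lemma exp_type_entire: "exp_type f \<Longrightarrow> entire_fun f"
  by (simp add: exp_type_def)

lemma exp_typeE:
  assumes "exp_type f"
  obtains C M where "0 \<le> C" "0 \<le> M" "\<And>z. cmod (f z) \<le> C * exp (M * norm z)"
  using assms unfolding exp_type_def by blast

lemma exp_typeI:
  assumes "entire_fun f" "\<And>z. cmod (f z) \<le> C * exp (M * norm z)" "0 \<le> C" "0 \<le> M"
  shows "exp_type f"
  using assms unfolding exp_type_def by blast

lemma exp_type_const: "exp_type (\<lambda>z. c)"
  by (rule exp_typeI[of _ "cmod c" 0]) (auto simp: entire_fun_const)

lemma exp_type_nth: "exp_type (\<lambda>z. z $ k)"
proof (rule exp_typeI[of _ 1 1])
  fix z :: "complex^'a"
  have "cmod (z $ k) \<le> exp (norm z)"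
    using Finite_Cartesian_Product.norm_nth_le[of z k] exp_ge_add_one_self[of "norm z"] by linarith
  then show "cmod (z $ k) \<le> 1 * exp (1 * norm z)" by simp
qed (auto simp: entire_fun_nth)

lemma exp_type_mult:
  assumes "exp_type f" "exp_type g"
  shows "exp_type (\<lambda>z. f z * g z)"
proof -
  obtain C M where f: "0 \<le> C" "0 \<le> M" "\<And>z. cmod (f z) \<le> C * exp (M * norm z)"
    by (rule exp_typeE[OF assms(1)]) blast
  obtain C' M' where g: "0 \<le> C'" "0 \<le> M'" "\<And>z. cmod (g z) \<le> C' * exp (M' * norm z)"
    by (rule exp_typeE[OF assms(2)]) blast
  show ?thesis
  proof (rule exp_typeI)
    show "cmod (f z * g z) \<le> (C * C') * exp ((M + M') * norm z)" for z
    proof -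
      have "exp ((M + M') * norm z) = exp (M * norm z) * exp (M' * norm z)"
        by (simp add: distrib_right exp_add)
      then show ?thesis
        using mult_mono[OF f(3)[of z] g(3)[of z]] f g by (simp add: norm_mult mult_ac)
    qed
  qed (use f g assms in \<open>auto intro: entire_fun_mult exp_type_entire\<close>)
qed

lemma exp_type_add:
  assumes "exp_type f" "exp_type g"
  shows "exp_type (\<lambda>z. f z + g z)"
proof -
  obtain C M where f: "0 \<le> C" "0 \<le> M" "\<And>z. cmod (f z) \<le> C * exp (M * norm z)"
    by (rule exp_typeE[OF assms(1)]) blast
  obtain C' M' where g: "0 \<le> C'" "0 \<le> M'" "\<And>z. cmod (g z) \<le> C' * exp (M' * norm z)"
    by (rule exp_typeE[OF assms(2)]) blast
  show ?thesis
  proof (rule exp_typeI)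
    fix z :: "complex^'a"
    have "cmod (f z + g z) \<le> C * exp (M * norm z) + C' * exp (M' * norm z)"
      by (rule order_trans[OF norm_triangle_ineq add_mono[OF f(3) g(3)]])
    also have "\<dots> \<le> C * exp ((M + M') * norm z) + C' * exp ((M + M') * norm z)"
      using f g by (intro add_mono mult_left_mono) (auto intro: mult_right_mono)
    finally show "cmod (f z + g z) \<le> (C + C') * exp ((M + M') * norm z)"
      by (simp add: distrib_right)
  qed (use f g assms in \<open>auto intro: entire_fun_add exp_type_entire\<close>)
qed

lemma exp_type_sum: "(\<And>i. i \<in> I \<Longrightarrow> exp_type (f i)) \<Longrightarrow> exp_type (\<lambda>z. \<Sum>i\<in>I. f i z)"
  by (induction I rule: infinite_finite_induct) (auto intro: exp_type_const exp_type_add)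

lemma exp_type_prod: "(\<And>i. i \<in> I \<Longrightarrow> exp_type (f i)) \<Longrightarrow> exp_type (\<lambda>z. \<Prod>i\<in>I. f i z)"
  by (induction I rule: infinite_finite_induct) (auto intro: exp_type_const exp_type_mult)

lemma exp_type_power: "exp_type f \<Longrightarrow> exp_type (\<lambda>z. f z ^ m)"
  by (induction m) (auto intro: exp_type_const exp_type_mult)

lemma exp_type_translate:
  assumes "exp_type f"
  shows "exp_type (\<lambda>z. f (a + z))"
proof -
  obtain C M where f: "0 \<le> C" "0 \<le> M" "\<And>z. cmod (f z) \<le> C * exp (M * norm z)"
    by (rule exp_typeE[OF assms]) blast
  show ?thesis
  proof (rule exp_typeI)
    fix z :: "complex^'a"
    have "cmod (f (a + z)) \<le> C * exp (M * (norm a + norm z))"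
      using f by (intro order_trans[OF f(3)] mult_left_mono) (auto intro: mult_left_mono norm_triangle_ineq)
    then show "cmod (f (a + z)) \<le> (C * exp (M * norm a)) * exp (M * norm z)"
      by (simp add: distrib_left exp_add)
  qed (use f assms in \<open>auto intro: entire_fun_translate exp_type_entire\<close>)
qed

lemma bil_bound: "cmod (bil a z) \<le> (\<Sum>k\<in>UNIV. cmod (a $ k)) * norm z"
  unfolding bil_def sum_distrib_right
  by (intro order_trans[OF norm_sum] sum_mono)
     (auto simp: norm_mult intro: mult_left_mono Finite_Cartesian_Product.norm_nth_le)

lemma exp_type_exp_bil: "exp_type (\<lambda>z. exp (c * bil a z))"
proof (rule exp_typeI)
  show "cmod (exp (c * bil a z)) \<le> 1 * exp ((cmod c * (\<Sum>k\<in>UNIV. cmod (a $ k))) * norm z)" for z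
    using order_trans[OF complex_Re_le_cmod[of "c * bil a z"]] mult_left_mono[OF bil_bound[of a z], of "cmod c"]
    by (simp add: norm_mult mult.assoc del: complex_Re_le_cmod)
qed (intro entire_fun_exp entire_fun_mult entire_fun_const entire_fun_bil,
    auto intro!: mult_nonneg_nonneg sum_nonneg)

lemma coh_eq: "coh lam z w = exp (of_real (lam / 2) * bil (cnjv z) w)"
  by (simp add: coh_def)

lemma exp_type_coh: "exp_type (coh lam w)"
  unfolding coh_eq[abs_def] by (rule exp_type_exp_bil)

lemma exp_type_gaussian_integrable:
  fixes a :: real
  assumes f: "exp_type f" and a: "a > 0"
  shows "integrable lborel (\<lambda>w. f w * of_real (exp (- a * (norm w)\<^sup>2)))"
    and "(LINT w|lborel. f w * of_real (exp (- a * (norm (w::complex^'n))\<^sup>2))) = f 0 * (of_real (pi / a)) ^ CARD('n)"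
proof -
  obtain C M where f': "0 \<le> C" "0 \<le> M" "\<And>z. cmod (f z) \<le> C * exp (M * norm z)"
    by (rule exp_typeE[OF f]) blast
  let ?g = "\<lambda>w::complex^'n. complex_of_real (exp (- a * (norm w)\<^sup>2))"
  have G: "integrable lborel (\<lambda>w::complex^'n. C * exp (M * norm w - a * (norm w)\<^sup>2))"
    by (rule gaussian_exp_integrable[OF a])
  have bound: "cmod (f w * ?g w) \<le> C * exp (M * norm w - a * (norm w)\<^sup>2)" for w
    using mult_right_mono[OF f'(3)[of w], of "exp (- a * (norm w)\<^sup>2)"]
    by (simp add: norm_mult mult.assoc flip: exp_add)
  have cont: "continuous_on UNIV f" "continuous_on UNIV ?g"
    by (intro entire_fun_continuous exp_type_entire f continuous_intros)+
  show "integrable lborel (\<lambda>w. f w * ?g w)"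
  proof (rule Bochner_Integration.integrable_bound[OF G])
    show "(\<lambda>w. f w * ?g w) \<in> borel_measurable lborel"
      using borel_measurable_continuous_onI[OF continuous_on_mult[OF cont]] by simp
    show "AE w in lborel. norm (f w * ?g w) \<le> norm (C * exp (M * norm w - a * (norm w)\<^sup>2))"
      by (intro AE_I2 order_trans[OF bound]) simp
  qed
  have "(LINT w|lborel. f w * ?g w) = f 0 * (LINT w|lborel. ?g w)"
    by (rule mean_value_integral[OF exp_type_entire[OF f] cont(2) _ bound _ G]) (simp_all add: norm_smult)
  also have "(LINT w|lborel. ?g w) = (LINT w::complex^'n|lborel. exp (- (\<Sum>k\<in>UNIV. of_real a * of_real ((cmod (w $ k))\<^sup>2))))"
    by (simp add: sum_norm_square_vec exp_of_real[symmetric] flip: sum_distrib_left of_real_sum of_real_power)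
  also have "\<dots> = (\<Prod>k\<in>(UNIV::'n set). of_real pi / of_real a)"
    by (rule vec_gaussian) (use a in simp)
  finally show "(LINT w|lborel. f w * ?g w) = f 0 * (of_real (pi / a)) ^ CARD('n)"
    by simp
qed

section \<open>Passage to Lebesgue measure and the reproducing property\<close>

lemma mu_constant: "(2 * pi) powi (- int N) * lam ^ N = (lam / (2 * pi)) ^ N"
  by (simp add: power_int_minus power_divide field_simps)

lemma integrable_mu:
  fixes f :: "complex^'n \<Rightarrow> 'b::{banach, second_countable_topology}"
  assumes "lam > 0" "f \<in> borel_measurable borel"
  shows "integrable (mu lam) f \<longleftrightarrow> integrable lborel f"
proof -
  let ?K = "(lam / (2 * pi)) ^ CARD('n)"
  have "integrable (mu lam) f \<longleftrightarrow> integrable lborel (\<lambda>z. ?K *\<^sub>R f z)"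
    unfolding mu_def mu_constant using assms by (subst integrable_density) auto
  also have "\<dots> \<longleftrightarrow> integrable lborel f"
  proof
    assume "integrable lborel (\<lambda>z. ?K *\<^sub>R f z)"
    then have "integrable lborel (\<lambda>z. inverse ?K *\<^sub>R (?K *\<^sub>R f z))"
      by (rule integrable_scaleR_right)
    moreover have "inverse ?K *\<^sub>R (?K *\<^sub>R f z) = f z" for z
      using assms(1) by simp
    ultimately show "integrable lborel f" by (simp only:)
  qed simp
  finally show ?thesis .
qed

lemma integral_mu:
  fixes f :: "complex^'n \<Rightarrow> complex"
  assumes "lam > 0" "f \<in> borel_measurable borel"
  shows "(LINT z|mu lam. f z) = of_real ((lam / (2 * pi)) ^ CARD('n)) * (LINT z|lborel. f z)"
  unfolding mu_def mu_constant using assms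
  by (subst integral_density) (auto simp: scaleR_conv_of_real)

lemma exp_type_fock:
  assumes f: "exp_type f" and lam: "lam > 0"
  shows "f \<in> fock lam"
proof -
  obtain C M where f': "0 \<le> C" "0 \<le> M" "\<And>z. cmod (f z) \<le> C * exp (M * norm z)"
    by (rule exp_typeE[OF f]) blast
  have cont: "continuous_on UNIV f"
    by (intro entire_fun_continuous exp_type_entire f)
  have meas: "(\<lambda>z. (cmod (f z))\<^sup>2 * exp (- lam * (norm z)\<^sup>2 / 2)) \<in> borel_measurable borel"
    by (intro borel_measurable_continuous_onI continuous_intros cont) simp
  have "integrable lborel (\<lambda>z. (cmod (f z))\<^sup>2 * exp (- lam * (norm z)\<^sup>2 / 2))"
  proof (rule Bochner_Integration.integrable_bound)
    show "integrable lborel (\<lambda>z::complex^'a. C\<^sup>2 * exp (2 * M * norm z - lam / 2 * (norm z)\<^sup>2))"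
      using lam by (intro gaussian_exp_integrable) simp
    have "(cmod (f z))\<^sup>2 * exp (- lam * (norm z)\<^sup>2 / 2) \<le> C\<^sup>2 * exp (2 * M * norm z - lam / 2 * (norm z)\<^sup>2)" for z
    proof -
      have "(cmod (f z))\<^sup>2 \<le> (C * exp (M * norm z))\<^sup>2"
        using f'(3) by (intro power_mono) auto
      also have "\<dots> = C\<^sup>2 * exp (2 * M * norm z)"
        by (simp add: power_mult_distrib exp_double[symmetric] mult.assoc)
      finally have "(cmod (f z))\<^sup>2 * exp (- lam * (norm z)\<^sup>2 / 2) \<le>
          C\<^sup>2 * exp (2 * M * norm z) * exp (- lam * (norm z)\<^sup>2 / 2)"
        by (rule mult_right_mono) simp
      then show ?thesis
        by (simp add: mult.assoc mult_exp_exp)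
    qed
    then show "AE z in lborel. norm ((cmod (f z))\<^sup>2 * exp (- lam * (norm z)\<^sup>2 / 2))
        \<le> norm (C\<^sup>2 * exp (2 * M * norm z - lam / 2 * (norm z)\<^sup>2))"
      by simp
  qed (use meas in simp)
  with meas lam f show ?thesis
    by (simp add: fock_def integrable_mu exp_type_entire)
qed

text \<open>Translating the variable by \<open>z\<close> merges the conjugate coherent state with
  the weight: what remains is a function of exponential type, with value \<open>f z\<close> at the
  origin, times a centred Gaussian with parameter \<open>s = lam / 2\<close>. The mean value
  property evaluates the integral, and the normalisation of \<open>mu\<close> is the inverse of the
  Gaussian mass.\<close>

lemma reproducing:
  assumes f: "exp_type f" and lam: "lam > 0"
  shows "fock_inner lam f (coh lam z) = f z"
proof -
  define s where "s = lam / 2"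
  have s: "s > 0" using lam by (simp add: s_def)
  let ?h = "\<lambda>u. f u * cnj (coh lam z u) * of_real (exp (- lam * (norm u)\<^sup>2 / 2))"
  have meas: "?h \<in> borel_measurable borel"
    by (intro borel_measurable_continuous_onI continuous_intros entire_fun_continuous
        exp_type_entire f exp_type_coh) simp
  have norm_eq: "of_real ((norm u)\<^sup>2) = (\<Sum>k\<in>UNIV. u $ k * cnj (u $ k))" for u :: "complex^'a"
    by (simp add: sum_norm_square_vec[symmetric] complex_norm_square del: of_real_power)
  have "?h (z + v) = (f (z + v) * exp (- of_real s * bil (cnjv z) v)) * of_real (exp (- s * (norm v)\<^sup>2))" for v
  proof -
    have "cnj (coh lam z (z + v)) * of_real (exp (- lam * (norm (z + v))\<^sup>2 / 2)) =
      exp (cnj (of_real s * bil (cnjv z) (z + v))) * exp (of_real (- lam * (norm (z + v))\<^sup>2 / 2))"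
      by (simp only: coh_eq s_def exp_cnj exp_of_real)
    also have "\<dots> = exp (cnj (of_real s * bil (cnjv z) (z + v)) - of_real s * of_real ((norm (z + v))\<^sup>2))"
      by (simp add: mult_exp_exp s_def)
    also have "cnj (of_real s * bil (cnjv z) (z + v)) - of_real s * of_real ((norm (z + v))\<^sup>2) =
      - of_real s * bil (cnjv z) v - of_real s * of_real ((norm v)\<^sup>2)"
      unfolding norm_eq
      by (simp add: bil_def cnjv_def sum.distrib[symmetric] sum_subtractf[symmetric] sum_negf[symmetric]
          sum_distrib_left algebra_simps)
         (intro sum.cong refl, simp)
    also have "exp \<dots> = exp (- of_real s * bil (cnjv z) v) * of_real (exp (- s * (norm v)\<^sup>2))"
      by (simp add: mult_exp_exp flip: exp_of_real)
    finally show ?thesis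
      by (simp add: mult.assoc)
  qed
  then have "(LINT u|lborel. ?h (z + u)) = (LINT v|lborel. (f (z + v) * exp (- of_real s * bil (cnjv z) v)) * of_real (exp (- s * (norm v)\<^sup>2)))"
    by (simp only:)
  also have "\<dots> = f z * of_real (pi / s) ^ CARD('a)"
    by (subst exp_type_gaussian_integrable(2)[OF _ s])
       (intro exp_type_mult exp_type_translate f exp_type_exp_bil, simp add: bil_def)
  finally have "(LINT u|lborel. ?h u) = f z * of_real (pi / s) ^ CARD('a)"
    by (simp only: integral_lborel_translate[OF meas])
  then have "fock_inner lam f (coh lam z) = of_real ((lam / (2 * pi)) ^ CARD('a) * (pi / s) ^ CARD('a)) * f z"
    unfolding fock_inner_def by (subst integral_mu[OF lam meas]) simp
  also have "(lam / (2 * pi)) ^ CARD('a) * (pi / s) ^ CARD('a) = 1"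
    using lam by (simp add: power_mult_distrib[symmetric] s_def)
  finally show ?thesis by simp
qed

text \<open>Through the reproducing property the kernel becomes a plain value of \<open>A\<close> on
  a coherent state, and the symbol a single integral.\<close>

lemma kernel_eq: "exp_type (A (coh lam w)) \<Longrightarrow> lam > 0 \<Longrightarrow> kernel lam A z w = A (coh lam w) z"
  by (simp add: kernel_def reproducing)

section \<open>The integrand of the Weyl symbol\<close>

abbreviation weyl_weight :: "real \<Rightarrow> complex^'n \<Rightarrow> complex^'n \<Rightarrow> complex" where
  "weyl_weight lam z w \<equiv> exp (of_real lam / 2 *
     (\<Sum>k\<in>UNIV. - z $ k * cnj (z $ k) - w $ k * cnj (w $ k) + z $ k * cnj (w $ k) - cnj (z $ k) * w $ k))"

lemma W0_integrand_eq:
  assumes "exp_type (A (coh lam (z - w)))" "lam > 0"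
  shows "W0_integrand lam A z w = A (coh lam (z - w)) (z + w) *
    weyl_weight lam z w"
  unfolding W0_integrand_def kernel_eq[where A = A, OF assms]
  by (simp add: bil_def cnjv_def sum.distrib sum_subtractf sum_negf)

text \<open>The exponent of the coherent state is \<open>lam / 2\<close> times the sum of
  \<open>|z|^2 - |w|^2 + cnj z w - z cnj w\<close> over the coordinates; the weight cancels
  everything except the two contributions \<open>- |w|^2\<close>. An operator that multiplies
  coherent states by a polynomial therefore has a Gaussian average of that polynomial as its
  symbol.\<close>

lemma coh_W0_factor:
  "coh lam (z - w) (z + w) *
    weyl_weight lam z w
   = of_real (exp (- lam * (norm w)\<^sup>2))"
proof -
  have "bil (cnjv (z - w)) (z + w) +
      (\<Sum>k\<in>UNIV. - z $ k * cnj (z $ k) - w $ k * cnj (w $ k) + z $ k * cnj (w $ k) - cnj (z $ k) * w $ k) =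
      - 2 * of_real ((norm w)\<^sup>2)"
    by (simp add: bil_def cnjv_def sum_norm_square_vec[symmetric] sum.distrib[symmetric] sum_distrib_left
        algebra_simps complex_norm_square sum_negf[symmetric] del: of_real_power)
  then have "of_real lam / 2 * (bil (cnjv (z - w)) (z + w) +
      (\<Sum>k\<in>UNIV. - z $ k * cnj (z $ k) - w $ k * cnj (w $ k) + z $ k * cnj (w $ k) - cnj (z $ k) * w $ k)) =
      of_real (- lam * (norm w)\<^sup>2)"
    by simp
  then show ?thesis
    by (simp only: coh_eq mult_exp_exp distrib_left exp_of_real[symmetric]) simp
qed

section \<open>Differential operators with polynomial coefficients\<close>

definition monomial :: "('n::finite \<Rightarrow> nat) \<Rightarrow> complex^'n \<Rightarrow> complex" where
  "monomial \<alpha> z = (\<Prod>k\<in>UNIV. (z $ k) ^ \<alpha> k)"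

definition diff_op :: "(('n::finite \<Rightarrow> nat) \<times> 'n list) set \<Rightarrow> (('n \<Rightarrow> nat) \<Rightarrow> 'n list \<Rightarrow> complex) \<Rightarrow> 'n operator" where
  "diff_op S c = (\<lambda>f z. \<Sum>(\<alpha>, \<beta>)\<in>S. c \<alpha> \<beta> * monomial \<alpha> z * foldr cpartial \<beta> f z)"

text \<open>Agreement is demanded on entire functions only, where the derivatives behave well;
  restriction turns such an operator into an element of \<open>poly_diff_ops\<close>. Closure
  properties can thus be proved without carrying \<open>restrict\<close> along.\<close>

definition is_pdo :: "'n::finite operator \<Rightarrow> bool" where
  "is_pdo X \<longleftrightarrow> (\<exists>S c. finite S \<and> (\<forall>f. entire_fun f \<longrightarrow> X f = diff_op S c f))"

lemma poly_diff_ops_eq: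
  "poly_diff_ops = {restrict (diff_op S c) (Collect entire_fun) | S c. finite S}"
  unfolding poly_diff_ops_def diff_op_def monomial_def ..

lemma is_pdo_poly_diff_ops: "is_pdo X \<Longrightarrow> restrict X (Collect entire_fun) \<in> poly_diff_ops"
  unfolding is_pdo_def poly_diff_ops_eq by (force intro!: restrict_ext)

lemma is_pdo_cong: "is_pdo X \<Longrightarrow> (\<And>f. entire_fun f \<Longrightarrow> Y f = X f) \<Longrightarrow> is_pdo Y"
  unfolding is_pdo_def by metis

section \<open>Closure properties of differential operators\<close>

lemma is_pdo_mono: "is_pdo (\<lambda>f z. c * monomial \<alpha> z * foldr cpartial \<beta> f z)"
  unfolding is_pdo_def diff_op_def
  by (rule exI[of _ "{(\<alpha>, \<beta>)}"], rule exI[of _ "\<lambda>_ _. c"]) simp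

lemma is_pdo_zero: "is_pdo (\<lambda>f z. 0)"
  unfolding is_pdo_def diff_op_def by (rule exI[of _ "{}"]) simp

lemma is_pdo_add:
  assumes "is_pdo X" "is_pdo Y"
  shows "is_pdo (\<lambda>f z. X f z + Y f z)"
proof -
  obtain S c where X: "finite S" "\<And>f. entire_fun f \<Longrightarrow> X f = diff_op S c f"
    using assms(1) unfolding is_pdo_def by blast
  obtain T d where Y: "finite T" "\<And>f. entire_fun f \<Longrightarrow> Y f = diff_op T d f"
    using assms(2) unfolding is_pdo_def by blast
  \<comment> \<open>The coefficient functions are arbitrary outside their index sets, hence cut off
    to 0 before they are added on the union.\<close>
  define e where "e \<alpha> \<beta> = (if (\<alpha>, \<beta>) \<in> S then c \<alpha> \<beta> else 0) + (if (\<alpha>, \<beta>) \<in> T then d \<alpha> \<beta> else 0)" for \<alpha> \<beta>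
  have "X f z + Y f z = diff_op (S \<union> T) e f z" if "entire_fun f" for f z
  proof -
    have "diff_op (S \<union> T) e f z =
        (\<Sum>(\<alpha>, \<beta>)\<in>S \<union> T. (if (\<alpha>, \<beta>) \<in> S then c \<alpha> \<beta> * monomial \<alpha> z * foldr cpartial \<beta> f z else 0)) +
        (\<Sum>(\<alpha>, \<beta>)\<in>S \<union> T. (if (\<alpha>, \<beta>) \<in> T then d \<alpha> \<beta> * monomial \<alpha> z * foldr cpartial \<beta> f z else 0))"
      unfolding diff_op_def sum.distrib[symmetric]
      by (intro sum.cong) (auto simp: e_def algebra_simps)
    also have "(\<Sum>(\<alpha>, \<beta>)\<in>S \<union> T. (if (\<alpha>, \<beta>) \<in> S then c \<alpha> \<beta> * monomial \<alpha> z * foldr cpartial \<beta> f z else 0)) = diff_op S c f z"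
      unfolding diff_op_def using X(1) Y(1) by (intro sum.mono_neutral_cong_right) auto
    also have "(\<Sum>(\<alpha>, \<beta>)\<in>S \<union> T. (if (\<alpha>, \<beta>) \<in> T then d \<alpha> \<beta> * monomial \<alpha> z * foldr cpartial \<beta> f z else 0)) = diff_op T d f z"
      unfolding diff_op_def using X(1) Y(1) by (intro sum.mono_neutral_cong_right) auto
    finally show ?thesis
      using that by (simp add: X Y)
  qed
  then show ?thesis
    unfolding is_pdo_def using X(1) Y(1) by (intro exI[of _ "S \<union> T"] exI[of _ e]) auto
qed

lemma is_pdo_sum: "(\<And>i. i \<in> I \<Longrightarrow> is_pdo (X i)) \<Longrightarrow> is_pdo (\<lambda>f z. \<Sum>i\<in>I. X i f z)"
  by (induction I rule: infinite_finite_induct) (auto intro: is_pdo_zero is_pdo_add)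

lemma is_pdo_cmult:
  assumes "is_pdo X"
  shows "is_pdo (\<lambda>f z. k * X f z)"
proof -
  obtain S c where X: "finite S" "\<And>f. entire_fun f \<Longrightarrow> X f = diff_op S c f"
    using assms unfolding is_pdo_def by blast
  have "k * diff_op S c f z = diff_op S (\<lambda>\<alpha> \<beta>. k * c \<alpha> \<beta>) f z" for f z
    by (simp add: diff_op_def sum_distrib_left split_beta mult.assoc)
  then show ?thesis
    unfolding is_pdo_def using X by (intro exI[of _ S] exI[of _ "\<lambda>\<alpha> \<beta>. k * c \<alpha> \<beta>"]) auto
qed

lemma is_pdo_id: "is_pdo (\<lambda>f. f)"
  by (rule is_pdo_cong[OF is_pdo_mono[of 1 "\<lambda>_. 0" "[]"]]) (simp add: monomial_def)

lemma monomial_split: "monomial \<alpha> z = z $ j ^ \<alpha> j * (\<Prod>k\<in>UNIV - {j}. z $ k ^ \<alpha> k)"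
  unfolding monomial_def by (rule prod.remove) auto

lemma monomial_upd: "monomial (\<alpha>(j := m)) z = z $ j ^ m * (\<Prod>k\<in>UNIV - {j}. z $ k ^ \<alpha> k)"
  by (subst monomial_split[of _ _ j]) simp

lemma is_pdo_nth:
  assumes "is_pdo X"
  shows "is_pdo (\<lambda>f z. z $ j * X f z)"
proof -
  obtain S c where X: "finite S" "\<And>f. entire_fun f \<Longrightarrow> X f = diff_op S c f"
    using assms unfolding is_pdo_def by blast
  have "is_pdo (\<lambda>f z. \<Sum>i\<in>S. c (fst i) (snd i) * monomial ((fst i)(j := Suc (fst i j))) z * foldr cpartial (snd i) f z)"
    by (intro is_pdo_sum is_pdo_mono)
  then show ?thesis
    by (rule is_pdo_cong)
       (simp add: X fun_eq_iff diff_op_def sum_distrib_left split_beta monomial_upd monomial_split[of _ _ j] mult_ac)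
qed

lemma cpartial_has_derivative:
  assumes "entire_fun f"
  shows "((\<lambda>t. f (z + t *s axis j 1)) has_field_derivative cpartial j f z) (at 0)"
  using entire_fun_line_holomorphic[OF assms, of z "axis j 1" UNIV]
  unfolding cpartial_def by (auto intro: holomorphic_derivI)

lemma cpartial_mult:
  assumes "entire_fun f" "entire_fun g"
  shows "cpartial j (\<lambda>z. f z * g z) z = cpartial j f z * g z + f z * cpartial j g z"
  by (subst cpartial_def, rule DERIV_imp_deriv)
     (use DERIV_mult[OF cpartial_has_derivative[OF assms(1), of z j] cpartial_has_derivative[OF assms(2), of z j]]
      in \<open>simp add: algebra_simps\<close>)

lemma cpartial_const: "cpartial j (\<lambda>z. c) z = 0"
  by (simp add: cpartial_def)

lemma cpartial_sum:
  assumes "\<And>i. i \<in> I \<Longrightarrow> entire_fun (f i)"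
  shows "cpartial j (\<lambda>z. \<Sum>i\<in>I. f i z) z = (\<Sum>i\<in>I. cpartial j (f i) z)"
  by (subst cpartial_def, rule DERIV_imp_deriv)
     (intro DERIV_sum cpartial_has_derivative assms)

lemma entire_fun_mono: "entire_fun (monomial \<alpha>)"
  unfolding monomial_def[abs_def] by (intro entire_fun_prod entire_fun_power entire_fun_nth)

text \<open>For \<open>\<alpha> j = 0\<close> the truncated exponent \<open>\<alpha> j - 1\<close>
  is harmless, as the factor in front vanishes.\<close>

lemma cpartial_mono: "cpartial j (monomial \<alpha>) z = of_nat (\<alpha> j) * monomial (\<alpha>(j := \<alpha> j - 1)) z"
proof -
  have "monomial \<alpha> (z + t *s axis j 1) = (z $ j + t) ^ \<alpha> j * (\<Prod>k\<in>UNIV - {j}. z $ k ^ \<alpha> k)" for t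
    by (subst monomial_split[of _ _ j]) (auto simp: axis_def intro!: prod.cong)
  moreover have "((\<lambda>t. (z $ j + t) ^ \<alpha> j * (\<Prod>k\<in>UNIV - {j}. z $ k ^ \<alpha> k)) has_field_derivative
      of_nat (\<alpha> j) * monomial (\<alpha>(j := \<alpha> j - 1)) z) (at 0)"
    by (auto intro!: derivative_eq_intros simp: monomial_upd mult_ac)
  ultimately show ?thesis
    unfolding cpartial_def by (intro DERIV_imp_deriv) simp
qed

lemma entire_fun_pdo: "is_pdo X \<Longrightarrow> entire_fun f \<Longrightarrow> entire_fun (X f)"
  unfolding is_pdo_def diff_op_def split_beta
  by (auto intro!: entire_fun_sum entire_fun_mult entire_fun_const entire_fun_mono entire_fun_foldr_cpartial)

text \<open>By the Leibniz rule, differentiating a term either lowers a power of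
  \<open>z $ j\<close> or prepends \<open>j\<close> to the list; both results are again terms of the
  required shape.\<close>

lemma is_pdo_cpartial:
  assumes "is_pdo X"
  shows "is_pdo (\<lambda>f. cpartial j (X f))"
proof -
  obtain S c where X: "finite S" "\<And>f. entire_fun f \<Longrightarrow> X f = diff_op S c f"
    using assms unfolding is_pdo_def by blast
  have "is_pdo (\<lambda>f z. \<Sum>i\<in>S.
      c (fst i) (snd i) * of_nat (fst i j) * monomial ((fst i)(j := fst i j - 1)) z * foldr cpartial (snd i) f z +
      c (fst i) (snd i) * monomial (fst i) z * foldr cpartial (j # snd i) f z)"
    by (intro is_pdo_sum is_pdo_mono is_pdo_add)
  then show ?thesis
  proof (rule is_pdo_cong)
    fix f :: "complex^'a \<Rightarrow> complex"
    assume f: "entire_fun f"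
    have "cpartial j (X f) z = (\<Sum>i\<in>S. c (fst i) (snd i) *
        (of_nat (fst i j) * monomial ((fst i)(j := fst i j - 1)) z * foldr cpartial (snd i) f z +
         monomial (fst i) z * foldr cpartial (j # snd i) f z))" for z
      unfolding X(2)[OF f] diff_op_def split_beta mult.assoc
      by (subst cpartial_sum)
         (simp_all add: cpartial_mult cpartial_const cpartial_mono entire_fun_mult entire_fun_const
           entire_fun_mono entire_fun_foldr_cpartial f algebra_simps)
    then show "cpartial j (X f) = (\<lambda>z. \<Sum>i\<in>S.
        c (fst i) (snd i) * of_nat (fst i j) * monomial ((fst i)(j := fst i j - 1)) z * foldr cpartial (snd i) f z +
        c (fst i) (snd i) * monomial (fst i) z * foldr cpartial (j # snd i) f z)"
      by (simp add: fun_eq_iff algebra_simps)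
  qed
qed

section \<open>Differential operators on coherent states\<close>

lemma bil_axis: "bil a (z + t *s axis j 1) = bil a z + a $ j * t"
  by (simp add: bil_def axis_def distrib_left sum.distrib if_distrib[of "\<lambda>x. _ * x"] cong: if_cong)

lemma cpartial_exp_bil:
  "cpartial j (\<lambda>z. exp (c + bil a z)) z = a $ j * exp (c + bil a z)"
  unfolding cpartial_def bil_axis
  by (rule DERIV_imp_deriv) (auto intro!: derivative_eq_intros)

lemma foldr_cpartial_coh:
  "foldr cpartial \<beta> (coh lam w) z = (\<Prod>j\<leftarrow>\<beta>. of_real (lam / 2) * cnj (w $ j)) * coh lam w z"
proof (induction \<beta> arbitrary: z)
  case (Cons j \<beta>)
  have eq: "coh lam w = (\<lambda>z. exp (0 + bil (\<chi> k. of_real (lam / 2) * cnj (w $ k)) z))"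
    by (simp add: fun_eq_iff coh_eq bil_def cnjv_def sum_distrib_left mult.assoc)
  have "foldr cpartial \<beta> (coh lam w) = (\<lambda>z. (\<Prod>j\<leftarrow>\<beta>. of_real (lam / 2) * cnj (w $ j)) * coh lam w z)"
    using Cons.IH by (rule ext)
  then have "foldr cpartial (j # \<beta>) (coh lam w) z = (\<Prod>j\<leftarrow>\<beta>. of_real (lam / 2) * cnj (w $ j)) * cpartial j (coh lam w) z"
    by (simp add: cpartial_mult cpartial_const entire_fun_const entire_fun_coh)
  also have "cpartial j (coh lam w) z = of_real (lam / 2) * cnj (w $ j) * coh lam w z"
    by (simp only: eq cpartial_exp_bil) simp
  finally show ?case
    by simp
qed simp

text \<open>On the coherent state of parameter \<open>v\<close>, the operator \<open>z\<^sup>\<alpha> \<partial>\<^sub>\<beta>\<close> is the multiplication by a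
  multiple of \<open>bimono (\<alpha>, mset \<beta>) z v\<close>.\<close>

definition bimono :: "('n::finite \<Rightarrow> nat) \<times> 'n multiset \<Rightarrow> complex^'n \<Rightarrow> complex^'n \<Rightarrow> complex" where
  "bimono i u v = monomial (fst i) u * (\<Prod>j\<in>#snd i. cnj (v $ j))"

definition bideg :: "('n::finite \<Rightarrow> nat) \<times> 'n multiset \<Rightarrow> nat" where
  "bideg i = sum (fst i) UNIV + size (snd i)"

lemma bimono_list: "monomial \<alpha> u * (\<Prod>j\<leftarrow>\<beta>. c * cnj (v $ j)) = c ^ length \<beta> * bimono (\<alpha>, mset \<beta>) u v"
proof -
  have "(\<Prod>j\<leftarrow>\<beta>. c * cnj (v $ j)) = c ^ length \<beta> * (\<Prod>j\<in>#mset \<beta>. cnj (v $ j))"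
    by (induction \<beta>) (auto simp: mult_ac)
  then show ?thesis
    by (simp add: bimono_def mult_ac)
qed

lemma diff_op_coh:
  "diff_op S c (coh lam w) z =
     (\<Sum>(\<alpha>, \<beta>)\<in>S. c \<alpha> \<beta> * of_real (lam / 2) ^ length \<beta> * bimono (\<alpha>, mset \<beta>) z w) * coh lam w z"
  unfolding diff_op_def sum_distrib_right split_beta foldr_cpartial_coh
  by (intro sum.cong refl) (simp only: mult.assoc bimono_list[symmetric])

lemma exp_type_diff_op_coh: "exp_type (diff_op S c (coh lam w))"
  unfolding diff_op_def split_beta foldr_cpartial_coh monomial_def
  by (intro exp_type_sum exp_type_mult exp_type_const exp_type_prod exp_type_power exp_type_nth exp_type_coh)

lemma bimono_bound:
  assumes "norm u \<le> R" "norm v \<le> R"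
  shows "cmod (bimono i u v) \<le> R ^ bideg i"
proof -
  have R: "0 \<le> R" using assms(1) norm_ge_zero[of u] by linarith
  have "cmod (monomial (fst i) u) = (\<Prod>k\<in>UNIV. cmod (u $ k) ^ fst i k)"
    by (simp add: monomial_def prod_norm[symmetric] norm_power)
  also have "\<dots> \<le> (\<Prod>k\<in>UNIV. R ^ fst i k)"
    by (intro prod_mono conjI power_mono) (auto intro: order_trans[OF Finite_Cartesian_Product.norm_nth_le assms(1)])
  finally have 1: "cmod (monomial (fst i) u) \<le> R ^ sum (fst i) UNIV"
    by (simp add: power_sum)
  have "cmod (\<Prod>j\<in>#m. cnj (v $ j)) \<le> R ^ size m" for m
  proof (induction m)
    case (add j m)
    then show ?case
      using mult_mono[of "cmod (v $ j)" R "cmod (\<Prod>j\<in>#m. cnj (v $ j))" "R ^ size m"]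
        order_trans[OF Finite_Cartesian_Product.norm_nth_le[of v j] assms(2)] R
      by (simp add: norm_mult)
  qed simp
  from mult_mono[OF 1 this[of "snd i"]] R show ?thesis
    by (simp add: bimono_def bideg_def norm_mult power_add)
qed

lemma bimono_scale:
  "bimono i (of_real t *s u) (of_real t *s v) = of_real t ^ bideg i * bimono i u v"
proof -
  have "(\<Prod>j\<in>#m. cnj ((of_real t *s v) $ j)) = of_real t ^ size m * (\<Prod>j\<in>#m. cnj (v $ j))" for m
    by (induction m) (auto simp: mult_ac)
  then show ?thesis
    by (simp add: bimono_def bideg_def monomial_def power_mult_distrib prod.distrib power_add power_sum mult_ac)
qed

lemma continuous_on_bimono [continuous_intros]:
  assumes "continuous_on S f" "continuous_on S g"
  shows "continuous_on S (\<lambda>x. bimono i (f x) (g x))"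
proof -
  have "continuous_on S (\<lambda>x. \<Prod>j\<in>#m. cnj (g x $ j))" for m
    by (induction m) (auto intro!: continuous_intros assms)
  then show ?thesis
    unfolding bimono_def monomial_def by (intro continuous_intros assms)
qed

lemma power_le_exp_mult: "0 \<le> x \<Longrightarrow> x ^ d \<le> exp (real d * x)"
  using power_mono[of x "exp x" d] exp_ge_add_one_self[of x]
  by (simp add: exp_of_nat_mult)

text \<open>The bound is uniform in the shrinking factor \<open>c\<close>. The case
  \<open>c = 1\<close> gives integrability of the symbol, and \<open>c = 1 / (n + 1)\<close> occurs
  after rescaling; one dominating function covers the whole sequence.\<close>

lemma bimono_gaussian:
  assumes lam: "lam > 0" and c: "\<bar>c\<bar> \<le> 1"
  shows "cmod (bimono i (z + of_real c *s w) (z - of_real c *s w) * of_real (exp (- lam * (norm w)\<^sup>2)))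
     \<le> exp (bideg i * norm z) * exp (bideg i * norm w - lam * (norm w)\<^sup>2)"
proof -
  have "norm (of_real c *s w) \<le> norm w"
    using mult_right_mono[OF c, of "norm w"] by (simp add: norm_smult)
  then have "norm (z + of_real c *s w) \<le> norm z + norm w" "norm (z - of_real c *s w) \<le> norm z + norm w"
    using norm_triangle_ineq[of z "of_real c *s w"] norm_triangle_ineq4[of z "of_real c *s w"] by linarith+
  then have "cmod (bimono i (z + of_real c *s w) (z - of_real c *s w)) \<le> (norm z + norm w) ^ bideg i"
    by (rule bimono_bound)
  also have "\<dots> \<le> exp (bideg i * (norm z + norm w))"
    by (rule power_le_exp_mult) simp
  finally have "cmod (bimono i (z + of_real c *s w) (z - of_real c *s w)) * exp (- lam * (norm w)\<^sup>2) \<le>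
      exp (bideg i * (norm z + norm w)) * exp (- lam * (norm w)\<^sup>2)"
    by (rule mult_right_mono) simp
  then show ?thesis
    by (simp add: norm_mult mult_exp_exp distrib_left add_diff_eq)
qed

lemma bimono_gaussian_measurable:
  "(\<lambda>w. bimono i (z + of_real c *s w) (z - of_real c *s w) * of_real (exp (- lam * (norm w)\<^sup>2))) \<in> borel_measurable borel"
  by (intro borel_measurable_continuous_onI continuous_intros)

lemma bimono_gaussian_integrable:
  assumes lam: "lam > 0" and c: "\<bar>c\<bar> \<le> 1"
  shows "integrable lborel (\<lambda>w. bimono i (z + of_real c *s w) (z - of_real c *s w) * of_real (exp (- lam * (norm w)\<^sup>2)))"
proof (rule Bochner_Integration.integrable_bound)
  show "integrable lborel (\<lambda>w::complex^'a. exp (bideg i * norm z) * exp (bideg i * norm w - lam * (norm w)\<^sup>2))"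
    by (rule gaussian_exp_integrable[OF lam])
  show "AE w in lborel. norm (bimono i (z + of_real c *s w) (z - of_real c *s w) * of_real (exp (- lam * (norm w)\<^sup>2)))
      \<le> norm (exp (bideg i * norm z) * exp (bideg i * norm w - lam * (norm w)\<^sup>2))"
    by (intro AE_I2 order_trans[OF bimono_gaussian[OF assms]]) simp
  show "(\<lambda>w. bimono i (z + of_real c *s w) (z - of_real c *s w) * of_real (exp (- lam * (norm w)\<^sup>2)))
      \<in> borel_measurable lborel"
    using bimono_gaussian_measurable[of i z c lam] by simp
qed

text \<open>Up to a constant factor, the Weyl symbol of the operator with coefficient monomial
  \<open>fst i\<close> and derivatives \<open>snd i\<close>.\<close>

definition moment :: "real \<Rightarrow> ('n::finite \<Rightarrow> nat) \<times> 'n multiset \<Rightarrow> complex^'n \<Rightarrow> complex" where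
  "moment lam i z = (LINT w|lborel. bimono i (z + w) (z - w) * of_real (exp (- lam * (norm w)\<^sup>2)))"

text \<open>Homogeneity of \<open>bimono\<close> moves the scaling from \<open>z\<close> to the
  integration variable, which shrinks by \<open>1 / (n + 1)\<close>. Dominated convergence then
  freezes both arguments at \<open>z\<close> and leaves the Gaussian mass.\<close>

lemma moment_scaled_limit:
  fixes i :: "('n::finite \<Rightarrow> nat) \<times> 'n multiset"
  assumes lam: "lam > 0"
  shows "(\<lambda>n. moment lam i (of_nat (Suc n) *s z) / of_nat (Suc n) ^ bideg i) \<longlonglongrightarrow>
     bimono i z z * of_real (pi / lam) ^ CARD('n)"
proof -
  let ?e = "\<lambda>w::complex^'n. complex_of_real (exp (- lam * (norm w)\<^sup>2))"
  define r where "r n = 1 / real (Suc n)" for n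
  have r: "\<bar>r n\<bar> \<le> 1" for n
    by (simp add: r_def)
  have r0: "r \<longlonglongrightarrow> 0"
    unfolding r_def by (rule LIMSEQ_Suc[OF lim_1_over_n])
  have "moment lam i (of_nat (Suc n) *s z) / of_nat (Suc n) ^ bideg i =
      (LINT w|lborel. bimono i (z + of_real (r n) *s w) (z - of_real (r n) *s w) * ?e w)" for n
  proof -
    have "bimono i (of_nat (Suc n) *s z + w) (of_nat (Suc n) *s z - w) =
        of_nat (Suc n) ^ bideg i * bimono i (z + of_real (r n) *s w) (z - of_real (r n) *s w)" for w
    proof -
      have eqs: "of_nat (Suc n) *s z + w = of_real (real (Suc n)) *s (z + of_real (r n) *s w)"
        "of_nat (Suc n) *s z - w = of_real (real (Suc n)) *s (z - of_real (r n) *s w)"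
        by (simp_all add: vec_eq_iff r_def field_simps del: of_nat_Suc)
      then show ?thesis
        unfolding eqs bimono_scale by (simp only: of_real_of_nat_eq)
    qed
    then show ?thesis
      by (simp add: moment_def mult.assoc del: of_nat_Suc)
  qed
  moreover have "(\<lambda>n. LINT w|lborel. bimono i (z + of_real (r n) *s w) (z - of_real (r n) *s w) * ?e w)
      \<longlonglongrightarrow> (LINT w|lborel. bimono i z z * ?e w)"
  proof (rule integral_dominated_convergence)
    show "integrable lborel (\<lambda>w::complex^'n. exp (bideg i * norm z) * exp (bideg i * norm w - lam * (norm w)\<^sup>2))"
      by (rule gaussian_exp_integrable[OF lam])
    show "AE w in lborel. (\<lambda>n. bimono i (z + of_real (r n) *s w) (z - of_real (r n) *s w) * ?e w) \<longlonglongrightarrow> bimono i z z * ?e w"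
    proof (intro AE_I2 tendsto_mult tendsto_const)
      fix w
      have "continuous_on UNIV (\<lambda>t::real. bimono i (z + of_real t *s w) (z - of_real t *s w))"
        by (intro continuous_intros)
      then have "isCont (\<lambda>t::real. bimono i (z + of_real t *s w) (z - of_real t *s w)) 0"
        by (simp add: continuous_on_eq_continuous_at)
      from isCont_tendsto_compose[OF this r0]
      show "(\<lambda>n. bimono i (z + of_real (r n) *s w) (z - of_real (r n) *s w)) \<longlonglongrightarrow> bimono i z z"
        by simp
    qed
    show "AE w in lborel. norm (bimono i (z + of_real (r n) *s w) (z - of_real (r n) *s w) * ?e w)
        \<le> exp (bideg i * norm z) * exp (bideg i * norm w - lam * (norm w)\<^sup>2)" for n
      by (intro AE_I2 bimono_gaussian[OF lam r])
    show "(\<lambda>w. bimono i (z + of_real (r n) *s w) (z - of_real (r n) *s w) * ?e w) \<in> borel_measurable lborel" for n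
      using bimono_gaussian_measurable[of i z "r n" lam] by simp
    show "(\<lambda>w. bimono i z z * ?e w) \<in> borel_measurable lborel"
      using bimono_gaussian_measurable[of i z 0 lam] by simp
  qed
  moreover have "(LINT w|lborel. bimono i z z * ?e w) = bimono i z z * of_real (pi / lam) ^ CARD('n)"
    using exp_type_gaussian_integrable(2)[OF exp_type_const[of "bimono i z z"] lam] .
  ultimately show ?thesis
    by (simp only:)
qed

text \<open>Dedekind's argument: evaluate the relation at \<open>mul y x\<close> and subtract
  \<open>ch a y\<close> times the relation at \<open>x\<close>. The term of \<open>a\<close>
  disappears, and the other coefficients are multiplied by \<open>ch j y - ch a y\<close>, which is
  nonzero when \<open>y\<close> separates \<open>j\<close> from \<open>a\<close>. Multiplication and
  unit are parameters because the monoid used is \<open>complex^'n\<close> with the coordinatewise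
  product.\<close>

lemma characters_independent:
  fixes ch :: "'i \<Rightarrow> 'm \<Rightarrow> complex" and mul :: "'m \<Rightarrow> 'm \<Rightarrow> 'm"
  assumes "finite T" and "\<And>i x y. i \<in> T \<Longrightarrow> ch i (mul x y) = ch i x * ch i y" and "\<And>i. i \<in> T \<Longrightarrow> ch i e = 1"
    and "\<And>i j. i \<in> T \<Longrightarrow> j \<in> T \<Longrightarrow> i \<noteq> j \<Longrightarrow> \<exists>x. ch i x \<noteq> ch j x"
    and "\<And>x. (\<Sum>i\<in>T. C i * ch i x) = 0" and "i \<in> T"
  shows "C i = 0"
  using assms
proof (induction T arbitrary: C i rule: finite_induct)
  case (insert a T)
  have zero: "C j = 0" if j: "j \<in> T" for j
  proof -
    obtain y where y: "ch j y \<noteq> ch a y"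
      using insert.prems(3)[of j a] insert.hyps j by auto
    have "C j * (ch j y - ch a y) = 0"
    proof (rule insert.IH[where C = "\<lambda>j. C j * (ch j y - ch a y)"])
      fix x
      have "(\<Sum>i\<in>T. C i * ch i x) = - C a * ch a x"
        using insert.prems(4)[of x] insert.hyps by (simp add: add_eq_0_iff)
      moreover have "(\<Sum>i\<in>T. C i * ch i (mul y x)) = - C a * ch a (mul y x)"
        using insert.prems(4)[of "mul y x"] insert.hyps by (simp add: add_eq_0_iff)
      moreover have "(\<Sum>i\<in>T. C i * ch i (mul y x)) = (\<Sum>i\<in>T. C i * ch i y * ch i x)"
        using insert.prems(1) by (intro sum.cong) auto
      ultimately have "(\<Sum>i\<in>T. C i * ch i y * ch i x) = ch a y * (\<Sum>i\<in>T. C i * ch i x)"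
        using insert.prems(1)[of a] by simp
      then show "(\<Sum>i\<in>T. C i * (ch i y - ch a y) * ch i x) = 0"
        by (simp add: sum_distrib_left sum_subtractf algebra_simps)
    qed (use insert.prems j in auto)
    with y show ?thesis by simp
  qed
  moreover have "C a = 0"
    using insert.prems(4)[of e] insert.prems(2)[of a] insert.hyps zero by simp
  ultimately show ?case
    using insert.prems(5) by auto
qed simp

text \<open>If the exponents differ by \<open>d\<close>, the choice \<open>x = pi / d\<close> makes
  the two values opposite.\<close>

lemma cis_power_separates:
  assumes "\<And>x. cis (x * real a) = cis (x * real b)"
  shows "a = b"
proof (rule ccontr)
  assume "a \<noteq> b"
  define d where "d = real a - real b"
  have d: "d \<noteq> 0" using \<open>a \<noteq> b\<close> by (simp add: d_def)
  have "real a = real b + d"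
    by (simp add: d_def)
  then have "cis (pi / d * real a) = cis (pi / d * real b) * cis (pi / d * d)"
    by (simp only: cis_mult distrib_left)
  then show False
    using assms[of "pi / d"] d by simp
qed

text \<open>Setting all coordinates but the \<open>k\<close>-th to 1 isolates the two exponents of
  that coordinate. The value 2 determines their sum, points of the unit circle their
  difference.\<close>

lemma bimono_separates:
  assumes "\<And>z. bimono i z z = bimono j z z"
  shows "i = j"
proof -
  define Z where "Z k x = (\<chi> l. if l = k then x else 1)" for k :: 'a and x :: complex
  have m: "monomial \<alpha> (Z k x) = x ^ \<alpha> k" for \<alpha> k x
    by (subst monomial_split[of _ _ k]) (simp add: Z_def)
  have "(\<Prod>j\<in>#m. cnj (Z k x $ j)) = cnj x ^ count m k" for m k x
    by (induction m) (auto simp: Z_def)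
  then have b: "bimono i (Z k x) (Z k x) = x ^ fst i k * cnj x ^ count (snd i) k" for i k x
    by (simp add: bimono_def m)
  have sums: "fst i k + count (snd i) k = fst j k + count (snd j) k" for k
  proof -
    have "(2::complex) ^ (fst i k + count (snd i) k) = 2 ^ (fst j k + count (snd j) k)"
      using assms[of "Z k 2"] by (simp add: b power_add)
    then have "cmod (2 ^ (fst i k + count (snd i) k)) = cmod (2 ^ (fst j k + count (snd j) k))"
      by (rule arg_cong)
    then show ?thesis
      by (simp only: norm_power norm_numeral) simp
  qed
  have diffs: "fst i k + count (snd j) k = fst j k + count (snd i) k" for k
  proof (rule cis_power_separates)
    fix x
    have "cis (x * (real (fst i k) - real (count (snd i) k))) = cis (x * (real (fst j k) - real (count (snd j) k)))"
    proof -
      have "real n * x + real m * - x = x * (real n - real m)" for n m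
        by (simp add: algebra_simps)
      then show ?thesis
        using assms[of "Z k (cis x)"] unfolding b cis_cnj Complex.DeMoivre cis_mult by (simp only:)
    qed
    then have "cis (x * (real (fst i k) - real (count (snd i) k))) * cis (x * (count (snd i) k + count (snd j) k)) =
      cis (x * (real (fst j k) - real (count (snd j) k))) * cis (x * (count (snd i) k + count (snd j) k))"
      by (rule arg_cong)
    then show "cis (x * real (fst i k + count (snd j) k)) = cis (x * real (fst j k + count (snd i) k))"
      by (simp add: cis_mult algebra_simps)
  qed
  have "fst i k = fst j k \<and> count (snd i) k = count (snd j) k" for k
    using sums[of k] diffs[of k] by linarith
  then show ?thesis
    by (auto simp: prod_eq_iff fun_eq_iff multiset_eq_iff)
qed

lemma moment_independent:
  fixes T :: "(('n::finite \<Rightarrow> nat) \<times> 'n multiset) set"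
  assumes lam: "lam > 0" and T: "finite T" and zero: "\<And>z. (\<Sum>i\<in>T. C i * moment lam i z) = 0" and i: "i \<in> T"
  shows "C i = 0"
proof (rule ccontr)
  assume "C i \<noteq> 0"
  define T' where "T' = {i\<in>T. C i \<noteq> 0}"
  have T': "finite T'" "i \<in> T'"
    using T i \<open>C i \<noteq> 0\<close> by (auto simp: T'_def)
  define d where "d = Max (bideg ` T')"
  have d: "bideg j \<le> d" if "j \<in> T'" for j
    using T' that by (auto simp: d_def)
  obtain a where a: "a \<in> T'" "bideg a = d"
  proof -
    have "d \<in> bideg ` T'"
      unfolding d_def using T' by (intro Max_in) auto
    then show ?thesis
      using that by (elim imageE) simp
  qed
  define G where "G = complex_of_real (pi / lam) ^ CARD('n)"
  have "G \<noteq> 0"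
    using lam by (simp add: G_def)
  have "(\<Sum>j\<in>{j\<in>T'. bideg j = d}. C j * bimono j z z) = 0" for z
  proof -
    \<comment> \<open>The relation at \<open>(n + 1) z\<close> divided by
      \<open>(n + 1) ^ d\<close>. In the limit \<open>0 ^ (d - bideg j)\<close> is 1 for the terms
      of top degree and 0 for the others; on \<open>T'\<close> the truncated subtraction is a true
      one.\<close>
    have "(\<lambda>n. \<Sum>j\<in>T'. C j * (moment lam j (of_nat (Suc n) *s z) / of_nat (Suc n) ^ bideg j) *
        inverse (of_nat (Suc n)) ^ (d - bideg j)) \<longlonglongrightarrow>
      (\<Sum>j\<in>T'. C j * (bimono j z z * G) * 0 ^ (d - bideg j))"
      unfolding G_def
      by (intro tendsto_sum tendsto_mult tendsto_const tendsto_power moment_scaled_limit[OF lam]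
          LIMSEQ_Suc[OF lim_inverse_n])
    moreover have "(\<Sum>j\<in>T'. C j * (moment lam j (of_nat (Suc n) *s z) / of_nat (Suc n) ^ bideg j) *
        inverse (of_nat (Suc n)) ^ (d - bideg j)) = 0" for n
    proof -
      have "(\<Sum>j\<in>T'. C j * (moment lam j (of_nat (Suc n) *s z) / of_nat (Suc n) ^ bideg j) *
          inverse (of_nat (Suc n)) ^ (d - bideg j)) =
          (\<Sum>j\<in>T'. C j * moment lam j (of_nat (Suc n) *s z)) * inverse (of_nat (Suc n)) ^ d"
        unfolding sum_distrib_right
      proof (rule sum.cong)
        fix j assume "j \<in> T'"
        then have "inverse (of_nat (Suc n)) ^ d =
            inverse (of_nat (Suc n) ^ bideg j) * inverse (of_nat (Suc n) :: complex) ^ (d - bideg j)"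
          using d by (metis le_add_diff_inverse power_add power_inverse)
        then show "C j * (moment lam j (of_nat (Suc n) *s z) / of_nat (Suc n) ^ bideg j) *
            inverse (of_nat (Suc n)) ^ (d - bideg j) =
            C j * moment lam j (of_nat (Suc n) *s z) * inverse (of_nat (Suc n)) ^ d"
          by (simp only: divide_inverse mult.assoc)
      qed simp
      also have "(\<Sum>j\<in>T'. C j * moment lam j (of_nat (Suc n) *s z)) = (\<Sum>j\<in>T. C j * moment lam j (of_nat (Suc n) *s z))"
        unfolding T'_def using T by (intro sum.mono_neutral_left) auto
      finally show ?thesis
        by (simp only: zero) simp
    qed
    ultimately have "(\<Sum>j\<in>T'. C j * (bimono j z z * G) * 0 ^ (d - bideg j)) = 0"
      by (simp add: LIMSEQ_const_iff)
    moreover have "(\<Sum>j\<in>T'. C j * (bimono j z z * G) * 0 ^ (d - bideg j)) =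
        (\<Sum>j\<in>{j\<in>T'. bideg j = d}. C j * bimono j z z) * G"
      unfolding sum_distrib_right
    proof (rule sum.mono_neutral_cong_right[OF T'(1)])
      show "\<forall>j\<in>T' - {j\<in>T'. bideg j = d}. C j * (bimono j z z * G) * 0 ^ (d - bideg j) = 0"
      proof
        fix j assume "j \<in> T' - {j\<in>T'. bideg j = d}"
        then have "d - bideg j \<noteq> 0"
          using d[of j] by auto
        then show "C j * (bimono j z z * G) * 0 ^ (d - bideg j) = 0"
          by (simp add: power_0_left)
      qed
    qed auto
    ultimately show ?thesis
      using \<open>G \<noteq> 0\<close> by simp
  qed
  then have "C a = 0"
  proof (rule characters_independent[where ch = "\<lambda>i z. bimono i z z" and mul = "\<lambda>x y. \<chi> k. x $ k * y $ k" and e = "\<chi> k. 1", rotated -2])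
    show "bimono i (\<chi> k. x $ k * y $ k) (\<chi> k. x $ k * y $ k) = bimono i x x * bimono i y y"
      for i :: "('n \<Rightarrow> nat) \<times> 'n multiset" and x y
    proof -
      have "(\<Prod>j\<in>#m. cnj ((\<chi> k. x $ k * y $ k) $ j)) = (\<Prod>j\<in>#m. cnj (x $ j)) * (\<Prod>j\<in>#m. cnj (y $ j))" for m
        by (induction m) auto
      then show ?thesis
        by (simp add: bimono_def monomial_def power_mult_distrib prod.distrib mult_ac)
    qed
    show "bimono i (\<chi> k. 1) (\<chi> k. 1) = 1" for i :: "('n \<Rightarrow> nat) \<times> 'n multiset"
    proof -
      have "(\<Prod>j\<in>#m. cnj ((\<chi> k::'n. 1) $ j)) = 1" for m
        by (induction m) auto
      then show ?thesis
        by (simp add: bimono_def monomial_def)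
    qed
    show "\<exists>x. bimono i x x \<noteq> bimono j x x" if "i \<noteq> j" for i j :: "('n \<Rightarrow> nat) \<times> 'n multiset"
      using bimono_separates[of i j] that by blast
  qed (use a T' in auto)
  with a show False
    by (simp add: T'_def)
qed


section \<open>Injectivity of the symbol map\<close>

lemma W0_integrand_diff_op:
  assumes lam: "lam > 0"
  shows "W0_integrand lam (restrict (diff_op S c) (Collect entire_fun)) z w =
    (\<Sum>(\<alpha>, \<beta>)\<in>S. c \<alpha> \<beta> * of_real (lam / 2) ^ length \<beta> *
      (bimono (\<alpha>, mset \<beta>) (z + w) (z - w) * of_real (exp (- lam * (norm w)\<^sup>2))))"
proof -
  have A: "restrict (diff_op S c) (Collect entire_fun) (coh lam (z - w)) = diff_op S c (coh lam (z - w))"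
    by (simp add: entire_fun_coh)
  show ?thesis
    by (subst W0_integrand_eq[OF _ lam], unfold A, rule exp_type_diff_op_coh)
       (simp only: diff_op_coh mult.assoc coh_W0_factor sum_distrib_right case_prod_unfold)
qed

lemma W0_integrand_diff_op_integrable:
  assumes lam: "lam > 0"
  shows "integrable (mu lam) (W0_integrand lam (restrict (diff_op S c) (Collect entire_fun)) z)"
    and "W0_integrand lam (restrict (diff_op S c) (Collect entire_fun)) z \<in> borel_measurable borel"
proof -
  let ?h = "\<lambda>\<alpha> \<beta> w. bimono (\<alpha>, mset \<beta>) (z + w) (z - w) * complex_of_real (exp (- lam * (norm w)\<^sup>2))"
  have h: "?h \<alpha> \<beta> \<in> borel_measurable borel" "integrable lborel (?h \<alpha> \<beta>)" for \<alpha> \<beta>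
    using bimono_gaussian_measurable[of "(\<alpha>, mset \<beta>)" z 1 lam] bimono_gaussian_integrable[OF lam, of 1 "(\<alpha>, mset \<beta>)" z]
    by simp_all
  have eq: "W0_integrand lam (restrict (diff_op S c) (Collect entire_fun)) z =
    (\<lambda>w. \<Sum>(\<alpha>, \<beta>)\<in>S. c \<alpha> \<beta> * of_real (lam / 2) ^ length \<beta> * ?h \<alpha> \<beta> w)"
    by (rule ext, rule W0_integrand_diff_op[OF lam])
  show m: "W0_integrand lam (restrict (diff_op S c) (Collect entire_fun)) z \<in> borel_measurable borel"
    unfolding eq split_beta by (intro borel_measurable_sum borel_measurable_times borel_measurable_const h(1))
  show "integrable (mu lam) (W0_integrand lam (restrict (diff_op S c) (Collect entire_fun)) z)"
    unfolding integrable_mu[OF lam m]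
    unfolding eq split_beta by (intro Bochner_Integration.integrable_sum integrable_mult_right h(2))
qed

lemma W0_diff_op:
  fixes S :: "(('n::finite \<Rightarrow> nat) \<times> 'n list) set"
  assumes lam: "lam > 0"
  shows "W0 lam (restrict (diff_op S c) (Collect entire_fun)) z =
    2 ^ CARD('n) * of_real ((lam / (2 * pi)) ^ CARD('n)) *
      (\<Sum>(\<alpha>, \<beta>)\<in>S. c \<alpha> \<beta> * of_real (lam / 2) ^ length \<beta> * moment lam (\<alpha>, mset \<beta>) z)"
proof -
  let ?h = "\<lambda>\<alpha> \<beta> w. bimono (\<alpha>, mset \<beta>) (z + w) (z - w) * complex_of_real (exp (- lam * (norm w)\<^sup>2))"
  have h: "integrable lborel (?h \<alpha> \<beta>)" for \<alpha> \<beta>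
    using bimono_gaussian_integrable[OF lam, of 1 "(\<alpha>, mset \<beta>)" z] by simp
  have "W0 lam (restrict (diff_op S c) (Collect entire_fun)) z =
    2 ^ CARD('n) * (of_real ((lam / (2 * pi)) ^ CARD('n)) *
      (LINT w|lborel. (\<Sum>(\<alpha>, \<beta>)\<in>S. c \<alpha> \<beta> * of_real (lam / 2) ^ length \<beta> * ?h \<alpha> \<beta> w)))"
    unfolding W0_def integral_mu[OF lam W0_integrand_diff_op_integrable(2)[OF lam]]
    unfolding W0_integrand_diff_op[OF lam] by (simp only: mult.assoc)
  also have "(LINT w|lborel. (\<Sum>(\<alpha>, \<beta>)\<in>S. c \<alpha> \<beta> * of_real (lam / 2) ^ length \<beta> * ?h \<alpha> \<beta> w)) =
    (\<Sum>(\<alpha>, \<beta>)\<in>S. c \<alpha> \<beta> * of_real (lam / 2) ^ length \<beta> * moment lam (\<alpha>, mset \<beta>) z)"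
    unfolding split_beta moment_def
    by (subst Bochner_Integration.integral_sum, intro integrable_mult_right h)
       (simp only: integral_mult_right_zero)
  finally show ?thesis
    by (simp only: mult.assoc)
qed

text \<open>Only the sums \<open>C\<close> of coefficients over terms with the same
  \<open>key\<close> are forced to vanish, not the coefficients \<open>c\<close> themselves. This
  suffices: on an entire function all members of such a group yield the same derivative.\<close>

lemma diff_op_eq_0:
  fixes S :: "(('n::finite \<Rightarrow> nat) \<times> 'n list) set"
  assumes lam: "lam > 0" and S: "finite S" and zero: "\<And>z. W0 lam (restrict (diff_op S c) (Collect entire_fun)) z = 0"
    and f: "entire_fun f"
  shows "diff_op S c f z = 0"
proof -
  define key :: "('n \<Rightarrow> nat) \<times> 'n list \<Rightarrow> ('n \<Rightarrow> nat) \<times> 'n multiset" where "key x = (fst x, mset (snd x))" for x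
  define C where "C i = (\<Sum>x\<in>{x\<in>S. key x = i}. c (fst x) (snd x))" for i
  have "C i * of_real (lam / 2) ^ size (snd i) = 0" if "i \<in> key ` S" for i
  proof (rule moment_independent[OF lam _ _ that])
    fix z
    have "(\<Sum>x\<in>S. c (fst x) (snd x) * of_real (lam / 2) ^ length (snd x) * moment lam (key x) z) = 0"
      using zero[of z] lam by (simp add: W0_diff_op key_def split_beta)
    also have "(\<Sum>x\<in>S. c (fst x) (snd x) * of_real (lam / 2) ^ length (snd x) * moment lam (key x) z) =
       (\<Sum>i\<in>key ` S. \<Sum>x\<in>{x\<in>S. key x = i}. c (fst x) (snd x) * of_real (lam / 2) ^ length (snd x) * moment lam (key x) z)"
      by (rule sum.image_gen[OF S])
    also have "\<dots> = (\<Sum>i\<in>key ` S. C i * of_real (lam / 2) ^ size (snd i) * moment lam i z)"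
      unfolding C_def sum_distrib_right by (intro sum.cong refl) (auto simp: key_def)
    finally show "(\<Sum>i\<in>key ` S. C i * of_real (lam / 2) ^ size (snd i) * moment lam i z) = 0" .
  qed (use S in auto)
  then have C: "C i = 0" if "i \<in> key ` S" for i
    using that lam by simp
  have "diff_op S c f z = (\<Sum>i\<in>key ` S. \<Sum>x\<in>{x\<in>S. key x = i}. c (fst x) (snd x) * monomial (fst x) z * foldr cpartial (snd x) f z)"
    unfolding diff_op_def split_beta by (rule sum.image_gen[OF S])
  also have "\<dots> = 0"
  proof (rule sum.neutral, rule ballI)
    fix i assume i: "i \<in> key ` S"
    then obtain y where y: "y \<in> S" "i = key y" by blast
    have "(\<Sum>x\<in>{x\<in>S. key x = i}. c (fst x) (snd x) * monomial (fst x) z * foldr cpartial (snd x) f z) =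
        C i * (monomial (fst y) z * foldr cpartial (snd y) f z)"
      unfolding C_def sum_distrib_right mult.assoc
    proof (intro sum.cong refl)
      fix x assume "x \<in> {x\<in>S. key x = i}"
      then have "fst x = fst y" "foldr cpartial (snd x) f = foldr cpartial (snd y) f"
        using y(2) by (auto simp: key_def intro: foldr_cpartial_mset[OF f])
      then show "c (fst x) (snd x) * (monomial (fst x) z * foldr cpartial (snd x) f z) =
          c (fst x) (snd x) * (monomial (fst y) z * foldr cpartial (snd y) f z)"
        by simp
    qed
    then show "(\<Sum>x\<in>{x\<in>S. key x = i}. c (fst x) (snd x) * monomial (fst x) z * foldr cpartial (snd x) f z) = 0"
      using C[OF i] by simp
  qed
  finally show ?thesis .
qed

text \<open>The difference is again such an operator, and integrability of both integrands makes its
  symbol the difference of the symbols, hence 0. Equality of the operators follows because both are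
  \<open>undefined\<close> off the entire functions.\<close>

lemma W0_injective:
  fixes A B :: "'n::finite operator"
  assumes lam: "lam > 0" and A: "A \<in> poly_diff_ops" and B: "B \<in> poly_diff_ops" and eq: "W0 lam A = W0 lam B"
  shows "A = B"
proof -
  obtain S1 c1 where A1: "finite S1" "A = restrict (diff_op S1 c1) (Collect entire_fun)"
    using A unfolding poly_diff_ops_eq by blast
  obtain S2 c2 where B1: "finite S2" "B = restrict (diff_op S2 c2) (Collect entire_fun)"
    using B unfolding poly_diff_ops_eq by blast
  have "is_pdo (\<lambda>f z. diff_op S1 c1 f z + (-1) * diff_op S2 c2 f z)"
    using A1(1) B1(1) by (intro is_pdo_add is_pdo_cmult) (auto simp: is_pdo_def)
  then obtain S c where S: "finite S"
    "\<And>f. entire_fun f \<Longrightarrow> (\<lambda>z. diff_op S1 c1 f z + (-1) * diff_op S2 c2 f z) = diff_op S c f"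
    unfolding is_pdo_def by blast
  have "W0_integrand lam (restrict (diff_op S c) (Collect entire_fun)) z w =
      W0_integrand lam A z w - W0_integrand lam B z w" for z w
  proof -
    have *: "exp_type (restrict (diff_op S c) (Collect entire_fun) (coh lam w))" for S :: "(('n \<Rightarrow> nat) \<times> 'n list) set" and c w
      by (simp add: entire_fun_coh exp_type_diff_op_coh)
    show ?thesis
      unfolding A1 B1 W0_integrand_eq[where A = "restrict _ _", OF * lam]
      using fun_cong[OF S(2)[OF entire_fun_coh[of lam "z - w"]], of "z + w"]
      by (simp add: entire_fun_coh algebra_simps)
  qed
  then have "W0_integrand lam (restrict (diff_op S c) (Collect entire_fun)) z =
      (\<lambda>w. W0_integrand lam A z w - W0_integrand lam B z w)" for z
    by (rule ext)
  then have "W0 lam (restrict (diff_op S c) (Collect entire_fun)) z = W0 lam A z - W0 lam B z" for z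
    unfolding W0_def
    by (simp add: A1 B1 W0_integrand_diff_op_integrable(1)[OF lam] algebra_simps)
  then have "diff_op S c f z = 0" if "entire_fun f" for f z
    by (intro diff_op_eq_0[OF lam S(1) _ that]) (simp add: eq)
  then have "diff_op S1 c1 f z = diff_op S2 c2 f z" if "entire_fun f" for f z
    using fun_cong[OF S(2)[OF that], of z] that by simp
  then show ?thesis
    unfolding A1 B1 by (intro restrict_ext ext) simp
qed

lemma W0_inv_W0:
  assumes "lam > 0" "is_pdo X"
  shows "W0_inv lam (W0 lam (restrict X (Collect entire_fun))) = restrict X (Collect entire_fun)"
  unfolding W0_inv_def using W0_injective[OF assms(1)] is_pdo_poly_diff_ops[OF assms(2)]
  by (intro the_equality) auto

section \<open>The flow of the quadratic generator on coherent states\<close>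

lemma bounded_on_cball:
  fixes f :: "complex \<Rightarrow> complex"
  assumes "continuous_on (cball 0 R) f"
  shows "\<exists>C. \<forall>t\<in>cball 0 R. cmod (f t) \<le> C"
  using compact_imp_bounded[OF compact_continuous_image[OF assms compact_cball]]
  unfolding bounded_iff by auto

locale quadratic =
  fixes lam c0 :: real and a :: "complex^'n" and b :: "real^'n"
  assumes lam: "lam > 0" and b: "\<And>k. b $ k \<noteq> 0"
begin

definition om :: "'n \<Rightarrow> complex" where
  "om k = \<i> * of_real (2 * b $ k / lam)"

text \<open>Weyl quantisation of \<open>P\<close>: \<open>cnj (z $ k)\<close> becomes
  \<open>2 / lam\<close> times \<open>cpartial k\<close>, and the squared modulus becomes the
  symmetrised product, that is \<open>2 / lam\<close> times
  \<open>z $ k * cpartial k + 1 / 2\<close>. The last term \<open>om k / 2\<close> comes from this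
  symmetrisation.\<close>

definition gen :: "'n operator" where
  "gen f z = \<i> * of_real c0 * f z + (\<Sum>k\<in>UNIV. cnj (a $ k) * (z $ k * f z)
     + (- (2 / of_real lam) * a $ k) * cpartial k f z
     + om k * (z $ k * cpartial k f z) + om k / 2 * f z)"

text \<open>The solution of the characteristic equation \<open>bet' = om * bet + cnj a\<close> with
  initial value \<open>lam / 2 * cnj w\<close>, found by inserting an exponential of an affine
  function of \<open>z\<close> into the evolution equation. Then \<open>alp\<close> is the
  primitive, vanishing at 0, of \<open>i c0\<close> plus the sum of
  \<open>om k / 2 - 2 / lam * a k * bet k\<close>.\<close>

definition bet :: "complex \<Rightarrow> complex^'n \<Rightarrow> complex^'n" where
  "bet t w = (\<chi> k. exp (om k * t) * (of_real (lam / 2) * cnj (w $ k) + cnj (a $ k) / om k) - cnj (a $ k) / om k)"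

definition alp :: "complex \<Rightarrow> complex^'n \<Rightarrow> complex" where
  "alp t w = \<i> * of_real c0 * t + (\<Sum>k\<in>UNIV. om k / 2 * t - 2 / of_real lam * a $ k *
     ((of_real (lam / 2) * cnj (w $ k) + cnj (a $ k) / om k) * ((exp (om k * t) - 1) / om k) - cnj (a $ k) / om k * t))"

text \<open>The solution of the Schroedinger equation \<open>\<partial>u/\<partial>t = gen u\<close> that starts at the coherent state
  of parameter \<open>w\<close>; here \<open>t\<close> is a complex time.\<close>

definition flow :: "complex^'n \<Rightarrow> complex \<Rightarrow> complex^'n \<Rightarrow> complex" where
  "flow w t z = exp (alp t w + bil (bet t w) z)"

lemma om_nonzero: "om k \<noteq> 0"
  using lam b[of k] by (simp add: om_def)

lemma flow_0: "flow w 0 = coh lam w"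
  by (simp add: fun_eq_iff flow_def alp_def bet_def coh_eq bil_def cnjv_def sum_distrib_left mult.assoc)

lemma cpartial_flow: "cpartial k (flow w t) z = bet t w $ k * flow w t z"
  unfolding flow_def[abs_def] by (rule cpartial_exp_bil)

lemma exp_type_flow: "exp_type (flow w t)"
proof -
  have "exp_type (\<lambda>z. exp (alp t w) * exp (1 * bil (bet t w) z))"
    by (intro exp_type_mult exp_type_const exp_type_exp_bil)
  then show ?thesis
    by (simp add: flow_def[abs_def] exp_add)
qed

lemma flow_has_derivative:
  "((\<lambda>t. flow w t z) has_field_derivative gen (flow w t) z) (at t)"
proof -
  let ?s = "complex_of_real (lam / 2)"
  have bet': "((\<lambda>t. bet t w $ k) has_field_derivative om k * bet t w $ k + cnj (a $ k)) (at t)" for k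
    unfolding bet_def using om_nonzero[of k]
    by (auto intro!: derivative_eq_intros simp: algebra_simps)
  let ?X = "\<lambda>k. ?s * cnj (w $ k) + cnj (a $ k) / om k"
  have exp': "((\<lambda>t. (exp (om k * t) - 1) / om k) has_field_derivative exp (om k * t)) (at t)" for k
    using om_nonzero[of k] by (auto intro!: derivative_eq_intros)
  have "((\<lambda>t. alp t w) has_field_derivative
      \<i> * of_real c0 * 1 + (\<Sum>k\<in>UNIV. om k / 2 * 1 - 2 / of_real lam * a $ k * (?X k * exp (om k * t) - cnj (a $ k) / om k * 1))) (at t)"
    unfolding alp_def by (intro DERIV_add DERIV_cmult DERIV_ident DERIV_sum DERIV_diff exp')
  then have alp': "((\<lambda>t. alp t w) has_field_derivative
      \<i> * of_real c0 + (\<Sum>k\<in>UNIV. om k / 2 - 2 / of_real lam * a $ k * bet t w $ k)) (at t)"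
    by (simp add: bet_def mult.commute)
  have "((\<lambda>t. flow w t z) has_field_derivative flow w t z * (\<i> * of_real c0 +
      (\<Sum>k\<in>UNIV. om k / 2 - 2 / of_real lam * a $ k * bet t w $ k) +
      (\<Sum>k\<in>UNIV. (om k * bet t w $ k + cnj (a $ k)) * z $ k))) (at t)"
    unfolding flow_def bil_def by (auto intro!: derivative_eq_intros alp' bet')
  also have "flow w t z * (\<i> * of_real c0 +
      (\<Sum>k\<in>UNIV. om k / 2 - 2 / of_real lam * a $ k * bet t w $ k) +
      (\<Sum>k\<in>UNIV. (om k * bet t w $ k + cnj (a $ k)) * z $ k)) = gen (flow w t) z"
    unfolding gen_def cpartial_flow
    by (simp add: sum_distrib_left sum.distrib[symmetric] sum_subtractf[symmetric] algebra_simps)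
  finally show ?thesis .
qed

lemma flow_holomorphic: "(\<lambda>t. flow w t z) holomorphic_on S"
  unfolding holomorphic_on_def field_differentiable_def
  by (blast intro: flow_has_derivative has_field_derivative_at_within)

lemma continuous_on_bet [continuous_intros]:
  assumes "continuous_on S f" "continuous_on S g"
  shows "continuous_on S (\<lambda>x. bet (f x) (g x) $ k)"
  unfolding bet_def vec_lambda_beta using om_nonzero
  by (intro continuous_intros assms) auto

lemma continuous_on_alp [continuous_intros]:
  assumes "continuous_on S f" "continuous_on S g"
  shows "continuous_on S (\<lambda>x. alp (f x) (g x))"
  unfolding alp_def using om_nonzero
  by (intro continuous_intros assms) auto

lemma continuous_on_flow [continuous_intros]:
  assumes "continuous_on S f" "continuous_on S g" "continuous_on S h"
  shows "continuous_on S (\<lambda>x. flow (g x) (f x) (h x))"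
  unfolding flow_def bil_def by (intro continuous_intros assms)

section \<open>Time Taylor coefficients and powers of the generator\<close>

definition coef :: "nat \<Rightarrow> complex^'n \<Rightarrow> complex^'n \<Rightarrow> complex" where
  "coef m w z = (deriv ^^ m) (\<lambda>t. flow w t z) 0"

lemma coef_circle:
  assumes "r > 0"
  shows "((\<lambda>x. flow w (of_real r * circ x) z / circ x ^ m) has_integral of_real r ^ m * coef m w z / fact m) {0..1}"
  unfolding coef_def by (rule Cauchy_coeff_circle[OF assms flow_holomorphic])

text \<open>A time coefficient is a circle integral of the flow, so a derivative in \<open>z\<close>
  can be taken under the integral, where it multiplies the flow by \<open>bet\<close>.\<close>

lemma cpartial_coef:
  "((\<lambda>x. bet (circ x) w $ k * flow w (circ x) z / circ x ^ m) has_integral cpartial k (coef m w) z / fact m) {0..1}"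
proof -
  have int: "integral {0..1} (\<lambda>x. flow w (circ x) z / circ x ^ m) = coef m w z / fact m" for z
    using integral_unique[OF coef_circle[OF zero_less_one, of w z m]] by simp
  have "((\<lambda>\<tau>. integral (cbox 0 1) (\<lambda>x. flow w (circ x) (z + \<tau> *s axis k 1) / circ x ^ m)) has_field_derivative
      integral (cbox 0 1) (\<lambda>x. bet (circ x) w $ k * flow w (circ x) (z + 0 *s axis k 1) / circ x ^ m)) (at 0 within UNIV)"
  proof (rule leibniz_rule_field_derivative[where fx = "\<lambda>\<tau> x. bet (circ x) w $ k * flow w (circ x) (z + \<tau> *s axis k 1) / circ x ^ m"])
    show "((\<lambda>\<tau>. flow w (circ x) (z + \<tau> *s axis k 1) / circ x ^ m) has_field_derivative
        bet (circ x) w $ k * flow w (circ x) (z + \<tau> *s axis k 1) / circ x ^ m) (at \<tau> within UNIV)" for x \<tau>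
      unfolding flow_def bil_axis by (auto intro!: derivative_eq_intros)
    show "continuous_on (UNIV \<times> cbox 0 1) (\<lambda>(\<tau>, x). bet (circ x) w $ k * flow w (circ x) (z + \<tau> *s axis k 1) / circ x ^ m)"
      unfolding split_beta by (intro continuous_intros) auto
  qed (auto intro!: integrable_continuous_interval continuous_intros)
  then have "((\<lambda>\<tau>. coef m w (z + \<tau> *s axis k 1) / fact m) has_field_derivative
      integral {0..1} (\<lambda>x. bet (circ x) w $ k * flow w (circ x) z / circ x ^ m)) (at 0)"
    by (simp add: int)
  from DERIV_cmult[OF this, of "fact m"]
  have "cpartial k (coef m w) z = fact m * integral {0..1} (\<lambda>x. bet (circ x) w $ k * flow w (circ x) z / circ x ^ m)"
    unfolding cpartial_def by (intro DERIV_imp_deriv) simp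
  moreover have "(\<lambda>x. bet (circ x) w $ k * flow w (circ x) z / circ x ^ m) integrable_on {0..1}"
    by (intro integrable_continuous_interval continuous_intros) auto
  ultimately show ?thesis
    by (simp add: has_integral_integral)
qed

text \<open>Integrate the evolution equation over the unit circle against
  \<open>1 / circ x ^ m\<close>. On one side \<open>gen\<close> passes through the integral, on the
  other Cauchy's formula for the time derivative of the flow raises the order by one.\<close>

lemma gen_coef: "gen (coef m w) z = coef (Suc m) w z"
proof -
  have flow_int: "((\<lambda>x. flow w (circ x) z / circ x ^ m) has_integral coef m w z / fact m) {0..1}"
    using coef_circle[OF zero_less_one, of w z m] by simp
  have "((\<lambda>x. \<i> * of_real c0 * (flow w (circ x) z / circ x ^ m) + (\<Sum>k\<in>UNIV.
        cnj (a $ k) * (z $ k * (flow w (circ x) z / circ x ^ m))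
     + (- (2 / of_real lam) * a $ k) * (bet (circ x) w $ k * flow w (circ x) z / circ x ^ m)
     + om k * (z $ k * (bet (circ x) w $ k * flow w (circ x) z / circ x ^ m))
     + om k / 2 * (flow w (circ x) z / circ x ^ m))) has_integral
      (\<i> * of_real c0 * (coef m w z / fact m) + (\<Sum>k\<in>UNIV.
        cnj (a $ k) * (z $ k * (coef m w z / fact m))
     + (- (2 / of_real lam) * a $ k) * (cpartial k (coef m w) z / fact m)
     + om k * (z $ k * (cpartial k (coef m w) z / fact m))
     + om k / 2 * (coef m w z / fact m)))) {0..1}" (is "(?F has_integral ?I) _")
    by (intro has_integral_add has_integral_sum has_integral_mult_right flow_int cpartial_coef finite)
  moreover have "?I = gen (coef m w) z / fact m"
    by (simp add: gen_def add_divide_distrib diff_divide_distrib sum_divide_distrib)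
  moreover have "?F x = deriv (\<lambda>t. flow w t z) (circ x) / circ x ^ m" for x
    by (simp add: DERIV_imp_deriv[OF flow_has_derivative] gen_def cpartial_flow add_divide_distrib diff_divide_distrib sum_divide_distrib)
  ultimately have "((\<lambda>x. deriv (\<lambda>t. flow w t z) (circ x) / circ x ^ m) has_integral gen (coef m w) z / fact m) {0..1}"
    by simp
  moreover have "((\<lambda>x. deriv (\<lambda>t. flow w t z) (of_real 1 * circ x) / circ x ^ m) has_integral
      of_real 1 ^ m * (deriv ^^ m) (deriv (\<lambda>t. flow w t z)) 0 / fact m) {0..1}"
    by (intro Cauchy_coeff_circle holomorphic_on_subset[OF holomorphic_deriv[OF flow_holomorphic open_UNIV]]) auto
  ultimately have "gen (coef m w) z / fact m = (deriv ^^ m) (deriv (\<lambda>t. flow w t z)) 0 / fact m"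
    by (auto dest: has_integral_unique)
  then show ?thesis
    by (simp add: coef_def funpow_swap1)
qed

lemma gen_power_coh: "(gen ^^ m) (coh lam w) = coef m w"
proof (induction m)
  case 0
  then show ?case
    by (simp add: coef_def fun_eq_iff flow_0)
next
  case (Suc m)
  then show ?case
    by (simp add: gen_coef[abs_def])
qed

lemma is_pdo_gen:
  assumes "is_pdo X"
  shows "is_pdo (\<lambda>f. gen (X f))"
  unfolding gen_def[abs_def]
  by (intro is_pdo_add is_pdo_sum is_pdo_cmult is_pdo_nth assms is_pdo_cpartial)

lemma is_pdo_gen_power: "is_pdo (gen ^^ m)"
proof (induction m)
  case 0
  then show ?case
    using is_pdo_id by (simp add: id_def)
next
  case (Suc m)
  then show ?case
    using is_pdo_gen by (simp add: o_def)
qed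

lemma exp_type_coef: "exp_type (coef m w)"
proof -
  obtain S c where "\<And>f. entire_fun f \<Longrightarrow> (gen ^^ m) f = diff_op S c f"
    using is_pdo_gen_power[of m] unfolding is_pdo_def by blast
  then show ?thesis
    by (simp flip: gen_power_coh) (simp add: entire_fun_coh exp_type_diff_op_coh)
qed

section \<open>Growth of the flow and convergence in the Fock norm\<close>

lemma flow_bound:
  obtains C M where "0 \<le> M" "\<And>t z. cmod t \<le> R \<Longrightarrow> cmod (flow w t z) \<le> exp (C + M * norm z)"
proof -
  have "\<exists>C. \<forall>t\<in>cball 0 R. cmod (alp t w) \<le> C"
    by (intro bounded_on_cball continuous_intros)
  then obtain C where C: "\<And>t. t \<in> cball 0 R \<Longrightarrow> cmod (alp t w) \<le> C" by blast
  have "\<forall>k. \<exists>D. \<forall>t\<in>cball 0 R. cmod (bet t w $ k) \<le> D"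
    by (intro allI bounded_on_cball continuous_intros)
  then obtain D where D: "\<And>k t. t \<in> cball 0 R \<Longrightarrow> cmod (bet t w $ k) \<le> D k" by metis
  show thesis
  proof
    show "0 \<le> (\<Sum>k\<in>UNIV. \<bar>D k\<bar>)" by (simp add: sum_nonneg)
    fix t z assume t: "cmod t \<le> R"
    have "Re (alp t w + bil (bet t w) z) \<le> cmod (alp t w) + cmod (bil (bet t w) z)"
      using complex_Re_le_cmod[of "alp t w"] complex_Re_le_cmod[of "bil (bet t w) z"] by simp
    also have "\<dots> \<le> C + (\<Sum>k\<in>UNIV. cmod (bet t w $ k)) * norm z"
      using C[of t] t by (intro add_mono bil_bound) auto
    also have "\<dots> \<le> C + (\<Sum>k\<in>UNIV. \<bar>D k\<bar>) * norm z"
      using t by (intro add_left_mono mult_right_mono sum_mono order_trans[OF D abs_ge_self]) auto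
    finally show "cmod (flow w t z) \<le> exp (C + (\<Sum>k\<in>UNIV. \<bar>D k\<bar>) * norm z)"
      by (simp add: flow_def)
  qed
qed

lemma flow_taylor_remainder:
  obtains C M where "0 \<le> M"
    "\<And>N z :: complex^'n. cmod ((\<Sum>k<N. coef k w z / fact k) - flow w 1 z) \<le> (1 / 2) ^ N * exp (C + M * norm z)"
proof -
  obtain C M where M: "0 \<le> M" and bound: "\<And>t z. cmod t \<le> 2 \<Longrightarrow> cmod (flow w t z) \<le> exp (C + M * norm z)"
    by (rule flow_bound) blast
  show thesis
  proof
    fix N and z :: "complex^'n"
    let ?E = "exp (C + M * norm z)"
    have c: "cmod (coef k w z / fact k) \<le> ?E * (1 / 2) ^ k" for k
    proof -
      have "cmod (coef k w z) \<le> fact k * ?E / 2 ^ k"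
        unfolding coef_def
      proof (rule Cauchy_inequality)
        show "cmod (flow w x z) \<le> ?E" if "norm (0 - x) = 2" for x
          using that by (intro bound) (simp add: norm_minus_commute)
      qed (auto intro!: holomorphic_on_imp_continuous_on flow_holomorphic)
      then show ?thesis
        by (simp add: norm_divide divide_simps mult_ac power_one_over)
    qed
    have "(\<lambda>k. coef k w z / fact k * (1 - 0) ^ k) sums flow w 1 z"
      unfolding coef_def 
      by (rule holomorphic_power_series[where f = "\<lambda>t. flow w t z" and r = 2, OF flow_holomorphic]) simp
    then have "(\<lambda>k. coef k w z / fact k) sums flow w 1 z" by simp
    from sums_split_initial_segment[OF this, of N]
    have tail: "(\<lambda>k. coef (k + N) w z / fact (k + N)) sums (flow w 1 z - (\<Sum>k<N. coef k w z / fact k))" .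
    have geo: "(\<lambda>k. ?E * (1 / 2) ^ N * (1 / 2) ^ k) sums (?E * (1 / 2) ^ N * 2)"
      using sums_mult[OF geometric_sums[of "1 / 2 :: real"], of "?E * (1 / 2) ^ N"] by simp
    have "cmod (\<Sum>k. coef (k + N) w z / fact (k + N)) \<le> (\<Sum>k. ?E * (1 / 2) ^ N * (1 / 2) ^ k)"
    proof (rule norm_suminf_le[OF _ sums_summable[OF geo]])
      show "cmod (coef (k + N) w z / fact (k + N)) \<le> ?E * (1 / 2) ^ N * (1 / 2) ^ k" for k
        using c[of "k + N"] by (simp add: power_add mult_ac)
    qed
    then have "cmod (flow w 1 z - (\<Sum>k<N. coef k w z / fact k)) \<le> ?E * (1 / 2) ^ N * 2"
      by (simp only: sums_unique[OF tail] sums_unique[OF geo])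
    \<comment> \<open>The factor 2 from the geometric tail is absorbed in the exponent, raising the
      constant \<open>C\<close> by 1, since \<open>2 <= exp 1\<close>.\<close>
    also have "\<dots> \<le> ?E * (1 / 2) ^ N * exp 1"
      using exp_ge_add_one_self[of 1] by (intro mult_left_mono) auto
    also have "\<dots> = (1 / 2) ^ N * exp ((C + 1) + M * norm z)"
      by (simp add: exp_add mult_ac)
    finally show "cmod ((\<Sum>k<N. coef k w z / fact k) - flow w 1 z) \<le> (1 / 2) ^ N * exp ((C + 1) + M * norm z)"
      by (simp only: norm_minus_commute)
  qed (rule M)
qed

end

text \<open>Square the pointwise bound and integrate. The root on the right does not depend on
  \<open>d\<close> or \<open>e\<close>, so a factor \<open>e\<close> tending to 0 forces convergence
  in norm.\<close>

lemma fock_norm_le: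
  fixes d :: "complex^'n \<Rightarrow> complex"
  assumes lam: "lam > 0" and d: "entire_fun d" and bound: "\<And>z. cmod (d z) \<le> e * exp (C + M * norm z)" and e: "0 \<le> e"
  shows "fock_norm lam d \<le> e * sqrt (LINT z::complex^'n|mu lam. exp (2 * C) * exp (2 * M * norm z - lam / 2 * (norm z)\<^sup>2))"
proof -
  let ?w = "\<lambda>z::complex^'n. exp (- lam * (norm z)\<^sup>2 / 2)"
  let ?G = "\<lambda>z::complex^'n. exp (2 * C) * exp (2 * M * norm z - lam / 2 * (norm z)\<^sup>2)"
  have mG: "?G \<in> borel_measurable borel"
    by (intro borel_measurable_continuous_onI continuous_intros)
  have G: "integrable (mu lam) ?G"
    unfolding integrable_mu[OF lam mG] using lam by (intro gaussian_exp_integrable) simp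
  have le: "(cmod (d z))\<^sup>2 * ?w z \<le> e\<^sup>2 * ?G z" for z
  proof -
    have "(cmod (d z))\<^sup>2 \<le> (e * exp (C + M * norm z))\<^sup>2"
      using bound by (intro power_mono) auto
    also have "\<dots> = e\<^sup>2 * exp (2 * C + 2 * M * norm z)"
      by (simp add: power_mult_distrib exp_double[symmetric] distrib_left mult.assoc)
    finally have "(cmod (d z))\<^sup>2 * ?w z \<le> e\<^sup>2 * exp (2 * C + 2 * M * norm z) * ?w z"
      by (rule mult_right_mono) simp
    then show ?thesis
      by (simp add: mult.assoc mult_exp_exp add_diff_eq)
  qed
  have md: "(\<lambda>z. (cmod (d z))\<^sup>2 * ?w z) \<in> borel_measurable borel"
    by (intro borel_measurable_continuous_onI continuous_intros entire_fun_continuous d) simp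
  have "fock_inner lam d d = (LINT z|mu lam. of_real ((cmod (d z))\<^sup>2 * ?w z))"
    unfolding fock_inner_def by (simp only: of_real_mult complex_norm_square)
  then have "Re (fock_inner lam d d) = (LINT z|mu lam. (cmod (d z))\<^sup>2 * ?w z)"
    by (simp only: integral_complex_of_real Re_complex_of_real)
  also have "\<dots> \<le> (LINT z|mu lam. e\<^sup>2 * ?G z)"
  proof (rule integral_mono)
    show "integrable (mu lam) (\<lambda>z. (cmod (d z))\<^sup>2 * ?w z)"
      by (rule Bochner_Integration.integrable_bound[OF integrable_mult_right[OF G, of "e\<^sup>2"]])
         (use le md in \<open>simp_all add: mu_def\<close>)
  qed (use G le in auto)
  also have "\<dots> = e\<^sup>2 * (LINT z|mu lam. ?G z)"
    by (rule integral_mult_right_zero)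
  finally have "fock_norm lam d \<le> sqrt (e\<^sup>2 * (LINT z|mu lam. ?G z))"
    unfolding fock_norm_def by (rule real_sqrt_le_mono)
  then show ?thesis
    using e by (simp add: real_sqrt_mult)
qed

context quadratic
begin

lemma fock_sums_flow: "fock_sums lam (\<lambda>k z. 1 / fact k * coef k w z) (flow w 1)"
  unfolding fock_sums_def
proof (intro conjI allI)
  show "(\<lambda>z. 1 / fact k * coef k w z) \<in> fock lam" for k
    by (intro exp_type_fock exp_type_mult exp_type_const exp_type_coef lam)
  show "flow w 1 \<in> fock lam"
    by (intro exp_type_fock exp_type_flow lam)
  obtain C M where M: "0 \<le> M" and
    bound: "\<And>N z. cmod ((\<Sum>k<N. coef k w z / fact k) - flow w 1 z) \<le> (1 / 2) ^ N * exp (C + M * norm z)"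
    by (rule flow_taylor_remainder) blast
  let ?d = "\<lambda>N z. (\<Sum>k<N. 1 / fact k * coef k w z) - flow w 1 z"
  let ?K = "sqrt (LINT z::complex^'n|mu lam. exp (2 * C) * exp (2 * M * norm z - lam / 2 * (norm z)\<^sup>2))"
  have le: "fock_norm lam (?d N) \<le> (1 / 2) ^ N * ?K" for N
  proof (rule fock_norm_le[OF lam])
    have "exp_type (\<lambda>z. (\<Sum>k<N. 1 / fact k * coef k w z) + (- 1) * flow w 1 z)"
      by (intro exp_type_add exp_type_sum exp_type_mult exp_type_const exp_type_coef exp_type_flow)
    then show "entire_fun (?d N)"
      by (simp add: exp_type_entire)
    show "cmod (?d N z) \<le> (1 / 2) ^ N * exp (C + M * norm z)" for z
      using bound[where N = N and z = z] by simp
  qed simp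
  \<comment> \<open>The real square root is negative on negative arguments, so the lower bound for
    the sandwich needs the inner product of \<open>d\<close> with itself to be nonnegative.\<close>
  have ge: "0 \<le> fock_norm lam (?d N)" for N
  proof -
    have "fock_inner lam d d = (LINT z|mu lam. of_real ((cmod (d z))\<^sup>2 * exp (- lam * (norm z)\<^sup>2 / 2)))" for d :: "complex^'n \<Rightarrow> complex"
      unfolding fock_inner_def by (simp only: of_real_mult complex_norm_square)
    then have "0 \<le> Re (fock_inner lam d d)" for d :: "complex^'n \<Rightarrow> complex"
      by (simp only: integral_complex_of_real Re_complex_of_real) (auto intro: integral_nonneg_AE)
    then show ?thesis
      by (simp add: fock_norm_def)
  qed
  have "(\<lambda>N. (1 / 2 :: real) ^ N * ?K) \<longlonglongrightarrow> 0"
    by (intro tendsto_mult_left_zero LIMSEQ_power_zero) simp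
  then show "(\<lambda>N. fock_norm lam (?d N)) \<longlonglongrightarrow> 0"
    by (rule tendsto_sandwich[OF _ _ tendsto_const, rotated -1]) (use le ge in auto)
qed

end

section \<open>The Weyl symbol of the flow\<close>

text \<open>With \<open>e = exp (2\<i>\<theta>)\<close> the number \<open>T\<close> is the tangent of \<open>\<theta>\<close>.\<close>

lemma gaussian_exponent:
  fixes e s B t z z' \<alpha> \<alpha>' :: complex
  assumes s: "s \<noteq> 0" and B: "B \<noteq> 0" and e: "1 + e \<noteq> 0" and T: "T = - \<i> * ((e - 1) / (1 + e))"
    and om: "om = \<i> * B / s" and g: "g = (e - 1) / om"
  shows "s * (e - 1) * (z * z') + g * (\<alpha>' * z - \<alpha> * z') - 1 / s * \<alpha> * \<alpha>' / om * (g - t) +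
      (s * (e - 1) * z' + \<alpha>' * g) * (- s * (e - 1) * z + \<alpha> * g) / (s * (1 + e)) =
    \<i> * (2 * s) * (\<alpha> * \<alpha>') * (- (t / (2 * s * B)) + T / B\<^sup>2) + \<i> * (2 * s) * (z * z') * T
      + 2 * s * T / B * (z * \<alpha>' - \<alpha> * z')"
proof -
  define \<tau> \<sigma> \<beta> \<omega> where "\<tau> = (e - 1) / (1 + e)" and "\<sigma> = 1 / s" and "\<beta> = 1 / B" and "\<omega> = - \<i> * s * \<beta>"
  have \<sigma>: "\<sigma> * s = 1" using s by (simp add: \<sigma>_def)
  have om': "1 / om = \<omega>" using s B by (simp add: om \<omega>_def \<beta>_def field_simps)
  have e1: "e - 1 = \<tau> * (1 + e)" using e by (simp add: \<tau>_def)
  \<comment> \<open>The exponent contains a bracket with factor \<open>e - 1\<close>; the Gaussian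
    integral contributes the same bracket with factor \<open>- \<tau> * (e - 1)\<close>. This
    identity adds them up to \<open>2 * \<tau>\<close>.\<close>
  have two: "(e - 1) * (1 - \<tau>) = 2 * \<tau>"
    using e by (simp add: \<tau>_def field_simps)
  have g': "g = (e - 1) * \<omega>"
    by (simp add: g om'[symmetric])
  have "(s * (e - 1) * z' + \<alpha>' * g) * (- s * (e - 1) * z + \<alpha> * g) =
      (1 + e) * (\<tau> * (e - 1) * ((s * z' + \<alpha>' * \<omega>) * (- s * z + \<alpha> * \<omega>)))"
    using e1 unfolding g' by algebra
  then have "(s * (e - 1) * z' + \<alpha>' * g) * (- s * (e - 1) * z + \<alpha> * g) / (s * (1 + e)) =
      \<tau> * (e - 1) * (\<sigma> * ((s * z' + \<alpha>' * \<omega>) * (- s * z + \<alpha> * \<omega>)))"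
    using e s by (simp add: \<sigma>_def)
  also have "\<sigma> * ((s * z' + \<alpha>' * \<omega>) * (- s * z + \<alpha> * \<omega>)) =
      - s * (z * z') - \<omega> * (\<alpha>' * z - \<alpha> * z') + \<sigma> * \<omega>\<^sup>2 * (\<alpha> * \<alpha>')"
    using \<sigma> by algebra
  finally have 1: "(s * (e - 1) * z' + \<alpha>' * g) * (- s * (e - 1) * z + \<alpha> * g) / (s * (1 + e)) =
      \<tau> * (e - 1) * (- s * (z * z') - \<omega> * (\<alpha>' * z - \<alpha> * z') + \<sigma> * \<omega>\<^sup>2 * (\<alpha> * \<alpha>'))" .
  have 2: "1 / s * \<alpha> * \<alpha>' / om * (g - t) = \<sigma> * \<omega> * (\<alpha> * \<alpha>') * (g - t)"
    by (simp add: om'[symmetric] \<sigma>_def)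
  have "s * (e - 1) * (z * z') + g * (\<alpha>' * z - \<alpha> * z') - 1 / s * \<alpha> * \<alpha>' / om * (g - t) +
      (s * (e - 1) * z' + \<alpha>' * g) * (- s * (e - 1) * z + \<alpha> * g) / (s * (1 + e)) =
      (e - 1) * (1 - \<tau>) * (s * (z * z') + \<omega> * (\<alpha>' * z - \<alpha> * z') - \<sigma> * \<omega>\<^sup>2 * (\<alpha> * \<alpha>'))
        + \<sigma> * \<omega> * (\<alpha> * \<alpha>') * t"
    unfolding 1 2 unfolding g' by (simp add: algebra_simps power2_eq_square)
  also have "\<dots> = 2 * \<tau> * (s * (z * z') + \<omega> * (\<alpha>' * z - \<alpha> * z') - \<sigma> * \<omega>\<^sup>2 * (\<alpha> * \<alpha>'))
        + \<sigma> * \<omega> * (\<alpha> * \<alpha>') * t"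
    unfolding two ..
  also have "\<tau> = \<i> * T"
    unfolding T \<tau>_def[symmetric] by simp
  also have "\<sigma> * \<omega> = - \<i> * \<beta>"
    using \<sigma> by (simp add: \<omega>_def)
  also have "\<sigma> * \<omega>\<^sup>2 = - s * \<beta>\<^sup>2"
  proof -
    have "\<omega>\<^sup>2 = - (s\<^sup>2 * \<beta>\<^sup>2)" by (simp add: \<omega>_def power_mult_distrib)
    then show ?thesis using \<sigma> by algebra
  qed
  also have "2 * (\<i> * T) * (s * (z * z') + \<omega> * (\<alpha>' * z - \<alpha> * z') - - s * \<beta>\<^sup>2 * (\<alpha> * \<alpha>')) + - \<i> * \<beta> * (\<alpha> * \<alpha>') * t =
    \<i> * (2 * s) * (\<alpha> * \<alpha>') * (- (t / (2 * s * B)) + T / B\<^sup>2) + \<i> * (2 * s) * (z * z') * T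
      + 2 * s * T / B * (z * \<alpha>' - \<alpha> * z')"
  proof -
    have "t / (2 * s * B) = t * \<sigma> * \<beta> / 2" "T / B\<^sup>2 = T * \<beta>\<^sup>2" "2 * s * T / B = 2 * s * T * \<beta>"
      by (simp_all add: \<sigma>_def \<beta>_def power_one_over)
    moreover have "\<i> * (2 * s) * (\<alpha> * \<alpha>') * (- (t * \<sigma> * \<beta> / 2)) = - \<i> * \<beta> * (\<alpha> * \<alpha>') * t"
      using s by (simp add: \<sigma>_def)
    ultimately show ?thesis
      by (simp only: distrib_left) (simp add: \<omega>_def algebra_simps)
  qed
  finally show ?thesis .
qed

context quadratic
begin

definition th :: "'n \<Rightarrow> complex \<Rightarrow> complex" where
  "th k t = t * of_real (b $ k / lam)"

definition sy :: "'n \<Rightarrow> complex \<Rightarrow> complex^'n \<Rightarrow> complex" where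
  "sy k t z = \<i> * of_real lam * (a $ k * cnj (a $ k)) *
      (- (t / (of_real lam * of_real (b $ k))) + sin (th k t) / cos (th k t) / (of_real (b $ k))\<^sup>2)
    + \<i> * of_real lam * (z $ k * cnj (z $ k)) * (sin (th k t) / cos (th k t))
    + of_real lam * (sin (th k t) / cos (th k t)) / of_real (b $ k) * (z $ k * cnj (a $ k) - a $ k * cnj (z $ k))"

text \<open>For real nonzero \<open>t\<close> this is the claimed closed form with
  \<open>c0\<close>, \<open>a\<close> and \<open>b\<close> multiplied by \<open>t\<close>, after
  cancelling powers of \<open>t\<close>; in this shape it extends to complex times.\<close>

definition Esym :: "complex \<Rightarrow> complex^'n \<Rightarrow> complex" where
  "Esym t z = exp (\<i> * of_real c0 * t) * (\<Prod>k\<in>UNIV. inverse (cos (th k t))) * exp (\<Sum>k\<in>UNIV. sy k t z)"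

text \<open>The integrand of the symbol of the flow is the exponential of
  \<open>\<i> c0 t + (\<Sum>k. om k t / 2 + Kk - pk |w\<^sub>k|\<^sup>2 + qk w\<^sub>k + rk cnj w\<^sub>k)\<close>.\<close>

definition gk :: "complex \<Rightarrow> 'n \<Rightarrow> complex" where "gk t k = (exp (om k * t) - 1) / om k"

definition pk :: "complex \<Rightarrow> 'n \<Rightarrow> complex" where "pk t k = of_real (lam / 2) * (1 + exp (om k * t))"

definition qk :: "complex \<Rightarrow> complex^'n \<Rightarrow> 'n \<Rightarrow> complex" where
  "qk t z k = of_real (lam / 2) * (exp (om k * t) - 1) * cnj (z $ k) + cnj (a $ k) * gk t k"

definition rk :: "complex \<Rightarrow> complex^'n \<Rightarrow> 'n \<Rightarrow> complex" where
  "rk t z k = - of_real (lam / 2) * (exp (om k * t) - 1) * (z $ k) + a $ k * gk t k"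

definition Kk :: "complex \<Rightarrow> complex^'n \<Rightarrow> 'n \<Rightarrow> complex" where
  "Kk t z k = of_real (lam / 2) * (exp (om k * t) - 1) * (z $ k * cnj (z $ k))
     + gk t k * (cnj (a $ k) * z $ k - a $ k * cnj (z $ k))
     - 1 / of_real (lam / 2) * a $ k * cnj (a $ k) / om k * (gk t k - t)"

lemma flow_integrand:
  "flow (z - w) t (z + w) *
     weyl_weight lam z w
   = exp (\<i> * of_real c0 * t + (\<Sum>k\<in>UNIV. om k / 2 * t + Kk t z k)) *
     exp (\<Sum>k\<in>UNIV. - pk t k * (w $ k * cnj (w $ k)) + qk t z k * w $ k + rk t z k * cnj (w $ k))"
proof -
  let ?s = "complex_of_real (lam / 2)"
  let ?A = "\<lambda>k. om k / 2 * t - a $ k * cnj ((z - w) $ k) * gk t k - 1 / ?s * a $ k * cnj (a $ k) / om k * (gk t k - t)"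
  let ?B = "\<lambda>k. (?s * exp (om k * t) * cnj ((z - w) $ k) + cnj (a $ k) * gk t k) * (z + w) $ k"
  let ?C = "\<lambda>k. - z $ k * cnj (z $ k) - w $ k * cnj (w $ k) + z $ k * cnj (w $ k) - cnj (z $ k) * w $ k"
  let ?D = "\<lambda>k. - pk t k * (w $ k * cnj (w $ k)) + qk t z k * w $ k + rk t z k * cnj (w $ k)"
  have s: "?s \<noteq> 0" using lam by simp
  have lam2: "complex_of_real lam / 2 = ?s" "2 / complex_of_real lam = 1 / ?s" by simp_all
  have "1 / s * x * ((s * c + y) * g - y * t) = x * c * g + 1 / s * x * y * (g - t)"
    if "s \<noteq> 0" for s x c y g :: complex
    using that by (simp add: field_simps)
  from this[OF s] have alp: "alp t (z - w) = \<i> * of_real c0 * t + (\<Sum>k\<in>UNIV. ?A k)"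
    unfolding alp_def gk_def[symmetric] lam2 by (simp only: diff_diff_eq times_divide_eq_right)
  have bet: "bet t (z - w) $ k = ?s * exp (om k * t) * cnj ((z - w) $ k) + cnj (a $ k) * gk t k" for k
    using om_nonzero[of k] by (simp add: bet_def gk_def field_simps)
  have "?A k + ?B k + ?s * ?C k = (om k / 2 * t + Kk t z k) + ?D k" for k
  proof -
    \<comment> \<open>Conjugates are treated as independent variables \<open>z'\<close> and
      \<open>w'\<close>, which reduces the comparison of exponents to a polynomial identity in each
      coordinate.\<close>
    have "m - x * (z' - w') * g - c * (g - t) + (s * e * (z' - w') + y * g) * (z + w) +
        s * (- z * z' - w * w' + z * w' - z' * w) =
      (m + (s * (e - 1) * (z * z') + g * (y * z - x * z') - c * (g - t))) +
        (- (s * (1 + e)) * (w * w') + (s * (e - 1) * z' + y * g) * w + (- s * (e - 1) * z + x * g) * w')"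
      for m x y z z' w w' g c s e :: complex
      by (simp add: algebra_simps)
    then show ?thesis
      unfolding Kk_def pk_def qk_def rk_def vector_minus_component vector_add_component complex_cnj_diff .
  qed
  then have "(\<Sum>k\<in>UNIV. ?A k) + (\<Sum>k\<in>UNIV. ?B k) + ?s * (\<Sum>k\<in>UNIV. ?C k) =
      (\<Sum>k\<in>UNIV. om k / 2 * t + Kk t z k) + (\<Sum>k\<in>UNIV. ?D k)"
    by (simp only: sum_distrib_left sum.distrib[symmetric])
  then have "\<i> * of_real c0 * t + (\<Sum>k\<in>UNIV. ?A k) + (\<Sum>k\<in>UNIV. ?B k) + ?s * (\<Sum>k\<in>UNIV. ?C k) =
      \<i> * of_real c0 * t + (\<Sum>k\<in>UNIV. om k / 2 * t + Kk t z k) + (\<Sum>k\<in>UNIV. ?D k)"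
    by (simp only: add.assoc)
  then show ?thesis
    unfolding flow_def mult_exp_exp alp bil_def bet lam2 by (rule arg_cong)
qed

lemma exp_om_th: "exp (om k * t) = exp (\<i> * th k t) * exp (\<i> * th k t)" "exp (om k / 2 * t) = exp (\<i> * th k t)"
  by (simp_all add: mult_exp_exp om_def th_def field_simps)

lemma one_plus_exp_om: "1 + exp (om k * t) = 2 * exp (\<i> * th k t) * cos (th k t)"
proof -
  have "2 * u * ((u + v) / 2) = u * u + u * v" for u v :: complex
    by (simp add: distrib_left)
  then show ?thesis
    unfolding exp_om_th cos_exp_eq by (simp only: exp_minus_inverse) (simp only: add.commute)
qed

lemma sin_th: "exp (om k * t) - 1 = 2 * \<i> * exp (\<i> * th k t) * sin (th k t)"
proof -
  have "2 * \<i> * u * ((u - v) / (2 * \<i>)) = u * u - u * v" for u v :: complex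
    by (simp add: field_simps)
  then show ?thesis
    unfolding exp_om_th sin_exp_eq by (simp only: exp_minus_inverse)
qed

lemma cos_th_nonzero: "Re (exp (om k * t)) > - 1 \<Longrightarrow> cos (th k t) \<noteq> 0"
  using one_plus_exp_om[of k t] by (auto simp: add_eq_0_iff complex_eq_iff)

text \<open>With \<open>\<theta> = th k t\<close> the Gaussian coefficient \<open>pk t k\<close>
  equals \<open>lam * exp (i \<theta>) * cos \<theta>\<close>. The normalisations leave
  \<open>exp (- i \<theta>) / cos \<theta>\<close>, and the symmetrisation term
  \<open>exp (om k / 2 * t) = exp (i \<theta>)\<close> cancels the phase.\<close>

lemma symbol_factor:
  assumes "cos (th k t) \<noteq> 0"
  shows "2 * of_real (lam / (2 * pi)) * (pi / pk t k * exp (qk t z k * rk t z k / pk t k)) * exp (om k / 2 * t + Kk t z k)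
    = inverse (cos (th k t)) * exp (sy k t z)"
proof -
  let ?e = "exp (om k * t)"
  have e: "1 + ?e \<noteq> 0" using assms by (simp add: one_plus_exp_om)
  have T: "sin (th k t) / cos (th k t) = - \<i> * ((?e - 1) / (1 + ?e))"
    unfolding one_plus_exp_om sin_th using assms by (simp add: field_simps)
  have s2: "2 * complex_of_real (lam / 2) = of_real lam" by simp
  have "Kk t z k + qk t z k * rk t z k / pk t k = sy k t z"
    unfolding Kk_def qk_def rk_def pk_def sy_def s2[symmetric]
    by (rule gaussian_exponent[OF _ _ e T]) (use lam b[of k] in \<open>simp_all add: om_def gk_def field_simps\<close>)
  moreover have "2 * of_real (lam / (2 * pi)) * (pi / pk t k) * exp (om k / 2 * t) = inverse (cos (th k t))"
    unfolding pk_def one_plus_exp_om exp_om_th(2) using lam assms by (simp add: field_simps)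
  moreover have "2 * x * (y * exp v) * exp (m + c) = (2 * x * y * exp m) * exp (c + v)" for x y v m c :: complex
    by (simp add: exp_add)
  ultimately show ?thesis
    by (simp only:)
qed

text \<open>The assumption says that every \<open>pk t k\<close> has positive real part, so that the
  Gaussian formula applies; it also excludes the zeros of the cosines.\<close>

lemma flow_gaussian:
  fixes z :: "complex^'n"
  assumes "\<And>k. Re (exp (om k * t)) > - 1"
  defines "h \<equiv> \<lambda>w. flow (z - w) t (z + w) *
     weyl_weight lam z w"
  shows "integrable lborel h" "2 ^ CARD('n) * (of_real ((lam / (2 * pi)) ^ CARD('n)) * integral\<^sup>L lborel h) = Esym t z"
proof -
  have p: "Re (pk t k) > 0" for k
    using assms(1)[of k] lam by (simp add: pk_def)
  have h: "h = (\<lambda>w. exp (\<i> * of_real c0 * t + (\<Sum>k\<in>UNIV. om k / 2 * t + Kk t z k)) *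
     exp (\<Sum>k\<in>UNIV. - pk t k * (w $ k * cnj (w $ k)) + qk t z k * w $ k + rk t z k * cnj (w $ k)))"
    unfolding h_def flow_integrand ..
  show "integrable lborel h"
    unfolding h by (intro integrable_mult_right vec_gaussian_linear(1) p)
  have "integral\<^sup>L lborel h = exp (\<i> * of_real c0 * t + (\<Sum>k\<in>UNIV. om k / 2 * t + Kk t z k)) *
      (\<Prod>k\<in>UNIV. pi / pk t k * exp (qk t z k * rk t z k / pk t k))"
    unfolding h integral_mult_right_zero using vec_gaussian_linear(2)[of "pk t" "qk t z" "rk t z", OF p] by simp
  then have "2 ^ CARD('n) * (of_real ((lam / (2 * pi)) ^ CARD('n)) * integral\<^sup>L lborel h) =
     exp (\<i> * of_real c0 * t) * (\<Prod>k\<in>UNIV. 2 * of_real (lam / (2 * pi)) *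
       (pi / pk t k * exp (qk t z k * rk t z k / pk t k)) * exp (om k / 2 * t + Kk t z k))"
    by (simp only: exp_add exp_sum[OF finite] prod.distrib prod_constant of_real_power mult_ac)
  also have "(\<Prod>k\<in>UNIV. 2 * of_real (lam / (2 * pi)) *
       (pi / pk t k * exp (qk t z k * rk t z k / pk t k)) * exp (om k / 2 * t + Kk t z k)) =
      (\<Prod>k\<in>UNIV. inverse (cos (th k t)) * exp (sy k t z))"
    by (intro prod.cong refl symbol_factor cos_th_nonzero assms(1))
  also have "exp (\<i> * of_real c0 * t) * \<dots> = Esym t z"
    by (simp only: Esym_def prod.distrib exp_sum[OF finite] mult_ac)
  finally show "2 ^ CARD('n) * (of_real ((lam / (2 * pi)) ^ CARD('n)) * integral\<^sup>L lborel h) = Esym t z" .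
qed

text \<open>Only the values on the coherent states matter; a coherent state determines its parameter, so that
  \<open>SOME\<close> is harmless there.\<close>

definition Bop :: "complex \<Rightarrow> 'n operator" where
  "Bop t f = flow (SOME w. f = coh lam w) t"

lemma coh_inject: "coh lam w = coh lam w' \<Longrightarrow> w = w'"
proof -
  assume eq: "coh lam w = coh lam w'"
  have "w $ k = w' $ k" for k
  proof -
    have "foldr cpartial [k] (coh lam w) 0 = foldr cpartial [k] (coh lam w') 0"
      by (simp only: eq)
    then show ?thesis
      using lam unfolding foldr_cpartial_coh by (simp add: coh_eq bil_def)
  qed
  then show ?thesis by (simp add: vec_eq_iff)
qed

lemma Bop_coh: "Bop t (coh lam w) = flow w t"
  unfolding Bop_def by (rule arg_cong[where f = "\<lambda>w. flow w t"], rule some_equality) (auto dest: coh_inject)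

lemma W0_Bop:
  assumes "\<And>k. Re (exp (om k * t)) > - 1"
  shows "integrable (mu lam) (W0_integrand lam (Bop t) z)" "W0 lam (Bop t) z = Esym t z"
proof -
  have eq: "W0_integrand lam (Bop t) z = (\<lambda>w. flow (z - w) t (z + w) *
     weyl_weight lam z w)"
    by (rule ext, subst W0_integrand_eq[OF _ lam]) (simp_all only: Bop_coh exp_type_flow)
  have m: "W0_integrand lam (Bop t) z \<in> borel_measurable borel"
    unfolding eq by (intro borel_measurable_continuous_onI continuous_intros)
  have "integrable lborel (W0_integrand lam (Bop t) z)"
    unfolding eq by (rule flow_gaussian(1)[OF assms])
  then show "integrable (mu lam) (W0_integrand lam (Bop t) z)"
    by (simp only: integrable_mu[OF lam m])
  have "2 ^ CARD('n) * (of_real ((lam / (2 * pi)) ^ CARD('n)) * integral\<^sup>L lborel (W0_integrand lam (Bop t) z)) = Esym t z"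
    unfolding eq by (rule flow_gaussian(2)[OF assms])
  then show "W0 lam (Bop t) z = Esym t z"
    by (simp only: W0_def integral_mu[OF lam m])
qed

section \<open>Symbols of the powers of the generator\<close>

lemma Esym_holomorphic:
  assumes "\<And>k t. t \<in> S \<Longrightarrow> cos (th k t) \<noteq> 0"
  shows "(\<lambda>t. Esym t z) holomorphic_on S"
  unfolding Esym_def sy_def th_def using assms lam b
  by (intro holomorphic_intros) (auto simp: th_def)

text \<open>A nonnegative real part, rather than one above \<open>-1\<close>, keeps
  \<open>Re (pk t k) >= lam / 2\<close> on the whole disc, so that a single Gaussian dominates the
  integrand for all times on the circle. The radius ensures that \<open>om k * t\<close> has modulus
  at most 1, hence an imaginary part on which the cosine is nonnegative.\<close>

lemma small_time:
  obtains r where "r > 0" "\<And>k t. cmod t \<le> r \<Longrightarrow> 0 \<le> Re (exp (om k * t))"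
proof
  let ?r = "1 / (1 + (\<Sum>k\<in>UNIV. cmod (om k)))"
  have S: "0 \<le> (\<Sum>k\<in>UNIV. cmod (om k))" by (simp add: sum_nonneg)
  then show "?r > 0" by simp
  fix k t assume t: "cmod t \<le> ?r"
  have "cmod (om k * t) \<le> cmod (om k) * ?r"
    using t by (simp add: norm_mult mult_left_mono del: times_divide_eq_right)
  also have "\<dots> \<le> 1"
    using member_le_sum[of k UNIV "\<lambda>k. cmod (om k)"] S by (simp add: divide_simps)
  finally have "\<bar>Im (om k * t)\<bar> \<le> 1"
    using abs_Im_le_cmod order_trans by blast
  then have "0 \<le> cos (Im (om k * t))"
    using pi_gt3 by (intro cos_ge_zero) auto
  then show "0 \<le> Re (exp (om k * t))"
    by (simp add: Re_exp)
qed

text \<open>The integrand contains \<open>coef m\<close>, a circle integral of the flow over small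
  times. Exchanging it with the symbol integral gives the circle integral of \<open>Esym\<close>,
  which Cauchy's formula turns back into a derivative at 0.\<close>

lemma W0_gen_power:
  "W0 lam (restrict (gen ^^ m) (Collect entire_fun)) z = (deriv ^^ m) (\<lambda>t. Esym t z) 0"
proof -
  obtain r where r: "r > 0" "\<And>k t. cmod t \<le> r \<Longrightarrow> 0 \<le> Re (exp (om k * t))"
    by (rule small_time) blast
  let ?A = "restrict (gen ^^ m) (Collect entire_fun)"
  let ?X = "\<lambda>w. weyl_weight lam z w"
  define F where "F x w = flow (z - w) (of_real r * circ x) (z + w) * ?X w / circ x ^ m" for x w
  have A: "?A (coh lam w) = coef m w" for w
    by (simp add: entire_fun_coh gen_power_coh)
  have integrand: "W0_integrand lam ?A z w = fact m / of_real r ^ m * integral {0..1} (\<lambda>x. F x w)" for w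
  proof -
    have "((\<lambda>x. flow (z - w) (of_real r * circ x) (z + w) / circ x ^ m * ?X w) has_integral
        of_real r ^ m * coef m (z - w) (z + w) / fact m * ?X w) {0..1}"
      by (intro has_integral_mult_left coef_circle r)
    then have "integral {0..1} (\<lambda>x. F x w) = of_real r ^ m * coef m (z - w) (z + w) / fact m * ?X w"
      unfolding F_def by (intro integral_unique) simp
    moreover have "W0_integrand lam ?A z w = coef m (z - w) (z + w) * ?X w"
      by (subst W0_integrand_eq[OF _ lam]) (simp_all only: A exp_type_coef)
    ultimately show ?thesis
      using r(1) by simp
  qed
  have meas: "W0_integrand lam ?A z \<in> borel_measurable borel"
  proof -
    obtain S c where "\<And>f. entire_fun f \<Longrightarrow> (gen ^^ m) f = diff_op S c f"
      using is_pdo_gen_power[of m] unfolding is_pdo_def by blast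
    then have "?A = restrict (diff_op S c) (Collect entire_fun)"
      by (intro restrict_ext) simp
    then show ?thesis
      using W0_integrand_diff_op_integrable(2)[OF lam] by simp
  qed
  \<comment> \<open>The bound must be uniform over the time circle: the prefactor and the linear
    coefficients of the Gaussian are continuous in \<open>t\<close>, hence bounded on the compact
    disc.\<close>
  have "\<exists>C. \<forall>t\<in>cball 0 r. cmod (exp (\<i> * of_real c0 * t + (\<Sum>k\<in>UNIV. om k / 2 * t + Kk t z k))) \<le> C"
    unfolding Kk_def gk_def using om_nonzero lam by (intro bounded_on_cball continuous_intros) auto
  then obtain C where C: "\<And>t. cmod t \<le> r \<Longrightarrow>
      cmod (exp (\<i> * of_real c0 * t + (\<Sum>k\<in>UNIV. om k / 2 * t + Kk t z k))) \<le> C"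
    unfolding mem_cball_0[symmetric] by blast
  have "\<exists>D. \<forall>t\<in>cball 0 r. cmod (of_real (\<Sum>k\<in>UNIV. cmod (qk t z k) + cmod (rk t z k))) \<le> D"
    unfolding qk_def rk_def gk_def using om_nonzero by (intro bounded_on_cball continuous_intros) auto
  then obtain D where "\<And>t. cmod t \<le> r \<Longrightarrow> \<bar>\<Sum>k\<in>UNIV. cmod (qk t z k) + cmod (rk t z k)\<bar> \<le> D"
    unfolding norm_of_real mem_cball_0[symmetric] by blast
  then have D: "\<And>t. cmod t \<le> r \<Longrightarrow> (\<Sum>k\<in>UNIV. cmod (qk t z k) + cmod (rk t z k)) \<le> D"
    using abs_le_D1 by blast
  let ?G = "\<lambda>w::complex^'n. C * exp (D * norm w - lam / 2 * (norm w)\<^sup>2)"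
  have bound: "cmod (F x w) \<le> ?G w" for x w
  proof -
    let ?t = "of_real r * circ x"
    have t: "cmod ?t \<le> r" using r(1) by (simp add: norm_mult)
    have "cmod (F x w) = cmod (exp (\<i> * of_real c0 * ?t + (\<Sum>k\<in>UNIV. om k / 2 * ?t + Kk ?t z k))) *
        cmod (exp (\<Sum>k\<in>UNIV. - pk ?t k * (w $ k * cnj (w $ k)) + qk ?t z k * w $ k + rk ?t z k * cnj (w $ k)))"
      unfolding F_def flow_integrand by (simp only: norm_divide norm_mult norm_power norm_cis power_one div_by_1)
    also have "\<dots> \<le> C * exp (D * norm w - lam / 2 * (norm w)\<^sup>2)"
    proof (rule mult_mono[OF C[OF t]])
      have "lam / 2 \<le> Re (pk ?t k)" for k
        using r(2)[OF t, of k] lam by (simp add: pk_def distrib_left)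
      from gaussian_linear_bound[where p = "pk ?t" and q = "qk ?t z" and r = "rk ?t z" and w = w, OF this]
      have "cmod (exp (\<Sum>k\<in>UNIV. - pk ?t k * (w $ k * cnj (w $ k)) + qk ?t z k * w $ k + rk ?t z k * cnj (w $ k)))
          \<le> exp ((\<Sum>k\<in>UNIV. cmod (qk ?t z k) + cmod (rk ?t z k)) * norm w - lam / 2 * (norm w)\<^sup>2)" .
      also have "\<dots> \<le> exp (D * norm w - lam / 2 * (norm w)\<^sup>2)"
        using mult_right_mono[OF D[OF t], of "norm w"] by simp
      finally show "cmod (exp (\<Sum>k\<in>UNIV. - pk ?t k * (w $ k * cnj (w $ k)) + qk ?t z k * w $ k + rk ?t z k * cnj (w $ k)))
          \<le> exp (D * norm w - lam / 2 * (norm w)\<^sup>2)" .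
      show "0 \<le> C" using order_trans[OF norm_ge_zero C[OF t]] .
    qed simp
    finally show ?thesis .
  qed
  have swap: "(LINT w|lborel. integral {0..1} (\<lambda>x. F x w)) = (LINT x:{0..1}|lborel. LINT w|lborel. F x w)"
  proof (rule circle_integral_swap[OF _ bound])
    show "continuous_on UNIV (\<lambda>(x, w). F x w)"
      unfolding F_def split_beta by (intro continuous_intros) auto
    show "integrable lborel ?G"
      using lam by (intro gaussian_exp_integrable) simp
  qed
  let ?K = "2 ^ CARD('n) * complex_of_real ((lam / (2 * pi)) ^ CARD('n))"
  have inner: "?K * (LINT w|lborel. F x w) = Esym (of_real r * circ x) z / circ x ^ m" for x
  proof -
    have "Re (exp (om k * (of_real r * circ x))) > - 1" for k
      using r(2)[of "of_real r * circ x" k] r(1) by (simp add: norm_mult)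
    from flow_gaussian(2)[OF this, of z] show ?thesis
      unfolding F_def by (simp add: mult.assoc)
  qed
  have hol: "(\<lambda>t. Esym t z) holomorphic_on cball 0 r"
  proof (rule Esym_holomorphic)
    show "cos (th k t) \<noteq> 0" if "t \<in> cball 0 r" for k t
      using r(2)[of t k] that by (intro cos_th_nonzero) simp
  qed
  have cont: "continuous_on {0..1} (\<lambda>x. Esym (of_real r * circ x) z / circ x ^ m)"
    using r(1) by (intro continuous_intros continuous_on_compose2[OF holomorphic_on_imp_continuous_on[OF hol]])
      (auto simp: norm_mult)
  have "W0 lam ?A z = ?K * (LINT w|lborel. fact m / of_real r ^ m * integral {0..1} (\<lambda>x. F x w))"
    unfolding W0_def integral_mu[OF lam meas] by (simp only: integrand[abs_def] mult.assoc)
  also have "\<dots> = fact m / of_real r ^ m * (?K * (LINT x:{0..1}|lborel. LINT w|lborel. F x w))"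
    by (simp only: integral_mult_right_zero swap mult_ac)
  also have "?K * (LINT x:{0..1}|lborel. LINT w|lborel. F x w) = (LINT x:{0..1}|lborel. ?K * (LINT w|lborel. F x w))"
    by (simp only: set_integral_mult_right)
  also have "\<dots> = integral {0..1} (\<lambda>x. Esym (of_real r * circ x) z / circ x ^ m)"
    unfolding inner by (rule set_borel_integral_eq_integral(2)[OF borel_integrable_atLeastAtMost'[OF cont]])
  also have "\<dots> = of_real r ^ m * (deriv ^^ m) (\<lambda>t. Esym t z) 0 / fact m"
    by (rule integral_unique[OF Cauchy_coeff_circle[OF r(1) hol]])
  also have "fact m / of_real r ^ m * \<dots> = (deriv ^^ m) (\<lambda>t. Esym t z) 0"
    using r(1) by simp
  finally show ?thesis .
qed

end

section \<open>The star exponential\<close>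

context quadratic
begin

definition P :: "complex^'n \<Rightarrow> complex" where
  "P z = \<i> * of_real c0 + bil (cnjv a) z - bil a (cnjv z) + \<i> * of_real (\<Sum>k\<in>UNIV. b $ k * (cmod (z $ k))\<^sup>2)"

lemma Esym_0: "Esym 0 z = 1"
  by (simp add: Esym_def sy_def th_def)

lemma Esym_has_derivative_0: "((\<lambda>t. Esym t z) has_field_derivative P z) (at 0)"
proof -
  have tan': "((\<lambda>t. sin (th k t) / cos (th k t)) has_field_derivative of_real (b $ k / lam)) (at 0)" for k
    unfolding th_def using lam by (auto intro!: derivative_eq_intros)
  have cos': "((\<lambda>t. inverse (cos (th k t))) has_field_derivative 0) (at 0)" for k
    unfolding th_def using lam by (auto intro!: derivative_eq_intros)
  have prod': "((\<lambda>t. \<Prod>k\<in>UNIV. inverse (cos (th k t))) has_field_derivative 0) (at 0)"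
    using has_field_derivative_prod[of UNIV "\<lambda>k t. inverse (cos (th k t))" "\<lambda>_. 0", OF cos'] by simp
  have gen: "((\<lambda>t. \<i> * L * A * (- (t / (L * B)) + f t / B\<^sup>2) + \<i> * L * Z * f t + L * f t / B * D) has_field_derivative
      \<i> * L * A * (- (1 / (L * B)) + f' / B\<^sup>2) + \<i> * L * Z * f' + L * f' / B * D) (at 0)"
    if "(f has_field_derivative f') (at 0)" "L \<noteq> 0" "B \<noteq> 0" for f and f' L A B Z D :: complex
    using that by (auto intro!: derivative_eq_intros simp: field_simps)
  have "((\<lambda>t. sy k t z) has_field_derivative
      \<i> * of_real lam * (a $ k * cnj (a $ k)) * (- (1 / (of_real lam * of_real (b $ k))) + of_real (b $ k / lam) / (of_real (b $ k))\<^sup>2)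
      + \<i> * of_real lam * (z $ k * cnj (z $ k)) * of_real (b $ k / lam)
      + of_real lam * of_real (b $ k / lam) / of_real (b $ k) * (z $ k * cnj (a $ k) - a $ k * cnj (z $ k))) (at 0)" for k
    unfolding sy_def by (rule gen[OF tan']) (use lam b[of k] in simp_all)
  moreover have "\<i> * of_real lam * (a $ k * cnj (a $ k)) * (- (1 / (of_real lam * of_real (b $ k))) + of_real (b $ k / lam) / (of_real (b $ k))\<^sup>2)
      + \<i> * of_real lam * (z $ k * cnj (z $ k)) * of_real (b $ k / lam)
      + of_real lam * of_real (b $ k / lam) / of_real (b $ k) * (z $ k * cnj (a $ k) - a $ k * cnj (z $ k)) =
      \<i> * of_real (b $ k) * (z $ k * cnj (z $ k)) + (z $ k * cnj (a $ k) - a $ k * cnj (z $ k))" for k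
    using lam b[of k] by (simp add: power2_eq_square)
  ultimately have sy': "((\<lambda>t. sy k t z) has_field_derivative
      \<i> * of_real (b $ k) * (z $ k * cnj (z $ k)) + (z $ k * cnj (a $ k) - a $ k * cnj (z $ k))) (at 0)" for k
    by simp
  have "((\<lambda>t. Esym t z) has_field_derivative
      \<i> * of_real c0 + (\<Sum>k\<in>UNIV. \<i> * of_real (b $ k) * (z $ k * cnj (z $ k)) + (z $ k * cnj (a $ k) - a $ k * cnj (z $ k)))) (at 0)"
    unfolding Esym_def
    by (auto intro!: derivative_eq_intros prod' sy') (simp_all add: th_def sy_def)
  also have "\<i> * of_real c0 + (\<Sum>k\<in>UNIV. \<i> * of_real (b $ k) * (z $ k * cnj (z $ k)) + (z $ k * cnj (a $ k) - a $ k * cnj (z $ k))) = P z"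
    by (simp add: P_def bil_def cnjv_def sum.distrib sum_subtractf sum_distrib_left complex_norm_square mult_ac del: of_real_power)
  finally show ?thesis .
qed

text \<open>The case \<open>m = 1\<close> of \<open>W0_gen_power\<close>: the first derivative of
  the closed form at 0 is \<open>P\<close>.\<close>

lemma P_symbol: "P = W0 lam (restrict gen (Collect entire_fun))"
proof
  show "P z = W0 lam (restrict gen (Collect entire_fun)) z" for z
    using W0_gen_power[of 1 z] DERIV_imp_deriv[OF Esym_has_derivative_0[of z]] by simp
qed

lemma compose_gen_power:
  "compose (Collect entire_fun) (restrict gen (Collect entire_fun)) (restrict (gen ^^ m) (Collect entire_fun)) =
    restrict (gen ^^ Suc m) (Collect entire_fun)"
  unfolding compose_def
  by (rule restrict_ext) (simp add: entire_fun_pdo[OF is_pdo_gen_power])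

lemma W0_inv_gen_power:
  "W0_inv lam (W0 lam (restrict (gen ^^ m) (Collect entire_fun))) = restrict (gen ^^ m) (Collect entire_fun)"
  by (rule W0_inv_W0[OF lam is_pdo_gen_power])

text \<open>The empty power 1 is the symbol of the identity, \<open>Esym 0\<close>. For each further
  factor both arguments of the star product are symbols of powers of \<open>gen\<close>, so the
  inverse symbol map returns these powers and the product composes them.\<close>

lemma star_pow_P: "star_pow lam P m = W0 lam (restrict (gen ^^ m) (Collect entire_fun))"
proof (induction m)
  case 0
  show ?case
    by (rule ext) (simp only: W0_gen_power, simp add: Esym_0)
next
  case (Suc m)
  have "W0_inv lam P = restrict gen (Collect entire_fun)"
    using W0_inv_gen_power[of 1] by (simp add: P_symbol)
  then show ?case
    unfolding star_pow.simps Suc star_def by (simp only: W0_inv_gen_power compose_gen_power)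
qed

lemma has_star_exp_P:
  assumes "\<And>k. cos (b $ k / lam) \<noteq> 0"
  shows "has_star_exp lam P (Esym 1)"
  unfolding has_star_exp_def
proof (intro exI conjI allI)
  show "fock_sums lam (\<lambda>k z. 1 / fact k * W0_inv lam (star_pow lam P k) (coh lam w) z) (Bop 1 (coh lam w))" for w
    using fock_sums_flow[of w]
    by (simp add: star_pow_P W0_inv_gen_power entire_fun_coh gen_power_coh Bop_coh)
  \<comment> \<open>Convergence of the symbol integral at time 1: \<open>om k\<close> is
    \<open>i\<close> times the double of the angle \<open>b $ k / lam\<close>, so the double angle
    formula turns the cosine condition into the half-plane condition.\<close>
  have "Re (exp (om k * 1)) > - 1" for k
  proof -
    have "Re (exp (om k * 1)) = cos (2 * (b $ k / lam))"
      by (simp add: om_def Re_exp)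
    also have "\<dots> = 2 * (cos (b $ k / lam))\<^sup>2 - 1"
      by (rule cos_double_cos)
    finally show ?thesis
      using assms[of k] by simp
  qed
  then show "integrable (mu lam) (W0_integrand lam (Bop 1) z)" "W0 lam (Bop 1) = Esym 1" for z
    by (auto simp: fun_eq_iff W0_Bop)
qed

lemma has_pointwise_star_exp_P:
  assumes "\<And>k. \<bar>b $ k\<bar> < lam * pi / 2"
  shows "has_pointwise_star_exp lam P (Esym 1)"
  unfolding has_pointwise_star_exp_def
proof
  fix z
  \<comment> \<open>The zeros of \<open>cos (th k t)\<close> in \<open>t\<close> are the odd
    multiples of \<open>lam * pi / (2 * b $ k)\<close>; \<open>R\<close> is their least modulus over
    all \<open>k\<close>. The assumption gives \<open>R > 1\<close>, so time 1 lies in the disc of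
    convergence.\<close>
  define R where "R = Min (range (\<lambda>k. lam * pi / 2 / \<bar>b $ k\<bar>))"
  have R: "R \<le> lam * pi / 2 / \<bar>b $ k\<bar>" for k
    unfolding R_def by (rule Min_le) auto
  have R1: "1 < R"
  proof -
    have "1 < lam * pi / 2 / \<bar>b $ k\<bar>" for k
      using assms[of k] b[of k] by (simp add: divide_simps mult.commute)
    then show ?thesis
      by (simp add: R_def)
  qed
  have "cos (th k t) \<noteq> 0" if "t \<in> ball 0 R" for k t
  proof
    assume "cos (th k t) = 0"
    then obtain n :: int where n: "th k t = of_real (of_int n * pi) + of_real pi / 2"
      by (auto simp: cos_eq_0)
    have "cmod (th k t) = \<bar>of_int n * pi + pi / 2\<bar>"
    proof -
      have "th k t = of_real (of_int n * pi + pi / 2)"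
        unfolding n by simp
      then show ?thesis
        by (simp only: norm_of_real)
    qed
    also have "of_int n * pi + pi / 2 = (2 * of_int n + 1) * (pi / 2)"
      by (simp add: field_simps)
    also have "\<bar>\<dots>\<bar> = \<bar>2 * of_int n + 1\<bar> * (pi / 2)"
      by (simp only: abs_mult) simp
    also have "\<dots> \<ge> 1 * (pi / 2)"
    proof (rule mult_right_mono)
      have "1 \<le> \<bar>2 * n + 1\<bar>" by (cases "n \<ge> 0") auto
      then have "real_of_int 1 \<le> real_of_int \<bar>2 * n + 1\<bar>" by (simp only: of_int_le_iff)
      then show "1 \<le> \<bar>2 * real_of_int n + 1\<bar>" by simp
    qed simp
    finally have "pi / 2 \<le> cmod t * (\<bar>b $ k\<bar> / lam)"
      using lam by (simp add: th_def norm_mult norm_divide)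
    then have "lam * pi / 2 / \<bar>b $ k\<bar> \<le> cmod t"
      using lam b[of k] by (simp add: field_simps)
    with R[of k] that show False by simp
  qed
  then have "(\<lambda>t. Esym t z) holomorphic_on ball 0 R"
    by (rule Esym_holomorphic)
  from holomorphic_power_series[OF this, of 1] R1
  have "(\<lambda>k. (deriv ^^ k) (\<lambda>t. Esym t z) 0 / fact k) sums Esym 1 z"
    by simp
  then show "(\<lambda>k. 1 / fact k * star_pow lam P k z) sums Esym 1 z"
    by (simp add: star_pow_P W0_gen_power)
qed

text \<open>At time 1 the angles are real, so the complex sine and cosine become real ones and the
  exponent splits into three sums.\<close>

lemma Esym_1:
  "Esym 1 z = exp (\<i> * of_real c0)
     * inverse (of_real (\<Prod>k\<in>UNIV. cos (1 / lam * b $ k)))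
     * exp (\<i> * of_real (lam * (\<Sum>k\<in>UNIV. (cmod (a $ k))\<^sup>2 *
         (- (1 / (lam * b $ k)) + 1 / (b $ k)\<^sup>2 * tan (1 / lam * b $ k)))))
     * exp (\<i> * of_real (lam * (\<Sum>k\<in>UNIV. (cmod (z $ k))\<^sup>2 * tan (1 / lam * b $ k))))
     * exp (of_real lam * (\<Sum>k\<in>UNIV. of_real (1 / b $ k * tan (1 / lam * b $ k)) *
         (z $ k * cnj (a $ k) - a $ k * cnj (z $ k))))"
proof -
  have th: "th k 1 = of_real (1 / lam * b $ k)" for k
    by (simp add: th_def)
  have sy: "sy k 1 z = \<i> * of_real lam * of_real ((cmod (a $ k))\<^sup>2 * (- (1 / (lam * b $ k)) + 1 / (b $ k)\<^sup>2 * tan (1 / lam * b $ k)))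
     + \<i> * of_real lam * of_real ((cmod (z $ k))\<^sup>2 * tan (1 / lam * b $ k))
     + of_real lam * (of_real (1 / b $ k * tan (1 / lam * b $ k)) * (z $ k * cnj (a $ k) - a $ k * cnj (z $ k)))" for k
  proof -
    have "sin (th k 1) / cos (th k 1) = of_real (tan (1 / lam * b $ k))"
      unfolding th tan_def by (simp only: sin_of_real cos_of_real of_real_divide)
    then show ?thesis
      unfolding sy_def complex_norm_square[symmetric]
      by (simp only:) (simp add: algebra_simps)
  qed
  show ?thesis
    unfolding Esym_def th sy cos_of_real sum.distrib exp_add sum_distrib_left[symmetric] of_real_sum[symmetric]
    by (simp add: prod_inversef[symmetric] mult_ac o_def flip: of_real_prod of_real_inverse)
qed

end

theorem corollary9p3:
  fixes lam c0 :: real and a :: "complex^'n" and b :: "real^'n"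
  assumes "lam > 0"
    and "\<And>k. b $ k \<noteq> 0"
    and "\<And>k. cos (1 / lam * b $ k) \<noteq> 0"
  shows
    "let P = (\<lambda>z :: complex^'n. \<i> * of_real c0 + bil (cnjv a) z - bil a (cnjv z)
               + \<i> * of_real (\<Sum>k\<in>UNIV. b $ k * (cmod (z $ k))\<^sup>2));
         E = (\<lambda>z :: complex^'n. exp (\<i> * of_real c0)
               * inverse (of_real (\<Prod>k\<in>UNIV. cos (1 / lam * b $ k)))
               * exp (\<i> * of_real (lam * (\<Sum>k\<in>UNIV. (cmod (a $ k))\<^sup>2 *
                   (- (1 / (lam * b $ k)) + 1 / (b $ k)\<^sup>2 * tan (1 / lam * b $ k)))))
               * exp (\<i> * of_real (lam * (\<Sum>k\<in>UNIV. (cmod (z $ k))\<^sup>2 * tan (1 / lam * b $ k))))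
               * exp (of_real lam * (\<Sum>k\<in>UNIV. of_real (1 / b $ k * tan (1 / lam * b $ k)) *
                   (z $ k * cnj (a $ k) - a $ k * cnj (z $ k)))));
         P0 = (\<lambda>z :: complex^'n. \<i> * of_real (\<Sum>k\<in>UNIV. b $ k * (cmod (z $ k))\<^sup>2));
         E0 = (\<lambda>z :: complex^'n. inverse (of_real (\<Prod>k\<in>UNIV. cos (1 / lam * b $ k)))
               * exp (\<i> * of_real (lam * (\<Sum>k\<in>UNIV. (cmod (z $ k))\<^sup>2 * tan (1 / lam * b $ k)))))
     in has_star_exp lam P E \<and> has_star_exp lam P0 E0
        \<and> ((\<forall>k. \<bar>b $ k\<bar> < lam * pi / 2) \<longrightarrow>
             has_pointwise_star_exp lam P E \<and> has_pointwise_star_exp lam P0 E0)"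
proof -
  interpret Q: quadratic lam c0 a b
    by unfold_locales (use assms in auto)
  \<comment> \<open>The special case is the same construction with \<open>a = 0\<close> and
    \<open>c0 = 0\<close>, where the factors containing them reduce to 1.\<close>
  interpret Q0: quadratic lam 0 0 b
    by unfold_locales (use assms in auto)
  have cos: "cos (b $ k / lam) \<noteq> 0" for k
    using assms(3)[of k] by simp
  have P0: "Q0.P = (\<lambda>z. \<i> * of_real (\<Sum>k\<in>UNIV. b $ k * (cmod (z $ k))\<^sup>2))"
    by (rule ext) (simp add: Q0.P_def bil_def cnjv_def)
  have E0: "Q0.Esym 1 = (\<lambda>z. inverse (of_real (\<Prod>k\<in>UNIV. cos (1 / lam * b $ k)))
               * exp (\<i> * of_real (lam * (\<Sum>k\<in>UNIV. (cmod (z $ k))\<^sup>2 * tan (1 / lam * b $ k)))))"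
    by (rule ext) (simp add: Q0.Esym_1)
  show ?thesis
    unfolding Let_def P0[symmetric] E0[symmetric] Q.P_def[abs_def, symmetric] Q.Esym_1[abs_def, symmetric]
    using Q.has_star_exp_P[OF cos] Q0.has_star_exp_P[OF cos]
      Q.has_pointwise_star_exp_P Q0.has_pointwise_star_exp_P by blast
qed

end
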